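(* Let $(S_n)_{n\ge1}$ and $(\psi_n)_{n\ge1}$ be sequences of real-valued random variables on a probability space $(\mathcal M,\mu)$, and set $\xi_n\equiv1$. Let $r'$ be a positive integer and $r\ge1$ a real number. Assume each $\psi_n$ is a probability density with respect to $\mu$ and let $\mathbb P_n$ be the probability measure on $\mathcal M$ with density $\psi_n$ with respect to $\mu$. Suppose Assumptions $(\alpha)[r']$, $(\beta)$ and $(\delta)[r]$ hold. Then there exist polynomials $P_k$ such that $$\mathbb P_n\left(\frac{S_n}{\sqrt n}\le x\right)=\mathfrak N(x)+\mathfrak n(x)\sum_{k=1}^{\min(r',\lfloor r\rfloor)}\frac{P_k(x)}{n^{k/2}}+o\big(n^{-\min(r,r')/2}\big),$$ uniformly in $x\in\mathbb R$.
   Context: All assumptions below are taken with $\xi_n\equiv 1$ and $\mathbb X=\mathbb R$, $\mathbb X^*=\mathbb R$. $\mathcal{SP}$ is the set of real sequences $(a_n)$ with $a_n=o(n^{-p})$ for every $p>0$; $\mathcal{LP}$ is the set of real sequences $(b_n)$ with $b_n=o(n^{p})$ for every $p>0$. Assumption $(\alpha)[m]$ ($m$ a nonnegative integer): there exist $\delta>0$ and $n_0\ge1$ such that $s\mapsto\mathbb E_\mu(\psi_ne^{isS_n}\xi_n)$ is $C^{m+2}$ on $[-\delta,\delta]$, and there exist $(b_n)\in\mathcal{LP}$, $(a_n)\in\mathcal{SP}$, a $C^{m+2}$ complex-valued function $s\mapsto\lambda(is)$ on $[-\delta,\delta]$ with $\lambda(is)=1-\frac{\sigma^2s^2}{2}+o(s^2)$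 for some $\sigma^2>0$, and constants $B_0,\dots,B_{m+2}$, such that for all $n\ge n_0$, $|s|<\delta$ and $j=0,\dots,m+2$: $|H_n^{(j)}(0)-B_j|=O(a_n)$ and $|\lambda(is)^nH_n^{(j)}(s)|\le b_ne^{-\sigma^2s^2/8}+a_n$, where $H_n(s):=\lambda(is)^{-n}\mathbb E_\mu(\psi_ne^{isS_n}\xi_n)$. Assumption $(\beta)$: for every compact $K\subset\mathbb X^*\setminus\{0\}$ there is $(a_n)\in\mathcal{SP}$ with $\sup_{s\in K}|\mathbb E_\mu(\psi_ne^{isS_n}\xi_n)|\le a_n$. Assumption $(\delta)[r]$ ($r$ real): $\mathbb X=\mathbb R$ and for every $B>0$ there exists $K>0$ such that $\int_{K<|s|<Bn^{(r-1)/2}}\frac{|\mathbb E_\mu(\psi_ne^{isS_n})|}{|s|}\,ds=o(n^{-r/2})$. $\mathfrak N$ and $\mathfrak n$ are the distribution function and density of the centered Gaussian law with variance $\sigma^2$ from $(\alpha)[r']$. *)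

theory Defs
  imports "HOL-Probability.Probability" "HOL-Computational_Algebra.Polynomial"
    "HOL-Library.Landau_Symbols"
begin

definition SP :: "(nat \<Rightarrow> real) set" where
  "SP = {a. \<forall>p>0. a \<in> o(\<lambda>n. real n powr (-p))}"

definition LP :: "(nat \<Rightarrow> real) set" where
  "LP = {b. \<forall>p>0. b \<in> o(\<lambda>n. real n powr p)}"

primrec vderivs :: "nat \<Rightarrow> real set \<Rightarrow> (real \<Rightarrow> complex) \<Rightarrow> real \<Rightarrow> complex" where
  "vderivs 0 S f = f"
| "vderivs (Suc j) S f = (\<lambda>x. vector_derivative (vderivs j S f) (at x within S))"

definition Ck_on :: "nat \<Rightarrow> real set \<Rightarrow> (real \<Rightarrow> complex) \<Rightarrow> bool" where
  "Ck_on k S f \<longleftrightarrow>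
     (\<forall>j<k. \<forall>x\<in>S. (vderivs j S f has_vector_derivative vderivs (Suc j) S f x) (at x within S))
     \<and> continuous_on S (vderivs k S f)"

definition charf :: "'a measure \<Rightarrow> (nat \<Rightarrow> 'a \<Rightarrow> real) \<Rightarrow> (nat \<Rightarrow> 'a \<Rightarrow> real) \<Rightarrow> nat \<Rightarrow> real \<Rightarrow> complex" where
  "charf M S \<psi> n s = (CLINT \<omega>|M. complex_of_real (\<psi> n \<omega>) * cis (s * S n \<omega>))"

text \<open>Assumption (alpha)[m] with xi_n = 1, the variance parameter sigma^2 made explicit.\<close>
definition assm_alpha :: "'a measure \<Rightarrow> (nat \<Rightarrow> 'a \<Rightarrow> real) \<Rightarrow> (nat \<Rightarrow> 'a \<Rightarrow> real) \<Rightarrow> nat \<Rightarrow> real \<Rightarrow> bool" where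
  "assm_alpha M S \<psi> m \<sigma>2 \<longleftrightarrow> \<sigma>2 > 0 \<and>
    (\<exists>\<delta>>0. \<exists>n0::nat. n0 \<ge> 1 \<and>
      (\<forall>n\<ge>n0. Ck_on (m+2) {-\<delta>..\<delta>} (charf M S \<psi> n)) \<and>
      (\<exists>a b (lam :: real \<Rightarrow> complex) (B :: nat \<Rightarrow> complex).
         a \<in> SP \<and> b \<in> LP \<and>
         Ck_on (m+2) {-\<delta>..\<delta>} lam \<and>
         (\<forall>s. \<bar>s\<bar> < \<delta> \<longrightarrow> lam s \<noteq> 0) \<and>
         ((\<lambda>s. (lam s - (1 - complex_of_real (\<sigma>2 * s\<^sup>2 / 2))) / complex_of_real (s\<^sup>2)) \<longlongrightarrow> 0) (at 0) \<and>
         (let H = (\<lambda>n s. inverse (lam s) ^ n * charf M S \<psi> n s) in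
           (\<forall>j\<le>m+2. (\<lambda>n. norm (vderivs j {-\<delta><..<\<delta>} (H n) 0 - B j)) \<in> O(a)) \<and>
           (\<forall>n\<ge>n0. \<forall>s. \<bar>s\<bar> < \<delta> \<longrightarrow> (\<forall>j\<le>m+2.
              norm (lam s ^ n * vderivs j {-\<delta><..<\<delta>} (H n) s)
                \<le> b n * exp (- \<sigma>2 * s\<^sup>2 / 8) + a n)))))"

text \<open>Assumption (beta) with xi_n = 1.\<close>
definition assm_beta :: "'a measure \<Rightarrow> (nat \<Rightarrow> 'a \<Rightarrow> real) \<Rightarrow> (nat \<Rightarrow> 'a \<Rightarrow> real) \<Rightarrow> bool" where
  "assm_beta M S \<psi> \<longleftrightarrow>
    (\<forall>K. compact K \<and> K \<subseteq> - {0::real} \<longrightarrow>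
       (\<exists>a\<in>SP. \<forall>n\<ge>1. \<forall>s\<in>K. norm (charf M S \<psi> n s) \<le> a n))"

definition assm_delta :: "'a measure \<Rightarrow> (nat \<Rightarrow> 'a \<Rightarrow> real) \<Rightarrow> (nat \<Rightarrow> 'a \<Rightarrow> real) \<Rightarrow> real \<Rightarrow> bool" where
  "assm_delta M S \<psi> r \<longleftrightarrow>
    (\<forall>B>0. \<exists>K>0.
       (\<lambda>n. set_lebesgue_integral lborel {s. K < \<bar>s\<bar> \<and> \<bar>s\<bar> < B * real n powr ((r - 1) / 2)}
              (\<lambda>s. norm (charf M S \<psi> n s) / \<bar>s\<bar>))
       \<in> o(\<lambda>n. real n powr (- r / 2)))"

definition gauss_cdf :: "real \<Rightarrow> real \<Rightarrow> real" where
  "gauss_cdf \<sigma>2 x = (LBINT t:{..x}. normal_density 0 (sqrt \<sigma>2) t)"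

end

theory Submission
  imports Defs
begin

text \<open>
  Esseen's smoothing inequality reduces the claim to an estimate of the integral of
  \<open>|\<phi>\<^sub>n(t) - \<gamma>\<^sub>n(t)| / |t|\<close> over \<open>|t| < B n powr (r/2)\<close>, where \<open>\<phi>\<^sub>n\<close> is the characteristic
  function of \<open>S\<^sub>n / sqrt n\<close> under the density \<open>\<psi>\<^sub>n\<close> and \<open>\<gamma>\<^sub>n\<close> is the Fourier transform of the
  candidate expansion; letting \<open>B\<close> grow makes the smoothing error \<open>o(n powr (- r/2))\<close>. With \<open>t = s sqrt n\<close>,
  assumption (delta) covers \<open>|s| > K\<close>, assumption (beta) covers \<open>\<rho> \<le> |s| \<le> K\<close>, and for \<open>|s| < \<rho>\<close>
  one writes \<open>\<phi>\<^sub>n = \<lambda>(s) ^ n H\<^sub>n(s)\<close>.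

  The bound on \<open>\<lambda> ^ n H\<^sub>n\<close> of assumption (alpha) has no decay in \<open>n s\<^sup>2\<close>, but \<open>|\<lambda>|\<close> decreases away from
  the origin so fast that \<open>|\<lambda>(s)| \<le> |\<lambda>(u)| exp (- c |s| |s - u| / 4)\<close> for \<open>u\<close> between \<open>0\<close> and \<open>s\<close>. Hence
  the Taylor remainder of \<open>H\<^sub>n\<close>, multiplied by \<open>\<lambda>(s) ^ n\<close>, is at most
  \<open>b\<^sub>n |s| min (|s| ^ (m+1)) (C / (n |s|) ^ (m+1))\<close>. Finally
  \<open>exp (c s\<^sup>2 / 2) \<lambda>(s) = 1 + s ^ 3 Q(s) + o(s ^ (m+2))\<close> with a polynomial \<open>Q\<close>, and the truncated binomial
  expansion of \<open>(1 + s ^ 3 Q(s)) ^ n\<close> is a polynomial in \<open>t\<close> and \<open>1 / sqrt n\<close>.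
\<close>

section \<open>Esseen smoothing\<close>

text \<open>Esseen's integrand divides by \<bar>t\<bar>, and this shapes every estimate: an error of
  the right size in \<open>n\<close> must also carry a factor \<bar>t\<bar>. All bounds therefore
  end in \<open>abs t * cauchy t\<close>, whose quotient by \<bar>t\<bar> has integral
  \<open>pi\<close>. The factor comes from exact agreement at the origin:
  \<open>H\<^sub>n(0) = 1\<close> for every \<open>n\<close>, hence \<open>B 0 = 1\<close>, hence
  all correction polynomials \<open>A k\<close> with \<open>k \<ge> 1\<close> vanish at 0. The same
  vanishing makes \<open>A k\<close> times the Gaussian the transform of a derivative, so that the
  correction of the distribution function is again the Gaussian density times a polynomial.

  With \<open>v = 1 / sqrt n\<close>, the smoothness \<open>m + 2\<close> exceeds the order
  \<open>v ^ m\<close> of the result by two for two reasons. The Taylor remainder of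
  \<open>H\<^sub>n\<close> is of size \<open>b\<^sub>n v ^ (m + 2)\<close>, and
  \<open>b\<^sub>n \<le> \<epsilon> n\<close> spends \<open>v^2\<close>. The Peano remainder of
  \<lambda> is \<open>o(s ^ (m + 2))\<close> and gets multiplied by \<open>n\<close> when the
  \<open>n\<close>-th power is taken.

  The resulting polynomial in \<open>v\<close> has a degree unrelated to the theorem; cutting it at
  \<open>N = min r' \<lfloor>r\<rfloor>\<close> costs \<open>v ^ (N + 1)\<close>, which is
  negligible because \<open>N + 1 > min r r'\<close>.\<close>

definition fejer :: "real \<Rightarrow> real" where
  "fejer y = (if y = 0 then 1 else 2 * (1 - cos y) / y^2)"

lemma fejer_nonneg: "0 \<le> fejer y"
  by (simp add: fejer_def)

lemma fejer_minus [simp]: "fejer (- y) = fejer y"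
  by (simp add: fejer_def)

lemma fejer_measurable [measurable]: "fejer \<in> borel_measurable borel"
  unfolding fejer_def by measurable

lemma fejer_mult_square_le: "fejer y * y^2 \<le> 4"
proof -
  have "- (2 * cos y) \<le> 2"
    using cos_ge_minus_one[of y] by linarith
  then show ?thesis
    by (simp add: fejer_def)
qed

lemma fejer_le_1: "fejer y \<le> 1"
proof -
  have "(sin (y/2))^2 \<le> (y/2)^2"
    using abs_sin_x_le_abs_x[of "y/2"] by (simp add: abs_le_square_iff[symmetric])
  moreover have "1 - cos y = 2 * (sin (y/2))^2"
    using cos_double_sin[of "y/2"] by simp
  ultimately have "2 * (1 - cos y) \<le> y^2"
    by (simp add: power_divide)
  then show ?thesis
    by (simp add: fejer_def divide_le_eq)
qed

abbreviation cauchy :: "real \<Rightarrow> real" where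
  "cauchy x \<equiv> inverse (1 + x^2)"

text \<open>The 5 is 1 + 4, from the bounds on \<open>fejer y\<close> and on
  \<open>fejer y * y^2\<close>. The function \<open>cauchy\<close> serves as integrable majorant
  throughout, since its integral is known to be \<open>pi\<close>.\<close>

lemma fejer_le: "fejer y \<le> 5 * cauchy y"
proof -
  have "fejer y * (1 + y^2) \<le> 5"
    using fejer_mult_square_le[of y] fejer_le_1[of y] by (simp add: algebra_simps)
  moreover have "0 < 1 + y^2"
    by (simp add: add_pos_nonneg)
  ultimately show ?thesis
    by (simp add: field_simps)
qed

lemma integrable_inverse_square_plus_1: "integrable lborel (\<lambda>x::real. cauchy x)"
  using integrable_inverse_1_plus_square by (simp add: set_integrable_def)

lemma integral_inverse_square_plus_1: "(LBINT x. cauchy x) = pi"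
  using LBINT_inverse_1_plus_square by (simp add: interval_lebesgue_integral_def set_lebesgue_integral_def)

lemma integrable_fejer: "integrable lborel fejer"
proof (rule Bochner_Integration.integrable_bound)
  show "integrable lborel (\<lambda>x::real. 5 * cauchy x)"
    using integrable_inverse_square_plus_1 by simp
qed (use fejer_le fejer_nonneg in \<open>auto intro!: order_trans[OF _ abs_ge_self]\<close>)

text \<open>Positivity is what allows \<open>esseen_const\<close> to divide by this integral. A
  nonnegative function of integral 0 vanishes almost everywhere, whereas the cosine stays below 1 on
  (1/2, 1).\<close>

lemma integral_fejer_pos: "0 < (LBINT y. fejer y)"
proof -
  have "(LBINT y. fejer y) \<noteq> 0"
  proof
    assume "(LBINT y. fejer y) = 0"
    then have "AE y in lborel. fejer y = 0"
      using integral_nonneg_eq_0_iff_AE[OF integrable_fejer] fejer_nonneg by simp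
    then have "AE y in lborel. y \<notin> {1/2<..<1::real}"
    proof eventually_elim
      case (elim y)
      show ?case
      proof
        assume y: "y \<in> {1/2<..<1::real}"
        have "cos y < 1"
          using y pi_gt3 cos_monotone_0_pi[of 0 y] by auto
        then show False
          using elim y by (simp add: fejer_def)
      qed
    qed
    then have "{1/2<..<1::real} \<in> null_sets lborel"
      by (subst AE_iff_null_sets) auto
    then have "emeasure lborel {1/2<..<1::real} = 0"
      by (rule null_setsD1)
    moreover have "emeasure lborel {1/2<..<1::real} = ennreal (1 - 1/2)"
      by (rule emeasure_lborel_Ioo) simp
    ultimately show False
      by (simp add: ennreal_eq_0_iff del: emeasure_lborel_Ioo)
  qed
  moreover have "0 \<le> (LBINT y. fejer y)"
    by (intro integral_nonneg_AE) (simp add: fejer_nonneg)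
  ultimately show ?thesis
    by simp
qed

text \<open>The kernel is the square of \<open>sin (y/2) / (y/2)\<close>, normalised to value 1 at
  0; the triangle function is its compactly supported counterpart. The integral is split at 0
  because of \<bar>t\<bar>, and \<open>y = 0\<close> is separate because the primitives divide by
  \<open>y\<close>.\<close>

lemma fejer_fourier:
  "(CLBINT t. indicator {-1..1} t *\<^sub>R (complex_of_real (1 - \<bar>t\<bar>) * iexp (- (t * y)))) = fejer y"
proof -
  define f where "f = (\<lambda>t::real. complex_of_real (1 - \<bar>t\<bar>) * iexp (- (t * y)))"
  have cont: "continuous_on S f" for S
    unfolding f_def by (intro continuous_intros)
  have "(f has_integral fejer y) {-1..1}"
  proof (cases "y = 0")
    case True
    have "(f has_integral (of_real (0 + 0^2/2) - of_real (-1 + (-1)^2/2))) {-1..0::real}"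
    proof (rule fundamental_theorem_of_calculus)
      fix t :: real assume "t \<in> {-1..0}"
      then have "f t = of_real (1 + t)"
        using True by (simp add: f_def)
      moreover have "((\<lambda>t. t + t^2/2) has_real_derivative 1 + t) (at t within {-1..0})"
        by (auto intro!: derivative_eq_intros)
      ultimately show "((\<lambda>t. complex_of_real (t + t^2/2)) has_vector_derivative f t) (at t within {-1..0})"
        by (simp only: has_vector_derivative_of_real has_real_derivative_iff_has_vector_derivative)
    qed simp
    moreover have "(f has_integral (of_real (1 - 1^2/2) - of_real (0 - 0^2/2))) {0..1::real}"
    proof (rule fundamental_theorem_of_calculus)
      fix t :: real assume "t \<in> {0..1}"
      then have "f t = of_real (1 - t)"
        using True by (simp add: f_def)
      moreover have "((\<lambda>t. t - t^2/2) has_real_derivative 1 - t) (at t within {0..1})"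
        by (auto intro!: derivative_eq_intros)
      ultimately show "((\<lambda>t. complex_of_real (t - t^2/2)) has_vector_derivative f t) (at t within {0..1})"
        by (simp only: has_vector_derivative_of_real has_real_derivative_iff_has_vector_derivative)
    qed simp
    ultimately have "(f has_integral (of_real (0 + 0^2/2) - of_real (-1 + (-1)^2/2)) + (of_real (1 - 1^2/2) - of_real (0 - 0^2/2))) {-1..1}"
      by (intro has_integral_combine[where c = 0]) auto
    then show ?thesis
      using True by (simp add: fejer_def)
  next
    case False
    \<comment> \<open>Primitives of \<open>(1 + t) * iexp (- (t * y))\<close> and
      \<open>(1 - t) * iexp (- (t * y))\<close>, obtained by one integration by parts.\<close>
    define F1 where "F1 = (\<lambda>t::real. \<i> / y * (1 + t) * exp (- \<i> * t * y) + exp (- \<i> * t * y) / y^2)"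
    define F2 where "F2 = (\<lambda>t::real. \<i> / y * (1 - t) * exp (- \<i> * t * y) - exp (- \<i> * t * y) / y^2)"
    have "(f has_integral (F1 0 - F1 (-1))) {-1..0::real}"
    proof (rule fundamental_theorem_of_calculus)
      fix t :: real assume t: "t \<in> {-1..0}"
      show "(F1 has_vector_derivative f t) (at t within {-1..0})"
      proof -
        have "((\<lambda>z. \<i> / y * (1 + z) * exp (- \<i> * z * y) + exp (- \<i> * z * y) / y^2) has_field_derivative f t) (at (of_real t))"
          unfolding f_def using False t
          by (auto intro!: derivative_eq_intros simp: power2_eq_square divide_simps) (simp add: algebra_simps)
        then show ?thesis
          unfolding F1_def by (rule has_vector_derivative_real_field)
      qed
    qed simp
    moreover have "(f has_integral (F2 1 - F2 0)) {0..1::real}"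
    proof (rule fundamental_theorem_of_calculus)
      fix t :: real assume t: "t \<in> {0..1}"
      show "(F2 has_vector_derivative f t) (at t within {0..1})"
      proof -
        have "((\<lambda>z. \<i> / y * (1 - z) * exp (- \<i> * z * y) - exp (- \<i> * z * y) / y^2) has_field_derivative f t) (at (of_real t))"
          unfolding f_def using False t
          by (auto intro!: derivative_eq_intros simp: power2_eq_square divide_simps) (simp add: algebra_simps)
        then show ?thesis
          unfolding F2_def by (rule has_vector_derivative_real_field)
      qed
    qed simp
    ultimately have "(f has_integral (F1 0 - F1 (-1)) + (F2 1 - F2 0)) {-1..1}"
      by (intro has_integral_combine[where c = 0]) auto
    moreover have "(F1 0 - F1 (-1)) + (F2 1 - F2 0) = fejer y"
      using False by (simp add: F1_def F2_def fejer_def field_simps cos_exp_eq flip: cos_of_real)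
    ultimately show ?thesis
      by simp
  qed
  moreover have "set_integrable lborel {-1..1} f"
    by (intro borel_integrable_atLeastAtMost' cont)
  ultimately show ?thesis
    using set_borel_integral_eq_integral(2)[of "{-1..1}" f]
    by (simp add: f_def set_lebesgue_integral_def integral_unique)
qed

section \<open>Fourier transform and distribution function of a complex density\<close>

definition ft :: "real measure \<Rightarrow> (real \<Rightarrow> complex) \<Rightarrow> real \<Rightarrow> complex" where
  "ft \<nu> h t = (CLINT z|\<nu>. h z * iexp (t * z))"

definition lower_mass :: "real measure \<Rightarrow> (real \<Rightarrow> complex) \<Rightarrow> real \<Rightarrow> complex" where
  "lower_mass \<nu> h x = (CLINT z|\<nu>. indicator {..x} z *\<^sub>R h z)"

text \<open>Both sides of Esseen's inequality live here: a probability law is \<open>\<nu>\<close>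
  with density 1, the candidate expansion is \<open>lborel\<close> with its density. The density is
  complex because the polynomials of the candidate are, and real parts are taken only at the
  end.\<close>

locale complex_density = sigma_finite_measure \<nu> for \<nu> :: "real measure" +
  fixes h :: "real \<Rightarrow> complex"
  assumes sets_eq [measurable_cong]: "sets \<nu> = sets borel"
    and integrable_density: "integrable \<nu> h"
begin

lemma density_measurable [measurable]: "h \<in> borel_measurable borel"
  using integrable_density sets_eq by (metis borel_measurable_integrable measurable_cong_sets)

lemma integrable_indicator_density: "integrable \<nu> (\<lambda>z. indicator {..x} z *\<^sub>R h z)"
  by (rule Bochner_Integration.integrable_bound[OF integrable_density])
     (auto simp: indicator_def)

lemma integrable_ft: "integrable \<nu> (\<lambda>z. h z * iexp (t * z))"
  by (rule Bochner_Integration.integrable_bound[OF integrable_density])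
     (auto simp: norm_mult)

lemma norm_ft_le: "norm (ft \<nu> h t) \<le> (LINT z|\<nu>. norm (h z))"
  unfolding ft_def by (rule order_trans[OF integral_norm_bound]) (simp add: norm_mult)

lemma norm_lower_mass_le: "norm (lower_mass \<nu> h x) \<le> (LINT z|\<nu>. norm (h z))"
  unfolding lower_mass_def
  by (rule order_trans[OF integral_norm_bound], rule integral_mono)
     (use integrable_norm[OF integrable_indicator_density] integrable_density in \<open>auto simp: indicator_def\<close>)

lemma lower_mass_measurable [measurable]: "lower_mass \<nu> h \<in> borel_measurable borel"
proof -
  have "(\<lambda>x. CLINT z|\<nu>. (if z \<le> x then h z else 0)) \<in> borel_measurable borel"
    by measurable
  then show ?thesis
    unfolding lower_mass_def[abs_def]
    by (rule measurable_cong[THEN iffD1, rotated])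
       (auto intro!: Bochner_Integration.integral_cong simp: indicator_def)
qed

lemma ft_measurable [measurable]: "ft \<nu> h \<in> borel_measurable borel"
  unfolding ft_def[abs_def] by measurable

lemma lower_mass_diff:
  assumes "x \<le> y"
  shows "lower_mass \<nu> h y - lower_mass \<nu> h x = (CLINT z|\<nu>. indicator {x<..y} z *\<^sub>R h z)"
proof -
  have "lower_mass \<nu> h y - lower_mass \<nu> h x
      = (CLINT z|\<nu>. indicator {..y} z *\<^sub>R h z - indicator {..x} z *\<^sub>R h z)"
    unfolding lower_mass_def
    by (rule Bochner_Integration.integral_diff[symmetric]) (rule integrable_indicator_density)+
  also have "\<dots> = (CLINT z|\<nu>. indicator {x<..y} z *\<^sub>R h z)"
    using assms by (intro Bochner_Integration.integral_cong) (auto simp: indicator_def)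
  finally show ?thesis .
qed

lemma lower_mass_lim: "(\<lambda>k. lower_mass \<nu> h (c - real k)) \<longlonglongrightarrow> 0"
proof -
  have "(\<lambda>k. CLINT z|\<nu>. indicator {..c - real k} z *\<^sub>R h z) \<longlonglongrightarrow> (CLINT z|\<nu>. 0)"
  proof (rule integral_dominated_convergence[where w = "\<lambda>z. norm (h z)"])
    show "AE z in \<nu>. (\<lambda>k. indicator {..c - real k} z *\<^sub>R h z) \<longlonglongrightarrow> 0"
    proof (rule AE_I2)
      fix z
      obtain K :: nat where K: "real K > c - z"
        using reals_Archimedean2 by blast
      have "\<forall>\<^sub>F k in sequentially. indicator {..c - real k} z *\<^sub>R h z = 0"
        using eventually_ge_at_top[of K] by eventually_elim (use K in auto)
      then show "(\<lambda>k. indicator {..c - real k} z *\<^sub>R h z) \<longlonglongrightarrow> 0"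
        by (rule tendsto_eventually)
    qed
  qed (use integrable_density in \<open>auto simp: indicator_def\<close>)
  then show ?thesis
    by (simp add: lower_mass_def)
qed

lemma integrable_lower_mass_fejer: "complex_integrable lborel (\<lambda>y. lower_mass \<nu> h (x - y / T) * fejer y)"
proof (rule Bochner_Integration.integrable_bound)
  show "integrable lborel (\<lambda>y. (LINT z|\<nu>. norm (h z)) * fejer y)"
    using integrable_fejer by simp
  show "AE y in lborel. norm (lower_mass \<nu> h (x - y / T) * fejer y) \<le> norm ((LINT z|\<nu>. norm (h z)) * fejer y)"
    using norm_lower_mass_le fejer_nonneg
    by (auto simp: norm_mult intro!: mult_right_mono order_trans[OF _ abs_ge_self])
qed measurable

text \<open>Smoothing by the Fejer kernel cuts the Fourier transform off at frequency \<open>T\<close>.\<close>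
lemma fejer_smoothing_increment:
  assumes T: "T > 0" and ab: "a \<le> b"
  shows "(CLBINT y. (lower_mass \<nu> h (b - y / T) - lower_mass \<nu> h (a - y / T)) * fejer y) =
    T * (CLBINT t. indicator {-1..1} t *\<^sub>R (complex_of_real (1 - \<bar>t\<bar>) * ft \<nu> h (t * T) *
           (CLBINT x. indicator {a<..b} x *\<^sub>R iexp (- (t * T * x)))))"
proof -
  interpret P: pair_sigma_finite lborel \<nu> ..
  have ind: "integrable lborel (indicator {a<..b} :: real \<Rightarrow> real)" "integrable lborel (indicator {-1..1} :: real \<Rightarrow> real)"
    by (auto intro!: integrable_real_indicator simp: emeasure_lborel_Icc_eq ab)
  let ?e = "\<lambda>t x. complex_of_real (1 - \<bar>t\<bar>) * ft \<nu> h (t * T) * iexp (- (t * T * x))"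
  let ?k = "\<lambda>t x z. indicator {-1..1} t *\<^sub>R (complex_of_real (1 - \<bar>t\<bar>) * iexp (- (t * (T * (x - z)))) * h z)"
  let ?f = "\<lambda>x z. T *\<^sub>R ((indicator {a<..b} x * fejer (T * (x - z))) *\<^sub>R h z)"
  let ?K = "\<lambda>x t. T *\<^sub>R (indicator {a<..b} x *\<^sub>R indicator {-1..1} t *\<^sub>R ?e t x)"
  let ?J = "\<lambda>t. CLBINT x. indicator {a<..b} x *\<^sub>R iexp (- (t * T * x))"
  let ?I = "\<lambda>y z. indicator {a<..b} (z + y / T) :: real"
  have diff: "lower_mass \<nu> h (b - y / T) - lower_mass \<nu> h (a - y / T) = (CLINT z|\<nu>. ?I y z *\<^sub>R h z)" for y
    using ab by (subst lower_mass_diff) (auto intro!: Bochner_Integration.integral_cong simp: indicator_def)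
  have "(CLBINT y. (lower_mass \<nu> h (b - y / T) - lower_mass \<nu> h (a - y / T)) * fejer y)
      = (CLBINT y. (CLINT z|\<nu>. (?I y z * fejer y) *\<^sub>R h z))"
    unfolding diff by (intro Bochner_Integration.integral_cong refl)
      (simp add: scaleR_conv_of_real mult_ac flip: integral_mult_right_zero)
  also have "\<dots> = (CLINT z|\<nu>. (CLBINT y. (?I y z * fejer y) *\<^sub>R h z))"
  proof (rule P.Fubini_integral[symmetric])
    have "integrable (lborel \<Otimes>\<^sub>M \<nu>) (\<lambda>p. fejer (fst p) *\<^sub>R h (snd p))"
      by (rule P.Fubini_integrable) (use integrable_fejer integrable_density in auto)
    then show "integrable (lborel \<Otimes>\<^sub>M \<nu>) (\<lambda>(y, z). (?I y z * fejer y) *\<^sub>R h z)"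
      by (rule Bochner_Integration.integrable_bound)
         (auto simp: indicator_def fejer_nonneg split_beta)
  qed
  \<comment> \<open>Substituting \<open>y = T * (x - z)\<close> frees the window
    \<open>(a, b]\<close> from \<open>z\<close> and moves the dependence on \<open>z\<close> into
    the kernel.\<close>
  also have "\<dots> = (CLINT z|\<nu>. (CLBINT x. ?f x z))"
  proof (rule Bochner_Integration.integral_cong[OF refl])
    fix z
    have "(CLBINT y. (?I y z * fejer y) *\<^sub>R h z) = \<bar>T\<bar> *\<^sub>R (CLBINT x. (?I (- T * z + T * x) z * fejer (- T * z + T * x)) *\<^sub>R h z)"
      by (rule lborel_integral_real_affine) (use T in simp)
    also have "\<dots> = \<bar>T\<bar> *\<^sub>R (CLBINT x. ((indicator {a<..b} x * fejer (T * (x - z))) *\<^sub>R h z))"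
      using T by (intro arg_cong2[where f = scaleR] refl Bochner_Integration.integral_cong) (auto simp: field_simps)
    finally show "(CLBINT y. (?I y z * fejer y) *\<^sub>R h z) = (CLBINT x. ?f x z)"
      unfolding integral_scaleR_right using T by simp
  qed
  also have "\<dots> = (CLBINT x. (CLINT z|\<nu>. ?f x z))"
  proof (rule P.Fubini_integral)
    have "integrable (lborel \<Otimes>\<^sub>M \<nu>) (\<lambda>p. (indicator {a<..b} (fst p) :: real) *\<^sub>R h (snd p))"
      by (rule P.Fubini_integrable) (use integrable_density ind in auto)
    then have "integrable (lborel \<Otimes>\<^sub>M \<nu>) (\<lambda>p. T *\<^sub>R ((indicator {a<..b} (fst p) :: real) *\<^sub>R h (snd p)))"
      by (rule integrable_scaleR_right)
    then show "integrable (lborel \<Otimes>\<^sub>M \<nu>) (\<lambda>(x, z). ?f x z)"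
    proof (rule Bochner_Integration.integrable_bound)
      show "AE p in lborel \<Otimes>\<^sub>M \<nu>. norm (case p of (x, z) \<Rightarrow> ?f x z)
             \<le> norm (T *\<^sub>R ((indicator {a<..b} (fst p) :: real) *\<^sub>R h (snd p)))"
        using T by (auto simp: indicator_def fejer_nonneg split_beta fejer_le_1 intro!: mult_left_le_one_le)
    qed measurable
  qed
  \<comment> \<open>The kernel is replaced by its Fourier representation; after exchanging
    integrals, the factor depending on \<open>z\<close> integrates to
    \<open>ft \<nu> h (t * T)\<close>.\<close>
  also have "\<dots> = (CLBINT x. (CLBINT t. ?K x t))"
  proof (rule Bochner_Integration.integral_cong[OF refl])
    fix x
    have "(CLINT z|\<nu>. fejer (T * (x - z)) *\<^sub>R h z)
        = (CLINT z|\<nu>. (CLBINT t. ?k t x z))"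
      by (intro Bochner_Integration.integral_cong refl)
         (simp add: scaleR_conv_of_real fejer_fourier[symmetric] mult_ac flip: integral_mult_left_zero)
    also have "\<dots> = (CLBINT t. (CLINT z|\<nu>. ?k t x z))"
    proof (rule P.Fubini_integral)
      have "integrable (lborel \<Otimes>\<^sub>M \<nu>) (\<lambda>p. (indicator {-1..1::real} (fst p) :: real) *\<^sub>R h (snd p))"
        by (rule P.Fubini_integrable) (use integrable_density ind in auto)
      then show "integrable (lborel \<Otimes>\<^sub>M \<nu>) (\<lambda>(t, z). ?k t x z)"
        by (rule Bochner_Integration.integrable_bound)
           (auto simp: indicator_def norm_mult split_beta simp flip: of_real_diff intro!: mult_left_le_one_le)
    qed
    also have "\<dots> = (CLBINT t. indicator {-1..1} t *\<^sub>R
                    (?e t x))"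
    proof (rule Bochner_Integration.integral_cong[OF refl])
      fix t
      have "(CLINT z|\<nu>. ?k t x z)
         = (CLINT z|\<nu>. (indicator {-1..1} t *\<^sub>R (complex_of_real (1 - \<bar>t\<bar>) * iexp (- (t * T * x)))) * (h z * iexp (t * T * z)))"
        by (intro Bochner_Integration.integral_cong refl)
           (simp add: algebra_simps flip: exp_add)
      also have "\<dots> = indicator {-1..1} t *\<^sub>R (complex_of_real (1 - \<bar>t\<bar>) * iexp (- (t * T * x))) * ft \<nu> h (t * T)"
        unfolding ft_def by (rule integral_mult_right_zero)
      finally show "(CLINT z|\<nu>. ?k t x z)
         = indicator {-1..1} t *\<^sub>R (?e t x)"
        by (simp add: mult_ac)
    qed
    finally have "(CLINT z|\<nu>. fejer (T * (x - z)) *\<^sub>R h z) = (CLBINT t. indicator {-1..1} t *\<^sub>R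
                    (?e t x))" .
    then show "(CLINT z|\<nu>. ?f x z) =
        (CLBINT t. ?K x t)"
      by (simp only: integral_scaleR_right scaleR_scaleR[symmetric])
  qed
  also have "\<dots> = (CLBINT t. (CLBINT x. ?K x t))"
  proof (rule lborel_pair.Fubini_integral[symmetric])
    let ?C = "LINT z|\<nu>. norm (h z)"
    have "integrable (lborel \<Otimes>\<^sub>M lborel) (\<lambda>p. (indicator {a<..b} (fst p) * indicator {-1..1::real} (snd p)) * (T * ?C) :: real)"
      by (rule lborel_pair.Fubini_integrable) (use T ind in \<open>auto simp: abs_mult\<close>)
    then show "integrable (lborel \<Otimes>\<^sub>M lborel) (\<lambda>(x, t). ?K x t)"
    proof (rule Bochner_Integration.integrable_bound)
      have "norm (?e t x) \<le> ?C"
        if "t \<in> {-1..1}" for t x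
      proof -
        have "norm (?e t x) = \<bar>1 - \<bar>t\<bar>\<bar> * norm (ft \<nu> h (t * T))"
          by (simp add: norm_mult flip: of_real_diff)
        also have "\<dots> \<le> 1 * ?C"
          using that by (intro mult_mono norm_ft_le) auto
        finally show ?thesis by simp
      qed
      then show "AE p in lborel \<Otimes>\<^sub>M lborel. norm (case p of (x, t) \<Rightarrow> ?K x t)
             \<le> norm ((indicator {a<..b} (fst p) * indicator {-1..1} (snd p)) * (T * ?C) :: real)"
        using T by (auto simp: indicator_def split_beta abs_mult intro!: mult_left_mono order_trans[OF _ abs_ge_self])
    qed measurable
  qed
  also have "\<dots> = (CLBINT t. T * (indicator {-1..1} t *\<^sub>R (complex_of_real (1 - \<bar>t\<bar>) * ft \<nu> h (t * T) *
           ?J t)))"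
  proof (rule Bochner_Integration.integral_cong[OF refl])
    fix t
    have "(CLBINT x. ?K x t)
       = (CLBINT x. (T * (indicator {-1..1} t *\<^sub>R (complex_of_real (1 - \<bar>t\<bar>) * ft \<nu> h (t * T)))) *
             (indicator {a<..b} x *\<^sub>R iexp (- (t * T * x))))"
      by (intro Bochner_Integration.integral_cong refl) (simp add: scaleR_conv_of_real mult_ac)
    also have "\<dots> = (T * (indicator {-1..1} t *\<^sub>R (complex_of_real (1 - \<bar>t\<bar>) * ft \<nu> h (t * T)))) *
             ?J t"
      by (rule integral_mult_right_zero)
    finally show "(CLBINT x. ?K x t)
       = T * (indicator {-1..1} t *\<^sub>R (complex_of_real (1 - \<bar>t\<bar>) * ft \<nu> h (t * T) *
           ?J t))"
      by (simp add: scaleR_conv_of_real mult_ac)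
  qed
  also have "\<dots> = T * (CLBINT t. indicator {-1..1} t *\<^sub>R (complex_of_real (1 - \<bar>t\<bar>) * ft \<nu> h (t * T) *
           ?J t))"
    by (rule integral_mult_right_zero)
  finally show ?thesis .
qed

end

text \<open>This is the source of the factor \<open>1 / \<bar>t\<bar>\<close> in Esseen's
  inequality; it does not depend on the length of the interval.\<close>

lemma norm_integral_iexp_le:
  assumes "a \<le> b" and \<theta>: "\<theta> \<noteq> 0"
  shows "norm (CLBINT x. indicator {a<..b} x *\<^sub>R iexp (- (\<theta> * x))) \<le> 2 / \<bar>\<theta>\<bar>"
proof -
  define F where "F = (\<lambda>x::real. \<i> / \<theta> * exp (- \<i> * \<theta> * x))"
  have "(CLBINT x. indicator {a<..b} x *\<^sub>R iexp (- (\<theta> * x))) = (CLBINT x=a..b. iexp (- (\<theta> * x)))"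
    using assms by (simp add: interval_integral_Ioc set_lebesgue_integral_def)
  also have "\<dots> = F b - F a"
  proof (rule interval_integral_FTC_finite)
    fix x :: real
    have "((\<lambda>z. \<i> / \<theta> * exp (- \<i> * \<theta> * z)) has_field_derivative iexp (- (\<theta> * x))) (at (of_real x))"
      using \<theta> by (auto intro!: derivative_eq_intros simp: mult.assoc)
    then show "(F has_vector_derivative iexp (- (\<theta> * x))) (at x within {min a b..max a b})"
      unfolding F_def by (rule has_vector_derivative_real_field)
  qed (intro continuous_intros)
  also have "norm \<dots> \<le> norm (F b) + norm (F a)"
    by (rule norm_triangle_ineq4)
  also have "\<dots> = 2 / \<bar>\<theta>\<bar>"
    by (simp add: F_def norm_mult norm_divide)
  finally show ?thesis .
qed

text \<open>Complements the previous bound, which degenerates as \<open>\<theta>\<close> tends to 0: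
  this one gives integrability in \<open>t\<close> across the origin.\<close>

lemma norm_integral_iexp_le_length:
  assumes "a \<le> b"
  shows "norm (CLBINT x. indicator {a<..b} x *\<^sub>R iexp (- (\<theta> * x))) \<le> b - a"
proof -
  have "norm (CLBINT x. indicator {a<..b} x *\<^sub>R iexp (- (\<theta> * x))) \<le> (LBINT x. indicator {a<..b} x)"
    by (rule order_trans[OF integral_norm_bound]) simp
  then show ?thesis
    using assms by simp
qed

text \<open>Working with increments avoids the singular kernel \<open>1 / t\<close> of Fourier
  inversion: the window \<open>(a, b]\<close> contributes at most
  \<open>2 / \<bar>\<theta>\<bar>\<close>, so \<open>2 * I\<close> bounds every increment whatever
  \<open>a\<close> is, and \<open>a\<close> may run to minus infinity. The hypothesis uses the
  nonnegative integral, which is meaningful without first proving the quotient integrable near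
  0.\<close>

lemma fejer_smoothed_difference_le:
  assumes "complex_density \<nu>1 h1" "complex_density \<nu>2 h2" and T: "T > 0" and I: "I \<ge> 0"
    and le: "(\<integral>\<^sup>+t. indicator {-T<..<T} t * ennreal (norm (ft \<nu>1 h1 t - ft \<nu>2 h2 t) / \<bar>t\<bar>) \<partial>lborel) \<le> ennreal I"
  shows "norm (CLBINT y. (lower_mass \<nu>1 h1 (x - y / T) - lower_mass \<nu>2 h2 (x - y / T)) * fejer y) \<le> 2 * I"
proof -
  interpret N1: complex_density \<nu>1 h1 by fact
  interpret N2: complex_density \<nu>2 h2 by fact
  let ?L1 = "lower_mass \<nu>1 h1" and ?L2 = "lower_mass \<nu>2 h2"
  let ?\<Delta> = "\<lambda>t. ft \<nu>1 h1 t - ft \<nu>2 h2 t"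
  define C where "C = (LINT z|\<nu>1. norm (h1 z)) + (LINT z|\<nu>2. norm (h2 z))"
  define D where "D x = (CLBINT y. (?L1 (x - y / T) - ?L2 (x - y / T)) * fejer y)" for x
  have [measurable]: "(\<lambda>t. CLBINT x. indicator {a<..b} x *\<^sub>R iexp (- (t * T * x))) \<in> borel_measurable lborel" for a b
    by measurable
  have D_eq: "D x = (CLBINT y. ?L1 (x - y / T) * fejer y) - (CLBINT y. ?L2 (x - y / T) * fejer y)" for x
    unfolding D_def left_diff_distrib
    by (intro Bochner_Integration.integral_diff N1.integrable_lower_mass_fejer N2.integrable_lower_mass_fejer)
  have incr: "norm (D b - D a) \<le> 2 * I" if ab: "a \<le> b" for a b
  proof -
    define J where "J t = (CLBINT x. indicator {a<..b} x *\<^sub>R iexp (- (t * T * x)))" for t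
    have [measurable]: "J \<in> borel_measurable borel"
      unfolding J_def[abs_def] by measurable
    define E where "E h \<nu> t = indicator {-1..1::real} t *\<^sub>R (complex_of_real (1 - \<bar>t\<bar>) * ft \<nu> h (t * T) * J t)" for h \<nu> t
    let ?E = "\<lambda>t. E h1 \<nu>1 t - E h2 \<nu>2 t"
    let ?w = "\<lambda>t. indicator {-T<..<T} (0 + T * t) * ennreal (norm (?\<Delta> (0 + T * t)) / \<bar>0 + T * t\<bar>)"
    have E_int: "complex_integrable lborel (E h \<nu>)" if "complex_density \<nu> h" for \<nu> h
    proof -
      interpret complex_density \<nu> h by fact
      show ?thesis
      proof (rule Bochner_Integration.integrable_bound)
        let ?C = "LINT z|\<nu>. norm (h z)"
        show "integrable lborel (\<lambda>t::real. indicator {-1..1} t * (?C * (b - a)) :: real)"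
          by (rule integrable_mult_left, rule integrable_real_indicator) (auto simp: emeasure_lborel_Icc_eq)
        have "norm (complex_of_real (1 - \<bar>t\<bar>) * ft \<nu> h (t * T) * J t) \<le> 1 * ?C * (b - a)"
          if "t \<in> {-1..1}" for t
          unfolding norm_mult
          using that norm_integral_iexp_le_length[OF ab, of "t * T"]
          by (intro mult_mono norm_ft_le) (auto simp: J_def simp flip: of_real_diff)
        then show "AE t in lborel. norm (E h \<nu> t) \<le> norm (indicator {-1..1} t * (?C * (b - a)) :: real)"
          by (auto simp: E_def indicator_def intro!: order_trans[OF _ abs_ge_self])
      qed (simp add: E_def[abs_def])
    qed
    have step: "(CLBINT y. lower_mass \<nu> h (b - y / T) * fejer y) - (CLBINT y. lower_mass \<nu> h (a - y / T) * fejer y)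
        = T * (CLBINT t. E h \<nu> t)" if "complex_density \<nu> h" for \<nu> h
    proof -
      interpret complex_density \<nu> h by fact
      show ?thesis
        using fejer_smoothing_increment[OF T ab] integrable_lower_mass_fejer
        by (simp add: left_diff_distrib E_def J_def)
    qed
    have "D b - D a = T * (CLBINT t. E h1 \<nu>1 t) - T * (CLBINT t. E h2 \<nu>2 t)"
      unfolding D_eq using step[OF assms(1)] step[OF assms(2)] by (simp add: algebra_simps)
    also have "\<dots> = (CLBINT t. T * ?E t)"
      using E_int[OF assms(1)] E_int[OF assms(2)] by (simp add: right_diff_distrib)
    finally have "D b - D a = (CLBINT t. T * ?E t)" .
    moreover have "complex_integrable lborel (\<lambda>t. T * ?E t)"
      using E_int[OF assms(1)] E_int[OF assms(2)] by simp
    ultimately have "ennreal (norm (D b - D a)) \<le> (\<integral>\<^sup>+t. norm (T * ?E t) \<partial>lborel)"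
      by (simp only: integral_norm_bound_ennreal)
    also have "\<dots> \<le> (\<integral>\<^sup>+t. ennreal (2 * T) * ?w t \<partial>lborel)"
    proof (rule nn_integral_mono_AE)
      \<comment> \<open>At \<open>t = 0\<close> the right-hand quotient is 0 by the convention on
        division, so the pointwise bound may fail there.\<close>
      have "AE t in lborel. t \<noteq> (0::real)"
        by (rule AE_lborel_singleton)
      then show "AE t in lborel. ennreal (norm (T * ?E t)) \<le>
          ennreal (2 * T) * ?w t"
      proof eventually_elim
        case (elim t)
        have eq: "?E t = indicator {-1..1} t *\<^sub>R (complex_of_real (1 - \<bar>t\<bar>) * ?\<Delta> (t * T) * J t)"
          by (simp add: E_def algebra_simps)
        show ?case
        proof (cases "t \<in> {-1<..<1}")
          case True
          have "norm (T * ?E t) = T * (\<bar>1 - \<bar>t\<bar>\<bar> * norm (?\<Delta> (t * T)) * norm (J t))"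
            unfolding eq using T True by (simp add: norm_mult flip: of_real_diff)
          also have "\<dots> \<le> T * (1 * norm (?\<Delta> (t * T)) * (2 / \<bar>t * T\<bar>))"
            using T True elim norm_integral_iexp_le[OF ab, of "t * T"]
            by (intro mult_left_mono mult_mono) (auto simp: J_def)
          also have "\<dots> = 2 * T * (norm (?\<Delta> (T * t)) / \<bar>T * t\<bar>)"
            by (simp add: mult_ac)
          finally have "norm (T * ?E t) \<le> 2 * T * (norm (?\<Delta> (T * t)) / \<bar>T * t\<bar>)" .
          moreover have "T * t \<in> {-T<..<T}"
          proof -
            have "T * (- 1) < T * t" "T * t < T * 1"
              using T True by (intro mult_strict_left_mono; simp)+
            then show ?thesis by simp
          qed
          ultimately show ?thesis
            using T by (simp add: ennreal_mult'[symmetric] ennreal_leI)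
        next
          \<comment> \<open>This includes \<open>t = 1\<close> and \<open>t = - 1\<close>, where the
            factor \<open>1 - \<bar>t\<bar>\<close> vanishes; so the closed support of the triangle
            function fits the open interval of the hypothesis.\<close>
          case False
          then have "?E t = 0"
            unfolding eq by (auto simp: indicator_def)
          then show ?thesis
            by simp
        qed
      qed
    qed
    also have "\<dots> = 2 * (\<bar>T\<bar> * (\<integral>\<^sup>+t. ?w t \<partial>lborel))"
      using T by (subst nn_integral_cmult) (auto simp: ennreal_mult mult.assoc)
    also have "\<dots> = 2 * (\<integral>\<^sup>+t. indicator {-T<..<T} t * ennreal (norm (?\<Delta> t) / \<bar>t\<bar>) \<partial>lborel)"
      using T by (subst nn_integral_real_affine[where c = T and t = 0]) auto
    also have "\<dots> \<le> 2 * ennreal I"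
      using le by (rule mult_left_mono) simp
    also have "\<dots> = ennreal (2 * I)"
      using I by (simp add: ennreal_mult)
    finally show ?thesis
      using I by simp
  qed
  let ?g = "\<lambda>k y. (?L1 (x - real k - y / T) - ?L2 (x - real k - y / T)) * fejer y"
  \<comment> \<open>Both distribution functions vanish at minus infinity, and the kernel dominates
    the integrands uniformly in \<open>k\<close>.\<close>
  have "(\<lambda>k. D (x - real k)) \<longlonglongrightarrow> integral\<^sup>L (lborel :: real measure) (\<lambda>_. 0)"
    unfolding D_def
  proof (rule integral_dominated_convergence[where w = "\<lambda>y. C * fejer y"])
    show "integrable lborel (\<lambda>y. C * fejer y)"
      using integrable_fejer by simp
    show "AE y in lborel. (\<lambda>k. ?g k y) \<longlonglongrightarrow> 0"
    proof (rule AE_I2)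
      fix y
      have "(\<lambda>k. (?L1 ((x - y / T) - real k) - ?L2 ((x - y / T) - real k)) * fejer y) \<longlonglongrightarrow> (0 - 0) * complex_of_real (fejer y)"
        by (intro tendsto_intros N1.lower_mass_lim N2.lower_mass_lim)
      then show "(\<lambda>k. ?g k y) \<longlonglongrightarrow> 0"
        by (simp add: algebra_simps)
    qed
    fix k
    show "AE y in lborel. norm (?g k y) \<le> C * fejer y"
      using N1.norm_lower_mass_le N2.norm_lower_mass_le fejer_nonneg
      by (auto simp: norm_mult C_def intro!: mult_right_mono order_trans[OF norm_triangle_ineq4] add_mono)
  qed measurable
  then have "(\<lambda>k. norm (D x - D (x - real k))) \<longlonglongrightarrow> norm (D x - 0)"
    by (intro tendsto_intros) simp
  then have "norm (D x - 0) \<le> 2 * I"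
    by (rule LIMSEQ_le_const2) (use incr in auto)
  then show ?thesis
    by (simp add: D_def)
qed

text \<open>On the tail \<open>w^2 + y^2 \<le> 2 * y^2\<close>, so
  \<open>fejer y * y^2 \<le> 4\<close> gives \<open>fejer y \<le> 8 / (w^2 + y^2)\<close>, a
  rescaled Cauchy function whose integral over the whole line is explicit.\<close>

lemma integral_fejer_tail_le:
  assumes w: "w > 0"
  shows "(LBINT y. indicator {y. w \<le> \<bar>y\<bar>} y * fejer y) \<le> 8 * pi / w"
    and "integrable lborel (\<lambda>y. indicator {y. w \<le> \<bar>y\<bar>} y * fejer y)"
proof -
  let ?t = "\<lambda>y. indicator {y. w \<le> \<bar>y\<bar>} y * fejer y"
  show int: "integrable lborel (\<lambda>y. ?t y)"
    by (rule Bochner_Integration.integrable_bound[OF integrable_fejer]) (auto simp: indicator_def)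
  let ?g = "\<lambda>y. 8 / w^2 * inverse (1 + (y / w)^2)"
  have "integrable lborel (\<lambda>y. inverse (1 + (0 + inverse w * y)^2))"
    using integrable_inverse_square_plus_1 w by (subst lborel_integrable_real_affine_iff) auto
  then have int': "integrable lborel ?g"
    by (intro integrable_mult_right) (simp add: divide_inverse_commute)
  have "(LBINT y. inverse (1 + (y / w)^2)) = abs w *\<^sub>R (LBINT y. inverse (1 + ((0 + w * y) / w)^2))"
    using w by (intro lborel_integral_real_affine) simp
  also have "\<dots> = w * pi"
    using w by (simp add: integral_inverse_square_plus_1 del: inverse_eq_divide)
  finally have "(LBINT y. inverse (1 + (y / w)^2)) = w * pi" .
  then have "(LBINT y. ?g y) = 8 / w^2 * (w * pi)"
    by (simp only: integral_mult_right_zero)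
  then have "(LBINT y. ?g y) = 8 * pi / w"
    using w by (simp add: power2_eq_square)
  moreover have "(LBINT y. ?t y) \<le> (LBINT y. ?g y)"
  proof (rule integral_mono[OF int int'])
    fix y
    show "?t y \<le> ?g y"
    proof (cases "w \<le> \<bar>y\<bar>")
      case True
      have "w^2 \<le> y^2"
        using True w by (simp add: abs_le_square_iff[symmetric])
      then have "fejer y * (w^2 + y^2) \<le> fejer y * (2 * y^2)"
        by (intro mult_left_mono fejer_nonneg) simp
      also have "\<dots> \<le> 8"
        using fejer_mult_square_le[of y] by simp
      finally have "fejer y \<le> 8 / (w^2 + y^2)"
        using w by (simp add: pos_le_divide_eq add_pos_nonneg)
      also have "\<dots> = ?g y"
        using w by (simp add: field_simps)
      finally show ?thesis
        using True by simp
    qed (use w in simp)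
  qed
  ultimately show "(LBINT y. ?t y) \<le> 8 * pi / w"
    by simp
qed

text \<open>From the near-maximum \<open>z\<close>, \<open>D\<close> cannot fall faster than with
  slope \<open>m\<close>. Over a length \<open>2 * h\<close> with \<open>m * h = \<eta> / 8\<close>
  it loses at most \<open>\<eta> / 4\<close>, hence stays above \<open>5 / 8 * \<eta>\<close>.
  Smoothing at the midpoint \<open>z + h\<close> sees these values for
  \<open>\<bar>y\<bar> < w = h * T\<close>; elsewhere \<open>D \<ge> - \<eta>\<close>, which
  accounts for 13/8 = 5/8 + 1. In the tail term \<open>\<eta>\<close> cancels:
  \<open>13 / 8 * \<eta> * 8 * pi / w = 104 * pi * m / T\<close>.\<close>

lemma fejer_smoothing_lower:
  fixes D :: "real \<Rightarrow> real"
  assumes [measurable]: "D \<in> borel_measurable borel"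
    and bnd: "\<And>x. \<bar>D x\<bar> \<le> \<eta>" and pos: "\<eta> > 0" "m > 0" "T > 0"
    and lip: "\<And>x y. x \<le> y \<Longrightarrow> D x - m * (y - x) \<le> D y"
    and z: "7 / 8 * \<eta> \<le> D z"
    and J: "\<And>x. (LBINT y. D (x - y / T) * fejer y) \<le> J"
  shows "5 / 8 * \<eta> * (LBINT y. fejer y) \<le> J + 104 * pi * m / T"
proof -
  define h where "h = \<eta> / (8 * m)"
  have h: "h > 0" "m * h = \<eta> / 8"
    using pos by (auto simp: h_def)
  define w where "w = h * T"
  have w: "w > 0"
    using h pos by (simp add: w_def)
  let ?tail = "\<lambda>y. indicator {y. w \<le> \<bar>y\<bar>} y * fejer y"
  have "(LBINT y. 5 / 8 * \<eta> * fejer y - 13 / 8 * \<eta> * ?tail y) \<le> (LBINT y. D (z + h - y / T) * fejer y)"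
  proof (rule integral_mono)
    show "integrable lborel (\<lambda>y. 5 / 8 * \<eta> * fejer y - 13 / 8 * \<eta> * ?tail y)"
      using integrable_fejer integral_fejer_tail_le(2)[OF w] by simp
    have "integrable lborel (\<lambda>y. \<eta> * fejer y)"
      using integrable_fejer by simp
    then show "integrable lborel (\<lambda>y. D (z + h - y / T) * fejer y)"
      by (rule Bochner_Integration.integrable_bound)
         (use bnd fejer_nonneg pos in \<open>auto simp: abs_mult intro!: mult_right_mono\<close>)
    fix y
    show "5 / 8 * \<eta> * fejer y - 13 / 8 * \<eta> * ?tail y \<le> D (z + h - y / T) * fejer y"
    proof (cases "w \<le> \<bar>y\<bar>")
      case True
      have "- \<eta> \<le> D (z + h - y / T)"
        using bnd[of "z + h - y / T"] by linarith
      from mult_right_mono[OF this fejer_nonneg[of y]] True show ?thesis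
        by (simp add: algebra_simps)
    next
      case False
      then have "\<bar>y / T\<bar> < h"
        using pos by (simp add: w_def field_simps abs_divide)
      then have y: "z \<le> z + h - y / T" "h - y / T \<le> 2 * h"
        unfolding abs_less_iff by linarith+
      have "5 / 8 * \<eta> = 7 / 8 * \<eta> - m * (2 * h)"
        unfolding mult.left_commute[of m 2 h] h(2) by simp
      also have "\<dots> \<le> D z - m * (z + h - y / T - z)"
        using z y pos by (intro diff_mono mult_left_mono) auto
      also have "\<dots> \<le> D (z + h - y / T)"
        using y by (intro lip)
      finally have "5 / 8 * \<eta> \<le> D (z + h - y / T)" .
      from mult_right_mono[OF this fejer_nonneg[of y]] False show ?thesis
        by simp
    qed
  qed
  also have "\<dots> \<le> J"
    by (rule J)
  also have "(LBINT y. 5 / 8 * \<eta> * fejer y - 13 / 8 * \<eta> * ?tail y)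
      = 5 / 8 * \<eta> * (LBINT y. fejer y) - 13 / 8 * \<eta> * (LBINT y. ?tail y)"
    using integrable_fejer integral_fejer_tail_le(2)[OF w] by simp
  finally have "5 / 8 * \<eta> * (LBINT y. fejer y) \<le> J + 13 / 8 * \<eta> * (LBINT y. ?tail y)"
    by simp
  also have "13 / 8 * \<eta> * (LBINT y. ?tail y) \<le> 13 / 8 * \<eta> * (8 * pi / w)"
    using integral_fejer_tail_le(1)[OF w] pos by (intro mult_left_mono) auto
  also have "\<dots> = 104 * pi * m / T"
    using pos by (simp add: w_def h_def field_simps)
  finally show ?thesis
    by simp
qed

text \<open>The supremum need not be attained, hence the near-maximiser at level 7/8. If the extreme
  value is negative, the one-sided lemma is applied to \<open>\<lambda>x. - D (- x)\<close>: both
  reflections together preserve the one-sided slope condition, and the kernel is even.\<close>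

lemma fejer_smoothing_bound:
  fixes D :: "real \<Rightarrow> real"
  assumes [measurable]: "D \<in> borel_measurable borel"
    and bnd: "\<And>x. \<bar>D x\<bar> \<le> B" and pos: "m > 0" "T > 0"
    and lip: "\<And>x y. x \<le> y \<Longrightarrow> D x - m * (y - x) \<le> D y"
    and J: "\<And>x. \<bar>LBINT y. D (x - y / T) * fejer y\<bar> \<le> J"
  shows "5 / 8 * \<bar>D x\<bar> * (LBINT y. fejer y) \<le> J + 104 * pi * m / T"
proof -
  define \<eta> where "\<eta> = (SUP x. \<bar>D x\<bar>)"
  have bdd: "bdd_above (range (\<lambda>x. \<bar>D x\<bar>))"
    by (rule bdd_aboveI2) (rule bnd)
  have le: "\<bar>D x\<bar> \<le> \<eta>" for x
    unfolding \<eta>_def by (rule cSUP_upper[OF _ bdd]) simp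
  have J0: "0 \<le> J"
    using J[of 0] by linarith
  show ?thesis
  proof (cases "\<eta> > 0")
    case False
    then have "D x = 0"
      using le[of x] by auto
    then show ?thesis
      using J0 pos by simp
  next
    case True
    then have "7 / 8 * \<eta> < \<eta>"
      by simp
    then obtain x0 where x0: "7 / 8 * \<eta> < \<bar>D x0\<bar>"
      using less_cSUP_iff[OF _ bdd, of "7 / 8 * \<eta>"] by (auto simp: \<eta>_def)
    have "5 / 8 * \<eta> * (LBINT y. fejer y) \<le> J + 104 * pi * m / T"
    proof (cases "D x0 \<ge> 0")
      case True
      show ?thesis
        by (rule fejer_smoothing_lower[where D = D and z = x0, OF _ le \<open>\<eta> > 0\<close> pos lip])
           (use x0 True J in \<open>auto simp: abs_le_iff\<close>)
    next
      case False
      show ?thesis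
      proof (rule fejer_smoothing_lower[where D = "\<lambda>x. - D (- x)" and z = "- x0", OF _ _ \<open>\<eta> > 0\<close> pos])
        show "- D (- x) - m * (y - x) \<le> - D (- y)" if "x \<le> y" for x y
          using lip[of "- y" "- x"] that by simp
        show "(LBINT y. - D (- (x - y / T)) * fejer y) \<le> J" for x
        proof -
          have "(LBINT y. - D (- (x - y / T)) * fejer y) = \<bar>-1\<bar> *\<^sub>R (LBINT y. - D (- (x - (0 + (-1) * y) / T)) * fejer (0 + (-1) * y))"
            by (rule lborel_integral_real_affine) simp
          also have "\<dots> = - (LBINT y. D (- x - y / T) * fejer y)"
            by simp
          finally show ?thesis
            using J[of "- x"] by linarith
        qed
      qed (use le x0 False in auto)
    qed
    moreover have "5 / 8 * \<bar>D x\<bar> * (LBINT y. fejer y) \<le> 5 / 8 * \<eta> * (LBINT y. fejer y)"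
      using le integral_fejer_pos by (intro mult_right_mono mult_left_mono) auto
    ultimately show ?thesis
      by linarith
  qed
qed

text \<open>The 2 stems from the two endpoint terms in \<open>norm_integral_iexp_le\<close>, 104 and
  5/8 from \<open>fejer_smoothing_lower\<close>; adding the numerators gives one constant for both
  error terms.\<close>

definition esseen_const :: real where
  "esseen_const = (2 + 104 * pi) / (5 / 8 * (LBINT y. fejer y))"

lemma esseen_const_pos: "esseen_const > 0"
  using integral_fejer_pos pi_gt_zero by (simp add: esseen_const_def add_pos_pos)

text \<open>Since \<open>cdf \<mu>\<close> is nondecreasing, only the candidate can pull the
  difference down, and it does so with slope at most \<open>m\<close>. This is why the smoothing
  lemmas ask for a one-sided Lipschitz condition: the law itself may have atoms.\<close>

theorem esseen_smoothing_inequality: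
  assumes "real_distribution \<mu>" and g: "complex_integrable lborel g" and gm: "\<And>x. \<bar>Re (g x)\<bar> \<le> m"
    and pos: "m > 0" "T > 0" "I \<ge> 0"
    and I: "(\<integral>\<^sup>+t. indicator {-T<..<T} t * ennreal (norm (char \<mu> t - ft lborel g t) / \<bar>t\<bar>) \<partial>lborel) \<le> ennreal I"
  shows "\<bar>cdf \<mu> x - Re (lower_mass lborel g x)\<bar> \<le> esseen_const * (I + m / T)"
proof -
  define c where "c = 5 / 8 * (LBINT y. fejer y)"
  have c: "c > 0"
    using integral_fejer_pos by (simp add: c_def)
  define K where "K = 2 + 104 * pi"
  have K: "K > 0" "K \<ge> 2" "K \<ge> 104 * pi"
    using pi_gt_zero by (auto simp: K_def intro: add_pos_pos)
  interpret real_distribution \<mu> by fact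
  interpret N1: complex_density \<mu> "\<lambda>_. 1"
    by standard auto
  interpret N2: complex_density lborel g
    by standard (use g in auto)
  have char: "ft \<mu> (\<lambda>_. 1) t = char \<mu> t" for t
    by (simp add: ft_def char_def)
  have cdf: "lower_mass \<mu> (\<lambda>_. 1) x = cdf \<mu> x" for x
    by (simp add: lower_mass_def cdf_def scaleR_conv_of_real)
  define D where "D x = cdf \<mu> x - Re (lower_mass lborel g x)" for x
  have [measurable]: "cdf \<mu> \<in> borel_measurable borel"
    by (intro borel_measurable_mono monoI cdf_nondecreasing)
  have [measurable]: "D \<in> borel_measurable borel"
    unfolding D_def[abs_def] by measurable
  have "5 / 8 * \<bar>D x\<bar> * (LBINT y. fejer y) \<le> 2 * I + 104 * pi * m / T"
  proof (rule fejer_smoothing_bound[where D = D, OF _ _ pos(1,2)])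
    fix x
    have "\<bar>D x\<bar> \<le> \<bar>cdf \<mu> x\<bar> + \<bar>Re (lower_mass lborel g x)\<bar>"
      unfolding D_def by (rule abs_triangle_ineq4)
    also have "\<dots> \<le> 1 + norm (lower_mass lborel g x)"
      using cdf_nonneg[of x] cdf_bounded_prob[of x] by (intro add_mono abs_Re_le_cmod) auto
    also have "\<dots> \<le> 1 + (LINT z|lborel. norm (g z))"
      by (intro add_mono N2.norm_lower_mass_le) simp
    finally show "\<bar>D x\<bar> \<le> 1 + (LINT z|lborel. norm (g z))" .
  next
    fix x y :: real
    assume xy: "x \<le> y"
    have "lower_mass lborel g y - lower_mass lborel g x = (CLBINT z. indicator {x<..y} z *\<^sub>R g z)"
      by (rule N2.lower_mass_diff[OF xy])
    moreover have int: "complex_integrable lborel (\<lambda>z. indicator {x<..y} z *\<^sub>R g z)"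
      by (rule Bochner_Integration.integrable_bound[OF g]) (auto simp: indicator_def)
    ultimately have "Re (lower_mass lborel g y) - Re (lower_mass lborel g x) = (LBINT z. Re (indicator {x<..y} z *\<^sub>R g z))"
      using integral_Re[OF int] by (metis minus_complex.simps(1))
    also have "\<dots> \<le> (LBINT z. indicator {x<..y} z * m)"
    proof (rule integral_mono)
      show "integrable lborel (\<lambda>z. Re (indicator {x<..y} z *\<^sub>R g z))"
        using int by (rule integrable_Re)
      show "integrable lborel (\<lambda>z. indicator {x<..y} z * m)"
        using xy by (intro integrable_mult_left integrable_real_indicator) auto
    qed (use gm in \<open>auto simp: indicator_def abs_le_iff\<close>)
    also have "\<dots> = m * (y - x)"
      using xy by simp
    finally show "D x - m * (y - x) \<le> D y"
      using cdf_nondecreasing[OF xy] by (simp add: D_def)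
  next
    fix x
    have "(LBINT y. D (x - y / T) * fejer y)
        = (LBINT y. Re ((lower_mass \<mu> (\<lambda>_. 1) (x - y / T) - lower_mass lborel g (x - y / T)) * fejer y))"
      by (simp add: D_def cdf)
    also have "\<dots> = Re (CLBINT y. (lower_mass \<mu> (\<lambda>_. 1) (x - y / T) - lower_mass lborel g (x - y / T)) * fejer y)"
      unfolding left_diff_distrib
      by (intro integral_Re Bochner_Integration.integrable_diff N1.integrable_lower_mass_fejer N2.integrable_lower_mass_fejer)
    also have "\<bar>\<dots>\<bar> \<le> norm (CLBINT y. (lower_mass \<mu> (\<lambda>_. 1) (x - y / T) - lower_mass lborel g (x - y / T)) * fejer y)"
      by (rule abs_Re_le_cmod)
    also have "\<dots> \<le> 2 * I"
      by (rule fejer_smoothed_difference_le)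
         (use pos I in \<open>auto simp: char intro: N1.complex_density_axioms N2.complex_density_axioms\<close>)
    finally show "\<bar>LBINT y. D (x - y / T) * fejer y\<bar> \<le> 2 * I" .
  qed measurable
  then have "c * \<bar>D x\<bar> \<le> 2 * I + 104 * pi * (m / T)"
    by (simp add: c_def mult_ac)
  also have "\<dots> \<le> K * I + K * (m / T)"
    using pos K by (intro add_mono mult_right_mono) auto
  finally have "\<bar>D x\<bar> \<le> K / c * (I + m / T)"
    using c by (simp add: field_simps)
  then show ?thesis
    by (simp only: D_def esseen_const_def K_def c_def)
qed

section \<open>Gaussian densities times polynomials\<close>

lemma power_div_fact_le_exp:
  fixes x :: real
  assumes "0 \<le> x"
  shows "x ^ n / fact n \<le> exp x"
proof -
  obtain t where "exp x = (\<Sum>m<Suc n. x ^ m / fact m) + exp t / fact (Suc n) * x ^ Suc n"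
    using Maclaurin_exp_le[of x "Suc n"] by blast
  moreover have "x ^ n / fact n \<le> (\<Sum>m<Suc n. x ^ m / fact m)"
    using assms by (simp add: sum_nonneg)
  moreover have "0 \<le> exp t / fact (Suc n) * x ^ Suc n"
    using assms by (intro mult_nonneg_nonneg divide_nonneg_pos) auto
  ultimately show ?thesis
    by linarith
qed

text \<open>Take the exponential series at \<open>c * (1 + t^2)\<close>, term \<open>k + 1\<close>:
  it bounds \<open>(1 + t^2) ^ (k + 1)\<close> times the Gaussian. One factor becomes
  \<open>cauchy t\<close>, the other \<open>k\<close> dominate \<open>abs t ^ k\<close>.\<close>

lemma power_mult_gauss_le:
  fixes c :: real
  assumes c: "c > 0"
  shows "\<exists>C>0. \<forall>t. abs t ^ k * exp (- (c * t^2)) \<le> C * cauchy t"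
proof (intro exI conjI allI)
  define j where "j = Suc k"
  define C where "C = fact j / c ^ j * exp c"
  show "C > 0"
    using c by (simp add: C_def)
  fix t :: real
  have "(c * (1 + t^2)) ^ j / fact j \<le> exp (c * (1 + t^2))"
    using power_div_fact_le_exp[of "c * (1 + t^2)" j] c by simp
  then have "(1 + t^2) ^ j \<le> C * exp (c * t^2)"
    using c by (simp add: C_def power_mult_distrib distrib_left exp_add divide_le_eq le_divide_eq
        mult_ac del: distrib_left_numeral) (simp add: power_mult_distrib[symmetric] algebra_simps)
  then have *: "(1 + t^2) ^ j * exp (- (c * t^2)) \<le> C"
    by (simp add: exp_minus field_simps)
  have "\<bar>t\<bar> \<le> 1 + t^2"
  proof (cases "\<bar>t\<bar> \<le> 1")
    case False
    then have "abs t ^ 1 \<le> abs t ^ 2"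
      by (intro power_increasing) auto
    then show ?thesis by simp
  qed (simp add: add_increasing2)
  then have "(1 + t^2) * (abs t ^ k * exp (- (c * t^2))) \<le> (1 + t^2) * ((1 + t^2) ^ k * exp (- (c * t^2)))"
    by (intro mult_left_mono mult_right_mono power_mono) auto
  also have "\<dots> \<le> C"
    using * by (simp add: j_def mult_ac)
  finally show "abs t ^ k * exp (- (c * t^2)) \<le> C * cauchy t"
    by (simp add: field_simps add_pos_nonneg)
qed

text \<open>The exponent \<open>k\<close> is kept general because removing the constant coefficient
  shifts one power of \<open>t\<close> from the polynomial to the monomial.\<close>

lemma poly_mult_gauss_le:
  fixes c :: real and p :: "complex poly"
  assumes c: "c > 0"
  shows "\<exists>C>0. \<forall>t. abs t ^ k * norm (poly p (of_real t)) * exp (- (c * t^2)) \<le> C * cauchy t"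
proof (induction p arbitrary: k)
  case 0
  show ?case
    by (intro exI[of _ 1]) (simp add: add_nonneg_nonneg)
next
  case (pCons a p)
  from power_mult_gauss_le[OF c, of k] obtain C1 where
    C1: "C1 > 0" "\<And>t. abs t ^ k * exp (- (c * t^2)) \<le> C1 * cauchy t" by blast
  from pCons.IH[of "Suc k"] obtain C2 where
    C2: "C2 > 0" "\<And>t. abs t ^ Suc k * norm (poly p (of_real t)) * exp (- (c * t^2)) \<le> C2 * cauchy t" by blast
  show ?case
  proof (intro exI conjI allI)
    show "norm a * C1 + C2 > 0"
      using C1 C2 by (simp add: add_nonneg_pos)
    fix t :: real
    have "norm (poly (pCons a p) (of_real t)) \<le> norm a + abs t * norm (poly p (of_real t))"
      by (auto intro!: order_trans[OF norm_triangle_ineq] simp: norm_mult)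
    then have "abs t ^ k * norm (poly (pCons a p) (of_real t)) * exp (- (c * t^2)) \<le>
       abs t ^ k * (norm a + abs t * norm (poly p (of_real t))) * exp (- (c * t^2))"
      by (intro mult_right_mono mult_left_mono) auto
    also have "\<dots> = norm a * (abs t ^ k * exp (- (c * t^2))) + abs t ^ Suc k * norm (poly p (of_real t)) * exp (- (c * t^2))"
      by (simp add: algebra_simps)
    also have "\<dots> \<le> norm a * (C1 * cauchy t) + C2 * cauchy t"
      by (intro add_mono mult_left_mono C1 C2) auto
    finally show "abs t ^ k * norm (poly (pCons a p) (of_real t)) * exp (- (c * t^2)) \<le> (norm a * C1 + C2) * cauchy t"
      by (simp add: algebra_simps)
  qed
qed

definition gauss_poly :: "real \<Rightarrow> complex poly \<Rightarrow> real \<Rightarrow> complex" where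
  "gauss_poly \<sigma> R x = complex_of_real (normal_density 0 \<sigma> x) * poly R (of_real x)"

text \<open>The polynomial \<open>Q\<close> for which \<open>gauss_poly \<sigma> Q\<close> is the derivative of \<open>gauss_poly \<sigma> R\<close>.\<close>
definition gauss_deriv :: "real \<Rightarrow> complex poly \<Rightarrow> complex poly" where
  "gauss_deriv \<sigma> R = pderiv R - smult (of_real (1 / \<sigma>^2)) (pCons 0 R)"

context
  fixes \<sigma> :: real
  assumes \<sigma>: "\<sigma> > 0"
begin

lemma gauss_poly_le: "\<exists>C>0. \<forall>x. norm (gauss_poly \<sigma> R x) \<le> C * cauchy x"
proof -
  have "1 / (2 * \<sigma>^2) > 0"
    using \<sigma> by simp
  from poly_mult_gauss_le[OF this, of 0 R] obtain C where
    C: "C > 0" "\<And>x. norm (poly R (of_real x)) * exp (- (1 / (2 * \<sigma>^2) * x^2)) \<le> C * cauchy x"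
    by auto
  define K where "K = 1 / sqrt (2 * pi * \<sigma>^2)"
  have K: "K > 0"
    using \<sigma> by (simp add: K_def)
  show ?thesis
  proof (intro exI[of _ "K * C"] conjI allI)
    show "K * C > 0"
      using K C by simp
    fix x
    have "norm (gauss_poly \<sigma> R x) = K * (norm (poly R (of_real x)) * exp (- (1 / (2 * \<sigma>^2) * x^2)))"
    proof -
      have "normal_density 0 \<sigma> x = K * exp (- (1 / (2 * \<sigma>^2) * x^2))"
        by (simp add: normal_density_def K_def)
      then show ?thesis
        using K by (simp add: gauss_poly_def norm_mult)
    qed
    also have "\<dots> \<le> K * (C * cauchy x)"
      using K C by (intro mult_left_mono) auto
    finally show "norm (gauss_poly \<sigma> R x) \<le> K * C * cauchy x"
      by simp
  qed
qed

lemma gauss_poly_measurable [measurable]: "gauss_poly \<sigma> R \<in> borel_measurable borel"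
proof -
  have [measurable]: "(\<lambda>x::real. poly R (of_real x)) \<in> borel_measurable borel"
    by (intro borel_measurable_continuous_onI continuous_intros)
  show ?thesis
    unfolding gauss_poly_def[abs_def] by measurable
qed

lemma gauss_poly_integrable: "complex_integrable lborel (gauss_poly \<sigma> R)"
proof -
  obtain C where C: "C > 0" "\<And>x. norm (gauss_poly \<sigma> R x) \<le> C * cauchy x"
    using gauss_poly_le by blast
  show ?thesis
  proof (rule Bochner_Integration.integrable_bound)
    show "integrable lborel (\<lambda>x. C * cauchy x)"
      using integrable_inverse_square_plus_1 by (rule integrable_mult_right)
    show "AE x in lborel. norm (gauss_poly \<sigma> R x) \<le> norm (C * cauchy x)"
      using C(2) by (intro AE_I2 order_trans[OF _ norm_ge_zero[THEN abs_of_nonneg, THEN eq_refl]]) (auto intro: order_trans[OF _ abs_ge_self])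
  qed simp
qed

lemma gauss_poly_complex_density: "complex_density lborel (gauss_poly \<sigma> R)"
  by standard (use gauss_poly_integrable in auto)

lemma gauss_poly_tendsto: "(gauss_poly \<sigma> R \<longlongrightarrow> 0) at_top" "(gauss_poly \<sigma> R \<longlongrightarrow> 0) at_bot"
proof -
  obtain C where C: "C > 0" "\<And>x. norm (gauss_poly \<sigma> R x) \<le> C * cauchy x"
    using gauss_poly_le by blast
  have "((\<lambda>x::real. C * cauchy x) \<longlongrightarrow> 0) at_top"
    by real_asymp
  then show "(gauss_poly \<sigma> R \<longlongrightarrow> 0) at_top"
    by (rule Lim_null_comparison[rotated]) (use C in simp)
  have "((\<lambda>x::real. C * cauchy x) \<longlongrightarrow> 0) at_bot"
    by real_asymp
  then show "(gauss_poly \<sigma> R \<longlongrightarrow> 0) at_bot"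
    by (rule Lim_null_comparison[rotated]) (use C in simp)
qed

lemma gauss_poly_has_derivative:
  "(gauss_poly \<sigma> R has_vector_derivative gauss_poly \<sigma> (gauss_deriv \<sigma> R) x) (at x)"
proof -
  have "(normal_density 0 \<sigma> has_real_derivative - (x / \<sigma>^2) * normal_density 0 \<sigma> x) (at x)"
  proof -
    define K where "K = 1 / sqrt (2 * pi * \<sigma>^2)"
    have "normal_density 0 \<sigma> = (\<lambda>x. K * exp (- (x^2 / (2 * \<sigma>^2))))"
      by (simp add: normal_density_def[abs_def] K_def)
    then show ?thesis
      using \<sigma> by (auto intro!: derivative_eq_intros simp: field_simps eval_nat_numeral)
  qed
  moreover have "((\<lambda>x. poly R (complex_of_real x)) has_vector_derivative poly (pderiv R) (of_real x)) (at x)"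
    by (rule has_vector_derivative_real_field) (rule poly_DERIV)
  ultimately show ?thesis
    unfolding gauss_poly_def[abs_def]
    by (auto intro!: derivative_eq_intros simp: gauss_deriv_def algebra_simps
        simp flip: has_real_derivative_iff_has_vector_derivative)
qed

lemma gauss_poly_isCont: "isCont (gauss_poly \<sigma> R) x"
  using gauss_poly_has_derivative by (rule has_vector_derivative_continuous)

section \<open>Fourier inversion for polynomials times a Gaussian\<close>

lemma ft_gauss_deriv: "ft lborel (gauss_poly \<sigma> (gauss_deriv \<sigma> R)) t = - \<i> * t * ft lborel (gauss_poly \<sigma> R) t"
proof -
  interpret N: complex_density lborel "gauss_poly \<sigma> R"
    by (rule gauss_poly_complex_density)
  interpret N': complex_density lborel "gauss_poly \<sigma> (gauss_deriv \<sigma> R)"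
    by (rule gauss_poly_complex_density)
  let ?F = "\<lambda>x. gauss_poly \<sigma> R x * iexp (t * x)"
  let ?f = "\<lambda>x. gauss_poly \<sigma> (gauss_deriv \<sigma> R) x * iexp (t * x) + \<i> * t * (gauss_poly \<sigma> R x * iexp (t * x))"
  have int: "complex_integrable lborel ?f"
    using N.integrable_ft N'.integrable_ft by (intro Bochner_Integration.integrable_add integrable_mult_right)
  have "(CLBINT x=-\<infinity>..\<infinity>. ?f x) = 0 - 0"
  proof (rule interval_integral_FTC_integrable)
    fix x :: real
    have "((\<lambda>z. exp (\<i> * (t * z))) has_field_derivative \<i> * t * iexp (t * x)) (at (of_real x))"
      by (auto intro!: derivative_eq_intros)
    then have "((\<lambda>x. iexp (t * x)) has_vector_derivative \<i> * t * iexp (t * x)) (at x)"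
      by (rule has_vector_derivative_real_field[where f = "\<lambda>z. exp (\<i> * (t * z))", unfolded of_real_mult[symmetric]])
    then show "(?F has_vector_derivative ?f x) (at x)"
      by (rule has_vector_derivative_eq_rhs[OF has_vector_derivative_mult[OF gauss_poly_has_derivative]])
         (simp add: algebra_simps)
    show "isCont ?f x"
      by (intro continuous_intros gauss_poly_isCont)
  next
    show "set_integrable lborel (einterval (-\<infinity>) \<infinity>) ?f"
      using int by (simp add: set_integrable_def)
    have "(?F \<longlongrightarrow> 0) at_top"
      by (rule Lim_null_comparison[OF _ tendsto_norm_zero[OF gauss_poly_tendsto(1)[of R]]]) (simp add: norm_mult)
    then show "((?F \<circ> real_of_ereal) \<longlongrightarrow> 0) (at_left \<infinity>)"
      by (simp add: ereal_tendsto_simps1)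
    have "(?F \<longlongrightarrow> 0) at_bot"
      by (rule Lim_null_comparison[OF _ tendsto_norm_zero[OF gauss_poly_tendsto(2)[of R]]]) (simp add: norm_mult)
    then show "((?F \<circ> real_of_ereal) \<longlongrightarrow> 0) (at_right (-\<infinity>))"
      by (simp add: ereal_tendsto_simps1)
  qed simp
  then have "(CLBINT x. ?f x) = 0"
    by (simp add: interval_lebesgue_integral_def set_lebesgue_integral_def)
  moreover have "(CLBINT x. ?f x) = ft lborel (gauss_poly \<sigma> (gauss_deriv \<sigma> R)) t + \<i> * t * ft lborel (gauss_poly \<sigma> R) t"
    unfolding ft_def
    by (subst Bochner_Integration.integral_add) (use N.integrable_ft N'.integrable_ft in auto)
  ultimately show ?thesis
    by (simp add: add_eq_0_iff2 add_eq_0_iff)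
qed

text \<open>The fundamental theorem of calculus from minus infinity, where the Gaussian removes the
  boundary term. It explains the shape of the theorem: each correction of the distribution function
  is the normal density times a polynomial.\<close>

lemma lower_mass_gauss_deriv: "lower_mass lborel (gauss_poly \<sigma> (gauss_deriv \<sigma> R)) x = gauss_poly \<sigma> R x"
proof -
  let ?f = "gauss_poly \<sigma> (gauss_deriv \<sigma> R)"
  interpret N: complex_density lborel ?f
    by (rule gauss_poly_complex_density)
  have "(CLBINT y=-\<infinity>..x. ?f y) = gauss_poly \<sigma> R x - 0"
  proof (rule interval_integral_FTC_integrable)
    show "set_integrable lborel (einterval (-\<infinity>) x) ?f"
      unfolding set_integrable_def
      by (rule Bochner_Integration.integrable_bound[OF gauss_poly_integrable[of "gauss_deriv \<sigma> R"]]) (auto simp: indicator_def)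
    show "((gauss_poly \<sigma> R \<circ> real_of_ereal) \<longlongrightarrow> 0) (at_right (-\<infinity>))"
      using gauss_poly_tendsto(2) by (simp add: ereal_tendsto_simps1)
    have "(gauss_poly \<sigma> R \<longlongrightarrow> gauss_poly \<sigma> R x) (at_left x)"
      using gauss_poly_isCont by (simp add: isCont_def filterlim_at_split)
    then show "((gauss_poly \<sigma> R \<circ> real_of_ereal) \<longlongrightarrow> gauss_poly \<sigma> R x) (at_left (ereal x))"
      by (simp add: ereal_tendsto_simps1)
  qed (auto intro: gauss_poly_has_derivative gauss_poly_isCont)
  moreover have "(CLBINT y=-\<infinity>..x. ?f y) = lower_mass lborel ?f x"
  proof -
    have "AE y in lborel. indicator (einterval (-\<infinity>) x) y *\<^sub>R ?f y = indicator {..x} y *\<^sub>R ?f y"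
      using AE_lborel_singleton[of x] by eventually_elim (auto simp: einterval_def indicator_def)
    then show ?thesis
      unfolding interval_lebesgue_integral_def set_lebesgue_integral_def lower_mass_def
      by (auto intro!: integral_cong_AE)
  qed
  ultimately show ?thesis
    by simp
qed

lemma ft_normal_density: "ft lborel (\<lambda>x. of_real (normal_density 0 \<sigma> x)) t = exp (- (\<sigma>^2 * t^2 / 2))"
proof -
  have "ft lborel (\<lambda>x. of_real (normal_density 0 \<sigma> x)) t =
      \<bar>\<sigma>\<bar> *\<^sub>R (CLBINT x. of_real (normal_density 0 \<sigma> (0 + \<sigma> * x)) * iexp (t * (0 + \<sigma> * x)))"
    unfolding ft_def using \<sigma> by (intro lborel_integral_real_affine) simp
  also have "\<dots> = (CLBINT x. \<sigma> *\<^sub>R (of_real (normal_density 0 \<sigma> (0 + \<sigma> * x)) * iexp (t * (0 + \<sigma> * x))))"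
    using \<sigma> by simp
  also have "\<dots> = (CLBINT x. std_normal_density x *\<^sub>R iexp (\<sigma> * t * x))"
  proof (rule Bochner_Integration.integral_cong[OF refl])
    fix x
    have "\<sigma> * normal_density 0 \<sigma> (0 + \<sigma> * x) = std_normal_density x"
      using \<sigma> by (simp add: normal_density_def power_mult_distrib real_sqrt_mult)
    then show "\<sigma> *\<^sub>R (of_real (normal_density 0 \<sigma> (0 + \<sigma> * x)) * iexp (t * (0 + \<sigma> * x))) = std_normal_density x *\<^sub>R iexp (\<sigma> * t * x)"
      by (simp add: scaleR_conv_of_real mult_ac flip: of_real_mult)
  qed
  also have "\<dots> = char std_normal_distribution (\<sigma> * t)"
    unfolding char_def by (subst integral_density) auto
  also have "\<dots> = exp (- (\<sigma>^2 * t^2 / 2))"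
    by (simp add: char_std_normal_distribution power_mult_distrib)
  finally show ?thesis .
qed

text \<open>Multiplication by \<open>t\<close> on the Fourier side is \<open>\<i>\<close> times
  differentiation, so \<open>R\<close> is built along the Horner scheme of \<open>A\<close>.\<close>

lemma exists_gauss_poly_ft:
  fixes A :: "complex poly"
  shows
  "\<exists>R. \<forall>t. ft lborel (gauss_poly \<sigma> R) t = poly A (of_real t) * exp (- (\<sigma>^2 * t^2 / 2))"
proof (induction A)
  case 0
  show ?case
    by (intro exI[of _ 0]) (simp add: ft_def gauss_poly_def)
next
  case (pCons a A)
  then obtain R where R: "\<And>t. ft lborel (gauss_poly \<sigma> R) t = poly A (of_real t) * exp (- (\<sigma>^2 * t^2 / 2))"
    by blast
  let ?R = "[:a:] + smult \<i> (gauss_deriv \<sigma> R)"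
  show ?case
  proof (intro exI allI)
    fix t
    interpret N: complex_density lborel "gauss_poly \<sigma> (gauss_deriv \<sigma> R)"
      by (rule gauss_poly_complex_density)
    interpret N1: complex_density lborel "gauss_poly \<sigma> 1"
      by (rule gauss_poly_complex_density)
    have "ft lborel (gauss_poly \<sigma> ?R) t
        = (CLBINT x. a * (gauss_poly \<sigma> 1 x * iexp (t * x)) + \<i> * (gauss_poly \<sigma> (gauss_deriv \<sigma> R) x * iexp (t * x)))"
      unfolding ft_def by (intro Bochner_Integration.integral_cong refl) (simp add: gauss_poly_def algebra_simps)
    also have "\<dots> = a * ft lborel (gauss_poly \<sigma> 1) t + \<i> * ft lborel (gauss_poly \<sigma> (gauss_deriv \<sigma> R)) t"
      unfolding ft_def by (subst Bochner_Integration.integral_add) (use N.integrable_ft N1.integrable_ft in auto)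
    also have "ft lborel (gauss_poly \<sigma> 1) t = exp (- (\<sigma>^2 * t^2 / 2))"
      using ft_normal_density[of t] by (simp add: gauss_poly_def[abs_def])
    also have "ft lborel (gauss_poly \<sigma> (gauss_deriv \<sigma> R)) t = - \<i> * t * (poly A (of_real t) * exp (- (\<sigma>^2 * t^2 / 2)))"
      by (simp add: ft_gauss_deriv R)
    finally show "ft lborel (gauss_poly \<sigma> ?R) t = poly (pCons a A) (of_real t) * exp (- (\<sigma>^2 * t^2 / 2))"
      by (simp add: algebra_simps)
  qed
qed

text \<open>Writing \<open>A\<close> as \<open>t\<close> times \<open>A'\<close>, one inverts
  \<open>\<i> * A'\<close> instead: differentiation contributes \<open>- \<i> * t\<close>, and the
  product is \<open>A\<close>.\<close>

lemma exists_gauss_primitive_ft: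
  fixes A :: "complex poly"
  assumes "poly A 0 = 0"
  shows "\<exists>P. \<forall>t. ft lborel (gauss_poly \<sigma> (gauss_deriv \<sigma> P)) t = poly A (of_real t) * exp (- (\<sigma>^2 * t^2 / 2))"
proof -
  from assms obtain A' where A': "A = pCons 0 A'"
    by (cases A) auto
  obtain R where R: "\<And>t. ft lborel (gauss_poly \<sigma> R) t = poly (smult \<i> A') (of_real t) * exp (- (\<sigma>^2 * t^2 / 2))"
    using exists_gauss_poly_ft by blast
  show ?thesis
    by (intro exI[of _ R]) (simp add: ft_gauss_deriv R A' algebra_simps)
qed

end

section \<open>Smooth functions and Taylor expansion\<close>

text \<open>Existentially quantified derivatives make closure under products and inverses a plain
  induction on the order. \<open>assm_alpha\<close> speaks of \<open>vderivs\<close> of the quotient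
  \<open>H\<close> while its smoothness clauses concern only \<open>lam\<close> and the
  characteristic functions; differentiability of \<open>H\<close> is obtained through this
  detour.\<close>

primrec smooth_on :: "real set \<Rightarrow> nat \<Rightarrow> (real \<Rightarrow> complex) \<Rightarrow> bool" where
  "smooth_on T 0 f \<longleftrightarrow> continuous_on T f"
| "smooth_on T (Suc k) f \<longleftrightarrow> (\<exists>f'. (\<forall>x\<in>T. (f has_vector_derivative f' x) (at x)) \<and> smooth_on T k f')"

lemma vderivs_Suc_shift: "vderivs (Suc j) S f = vderivs j S (vderivs 1 S f)"
  by (induction j) auto

lemma Ck_on_imp_smooth_on:
  assumes "Ck_on k S f" "T \<subseteq> interior S"
  shows "smooth_on T k f"
  using assms(1)
proof (induction k arbitrary: f)
  case 0
  then show ?case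
    using assms(2) interior_subset[of S] by (auto simp: Ck_on_def intro: continuous_on_subset)
next
  case (Suc k)
  have "Ck_on k S (vderivs 1 S f)"
    using Suc.prems unfolding Ck_on_def vderivs_Suc_shift[symmetric] by auto
  then have "smooth_on T k (vderivs 1 S f)"
    by (rule Suc.IH)
  moreover have "(f has_vector_derivative vderivs 1 S f x) (at x)" if "x \<in> T" for x
  proof -
    have x: "x \<in> interior S"
      using that assms(2) by auto
    then have "(f has_vector_derivative vderivs 1 S f x) (at x within S)"
      using Suc.prems interior_subset[of S] unfolding Ck_on_def by force
    then show ?thesis
      using at_within_interior[OF x] by simp
  qed
  ultimately show ?case
    unfolding smooth_on.simps by blast
qed

context
  fixes T :: "real set"
  assumes T: "open T"
begin

lemma smooth_on_cong:
  assumes "smooth_on T k f" "\<And>x. x \<in> T \<Longrightarrow> f x = g x"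
  shows "smooth_on T k g"
  using assms
proof (cases k)
  case (Suc k')
  then obtain f' where "\<And>x. x \<in> T \<Longrightarrow> (f has_vector_derivative f' x) (at x)" "smooth_on T k' f'"
    using assms by auto
  then show ?thesis
    using Suc assms(2) has_vector_derivative_transform_within_open[OF _ T] by (metis smooth_on.simps(2))
qed (auto cong: continuous_on_cong)

text \<open>The way back: on an open set the derivative chosen by \<open>vector_derivative\<close>
  is the one that exists, and shifting the index passes to it. It supplies the chain of derivatives
  that \<open>taylor_mean_value\<close> asks for.\<close>

lemma vderivs_has_vector_derivative:
  assumes "smooth_on T k f" "j < k" "x \<in> T"
  shows "(vderivs j T f has_vector_derivative vderivs (Suc j) T f x) (at x)"
  using assms
proof (induction j arbitrary: k f)
  case 0
  then obtain f' where "(f has_vector_derivative f' x) (at x)"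
    by (cases k) auto
  then show ?case
    using at_within_open[OF assms(3) T] by (simp add: vector_derivative_at)
next
  case (Suc j)
  then obtain k' where k': "k = Suc k'" "j < k'"
    by (cases k) auto
  then obtain f' where f': "\<And>x. x \<in> T \<Longrightarrow> (f has_vector_derivative f' x) (at x)" "smooth_on T k' f'"
    using Suc.prems by auto
  have eq: "vderivs 1 T f y = f' y" if "y \<in> T" for y
    using f'(1)[OF that] at_within_open[OF that T] by (simp add: vector_derivative_at)
  have "smooth_on T k' (vderivs 1 T f)"
    using smooth_on_cong[OF f'(2)] eq by metis
  from Suc.IH[OF this k'(2) Suc.prems(3)] show ?case
    unfolding vderivs_Suc_shift[symmetric] .
qed

lemma smooth_on_SucD: "smooth_on T (Suc k) f \<Longrightarrow> smooth_on T k f"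
proof (induction k arbitrary: f)
  case 0
  then show ?case
    unfolding smooth_on.simps
    by (meson continuous_at_imp_continuous_on has_vector_derivative_continuous)
next
  case (Suc k)
  then obtain f' where f': "\<And>x. x \<in> T \<Longrightarrow> (f has_vector_derivative f' x) (at x)" "smooth_on T (Suc k) f'"
    by (subst (asm) smooth_on.simps(2)) auto
  then show ?case
    using Suc.IH by auto
qed

lemma smooth_on_const: "smooth_on T k (\<lambda>_. c)"
  by (induction k arbitrary: c) (auto intro!: exI[of _ "\<lambda>_. 0"] derivative_intros)

lemma smooth_on_add: "smooth_on T k f \<Longrightarrow> smooth_on T k g \<Longrightarrow> smooth_on T k (\<lambda>x. f x + g x)"
proof (induction k arbitrary: f g)
  case (Suc k)
  then obtain f' g' where "\<And>x. x \<in> T \<Longrightarrow> (f has_vector_derivative f' x) (at x)" "smooth_on T k f'"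
    "\<And>x. x \<in> T \<Longrightarrow> (g has_vector_derivative g' x) (at x)" "smooth_on T k g'"
    unfolding smooth_on.simps by blast
  then show ?case
    using Suc.IH by (auto intro!: exI[of _ "\<lambda>x. f' x + g' x"] derivative_intros)
qed (auto intro: continuous_on_add)

lemma smooth_on_mult: "smooth_on T k f \<Longrightarrow> smooth_on T k g \<Longrightarrow> smooth_on T k (\<lambda>x. f x * g x)"
proof (induction k arbitrary: f g)
  case (Suc k)
  then obtain f' g' where *: "\<And>x. x \<in> T \<Longrightarrow> (f has_vector_derivative f' x) (at x)" "smooth_on T k f'"
    "\<And>x. x \<in> T \<Longrightarrow> (g has_vector_derivative g' x) (at x)" "smooth_on T k g'"
    unfolding smooth_on.simps by blast
  have "smooth_on T k (\<lambda>x. f x * g' x + f' x * g x)"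
    using * Suc.prems[THEN smooth_on_SucD] by (intro smooth_on_add Suc.IH)
  then show ?case
    using * by (auto intro!: exI[of _ "\<lambda>x. f x * g' x + f' x * g x"] has_vector_derivative_mult)
qed (auto intro: continuous_on_mult)

text \<open>The derivative is written as a product of \<open>f'\<close> with inverses of
  \<open>f\<close>, so that the induction hypothesis and closure under products apply one order
  lower.\<close>

lemma smooth_on_inverse:
  "smooth_on T k f \<Longrightarrow> (\<And>x. x \<in> T \<Longrightarrow> f x \<noteq> 0) \<Longrightarrow> smooth_on T k (\<lambda>x. inverse (f x))"
proof (induction k arbitrary: f)
  case (Suc k)
  then obtain f' where *: "\<And>x. x \<in> T \<Longrightarrow> (f has_vector_derivative f' x) (at x)" "smooth_on T k f'"
    by auto
  let ?d = "\<lambda>x. (-1) * (f' x * (inverse (f x) * inverse (f x)))"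
  have "smooth_on T k ?d"
    using * Suc.prems smooth_on_SucD by (intro smooth_on_mult smooth_on_const Suc.IH) auto
  moreover have "((\<lambda>x. inverse (f x)) has_vector_derivative ?d x) (at x)" if "x \<in> T" for x
  proof -
    have "(inverse has_field_derivative - (inverse (f x) * inverse (f x))) (at (f x))"
      using Suc.prems that by (auto intro!: derivative_eq_intros simp: power2_eq_square)
    from field_vector_diff_chain_at[OF *(1)[OF that] this] show ?thesis
      by (simp add: o_def)
  qed
  ultimately show ?case
    unfolding smooth_on.simps by (intro exI[of _ ?d] conjI ballI)
qed (auto intro: continuous_on_inverse)

lemma smooth_on_power: "smooth_on T k f \<Longrightarrow> smooth_on T k (\<lambda>x. f x ^ n)"
  by (induction n) (simp_all only: power_0 power_Suc smooth_on_const smooth_on_mult)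

end

section \<open>Taylor's formula along a chain of derivatives\<close>

lemma taylor_power_has_vector_derivative:
  "((\<lambda>u. complex_of_real ((s - u) ^ Suc N / fact (Suc N))) has_vector_derivative of_real (- ((s - u) ^ N / fact N))) (at u)"
proof -
  have "((\<lambda>u. (s - u) ^ Suc N) has_real_derivative real (Suc N) * ((0 - 1) * (s - u) ^ N)) (at u)"
    by (rule derivative_eq_intros refl)+ simp
  then have "((\<lambda>u. (s - u) ^ Suc N / fact (Suc N)) has_real_derivative real (Suc N) * ((0 - 1) * (s - u) ^ N) / fact (Suc N)) (at u)"
    by (rule DERIV_cdivide)
  then have "((\<lambda>u. (s - u) ^ Suc N / fact (Suc N)) has_real_derivative - ((s - u) ^ N / fact N)) (at u)"
    by (simp only: fact_Suc of_nat_mult) (simp del: of_nat_Suc)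
  then show ?thesis
    by (simp only: has_vector_derivative_of_real has_real_derivative_iff_has_vector_derivative)
qed

text \<open>The sum telescopes: differentiating the weight in one term cancels the derivative of the
  preceding coefficient.\<close>

lemma taylor_sum_has_vector_derivative:
  fixes F :: "nat \<Rightarrow> real \<Rightarrow> complex"
  assumes "\<And>j. j < Suc N \<Longrightarrow> (F j has_vector_derivative F (Suc j) u) (at u)"
  shows "((\<lambda>u. \<Sum>j<Suc N. F j u * of_real ((s - u) ^ j / fact j)) has_vector_derivative
           F (Suc N) u * of_real ((s - u) ^ N / fact N)) (at u)"
  using assms
proof (induction N)
  case 0
  then show ?case by simp
next
  case (Suc N)
  have

    "((\<lambda>u. F (Suc N) u * of_real ((s - u) ^ Suc N / fact (Suc N))) has_vector_derivative
       F (Suc N) u * of_real (- ((s - u) ^ N / fact N)) + F (Suc (Suc N)) u * of_real ((s - u) ^ Suc N / fact (Suc N))) (at u)"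
    by (intro has_vector_derivative_mult taylor_power_has_vector_derivative Suc.prems) auto
  from has_vector_derivative_add[OF Suc.IH this] Suc.prems show ?case
    by simp
qed

text \<open>Mean value inequality for \<open>g u\<close>, the Taylor polynomial centred at
  \<open>u\<close>, evaluated at \<open>s\<close>, with top coefficient \<open>w\<close>; it equals
  \<open>F 0 s\<close> at \<open>u = s\<close>. The choice of \<open>w\<close> is left open: the top
  derivative at 0 yields the Peano form, 0 the plain remainder. The hypothesis bounds the derivative
  together with its weight, since in \<open>characteristic_taylor\<close> neither factor alone is
  small enough.\<close>

lemma taylor_mean_value:
  fixes F :: "nat \<Rightarrow> real \<Rightarrow> complex"
  assumes der: "\<And>j u. j < Suc N \<Longrightarrow> u \<in> closed_segment 0 s \<Longrightarrow> (F j has_vector_derivative F (Suc j) u) (at u)"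
    and le: "\<And>u. u \<in> closed_segment 0 s \<Longrightarrow> norm (F (Suc N) u - w) * (\<bar>s - u\<bar> ^ N / fact N) \<le> B"
  shows "norm (F 0 s - (\<Sum>j<Suc N. F j 0 * of_real (s ^ j / fact j)) - w * of_real (s ^ Suc N / fact (Suc N))) \<le> B * \<bar>s\<bar>"
proof -
  define g where "g u = (\<Sum>j<Suc N. F j u * of_real ((s - u) ^ j / fact j)) + w * of_real ((s - u) ^ Suc N / fact (Suc N))" for u
  have g': "(g has_vector_derivative (F (Suc N) u - w) * of_real ((s - u) ^ N / fact N)) (at u)"
    if u: "u \<in> closed_segment 0 s" for u
  proof -
    have "((\<lambda>u. \<Sum>j<Suc N. F j u * of_real ((s - u) ^ j / fact j)) has_vector_derivative
           F (Suc N) u * of_real ((s - u) ^ N / fact N)) (at u)"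
      by (intro taylor_sum_has_vector_derivative der u)
    from has_vector_derivative_add[OF this has_vector_derivative_mult_right[OF taylor_power_has_vector_derivative, of w s N u]]
    show ?thesis
      unfolding g_def[abs_def] by (rule has_vector_derivative_eq_rhs) (simp only: left_diff_distrib of_real_minus mult_minus_right add_uminus_conv_diff)
  qed
  have "norm (g s - g 0) \<le> B * norm (s - 0)"
  proof (rule differentiable_bound[of "closed_segment 0 s"])
    fix u assume u: "u \<in> closed_segment 0 s"
    show "(g has_derivative (\<lambda>h. h *\<^sub>R ((F (Suc N) u - w) * of_real ((s - u) ^ N / fact N)))) (at u within closed_segment 0 s)"
      using g'[OF u] unfolding has_vector_derivative_def by (rule has_derivative_at_withinI)
    have "norm ((F (Suc N) u - w) * of_real ((s - u) ^ N / fact N)) \<le> B"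
      using le[OF u] by (simp add: norm_mult norm_divide norm_power flip: of_real_diff)
    then show "onorm (\<lambda>h. h *\<^sub>R ((F (Suc N) u - w) * of_real ((s - u) ^ N / fact N))) \<le> B"
      by (intro onorm_le) (simp only: norm_scaleR mult.commute[of B] real_norm_def mult_left_mono abs_ge_zero)
  qed auto
  moreover have "g s = F 0 s"
    by (simp add: g_def sum.lessThan_Suc_shift del: sum.lessThan_Suc)
  ultimately show ?thesis
    by (simp add: g_def diff_diff_eq)
qed

section \<open>The leading eigenvalue near the origin\<close>

text \<open>Factors are split off one at a time: after \<open>k + 1\<close> of them, the quotient in
  the hypothesis is the cofactor itself, whose limit 0 must be its value at 0. The use is to read
  off the Taylor coefficients of \<open>lam\<close> up to order 2.\<close>

lemma poly_little_o_imp_factor: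
  fixes p :: "complex poly"
  assumes "((\<lambda>s::real. poly p (of_real s) / of_real s ^ k) \<longlongrightarrow> 0) (at 0)"
  shows "\<exists>q. p = monom 1 (Suc k) * q"
  using assms
proof (induction k)
  case 0
  have "((\<lambda>s::real. poly p (of_real s)) \<longlongrightarrow> poly p (of_real 0)) (at 0)"
    by (intro tendsto_intros)
  with 0 have "poly p 0 = 0"
    using tendsto_unique[OF trivial_limit_at] by fastforce
  then obtain q where "p = pCons 0 q"
    by (cases p) auto
  then show ?case
    by (intro exI[of _ q]) (simp add: monom_altdef)
next
  case (Suc k)
  have "((\<lambda>s::real. complex_of_real s) \<longlongrightarrow> of_real 0) (at 0)"
    by (intro tendsto_intros)
  then have "((\<lambda>s::real. of_real s * (poly p (of_real s) / of_real s ^ Suc k)) \<longlongrightarrow> 0) (at 0)"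
    by (intro tendsto_mult_zero Suc.prems) simp
  then have "((\<lambda>s::real. poly p (of_real s) / of_real s ^ k) \<longlongrightarrow> 0) (at 0)"
    by (rule Lim_transform_eventually) (auto simp: eventually_at_filter)
  then obtain q where q: "p = monom 1 (Suc k) * q"
    using Suc.IH by blast
  have "((\<lambda>s::real. poly q (of_real s)) \<longlongrightarrow> 0) (at 0)"
    using Suc.prems by (rule Lim_transform_eventually) (auto simp: eventually_at_filter q poly_monom)
  moreover have "((\<lambda>s::real. poly q (of_real s)) \<longlongrightarrow> poly q (of_real 0)) (at 0)"
    by (intro tendsto_intros)
  ultimately have "poly q 0 = 0"
    using tendsto_unique[OF trivial_limit_at] by fastforce
  then obtain q' where "q = pCons 0 q'"
    by (cases q) auto
  then have "p = monom 1 (Suc (Suc k)) * q'"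
    by (simp add: q monom_altdef mult_ac)
  then show ?case
    by blast
qed

lemma poly_bounded_unit_interval:
  fixes p :: "complex poly"
  shows "\<exists>D>0. \<forall>s::real. \<bar>s\<bar> \<le> 1 \<longrightarrow> norm (poly p (of_real s)) \<le> D"
proof -
  have "compact ((\<lambda>s::real. poly p (of_real s)) ` {-1..1})"
    by (intro compact_continuous_image continuous_intros compact_Icc)
  then obtain D where "D > 0" and D: "\<And>z. z \<in> (\<lambda>s::real. poly p (of_real s)) ` {-1..1} \<Longrightarrow> norm z \<le> D"
    using compact_imp_bounded bounded_pos by metis
  then show ?thesis
    by (intro exI[of _ D] conjI allI impI D imageI) auto
qed

definition taylor_poly :: "(nat \<Rightarrow> complex) \<Rightarrow> nat \<Rightarrow> complex poly" where
  "taylor_poly F k = (\<Sum>j<k. monom (F j / fact j) j)"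

lemma poly_taylor_poly: "poly (taylor_poly F k) x = (\<Sum>j<k. F j / fact j * x ^ j)"
  by (simp add: taylor_poly_def poly_sum poly_monom)

lemma coeff_taylor_poly: "j < k \<Longrightarrow> coeff (taylor_poly F k) j = F j / fact j"
  by (simp add: taylor_poly_def coeff_sum)

lemma Ck_on_derivative_at:
  assumes "Ck_on k {-\<delta>..\<delta>} f" "j < k" "abs u < \<delta>"
  shows "(vderivs j {-\<delta>..\<delta>} f has_vector_derivative vderivs (Suc j) {-\<delta>..\<delta>} f u) (at u)"
proof -
  have "u \<in> interior {-\<delta>..\<delta>}"
    using assms(3) by (auto simp: interior_atLeastAtMost_real)
  moreover have "u \<in> {-\<delta>..\<delta>}"
    using assms(3) by auto
  ultimately show ?thesis
    using assms(1,2) unfolding Ck_on_def by (metis at_within_interior)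
qed

text \<open>With \<open>w\<close> the top derivative at 0, continuity of that derivative makes its
  variation at most \<epsilon> near the origin; no further order of smoothness is spent.\<close>

lemma taylor_peano:
  assumes f: "Ck_on (Suc N) {-\<delta>..\<delta>} f" and \<delta>: "\<delta> > 0" and \<epsilon>: "\<epsilon> > 0"
  defines "F \<equiv> \<lambda>j. vderivs j {-\<delta>..\<delta>} f 0"
  shows "\<exists>\<eta>>0. \<forall>s. abs s < \<eta> \<longrightarrow> norm (f s - poly (taylor_poly F (Suc (Suc N))) (of_real s)) \<le> \<epsilon> * abs s ^ Suc N"
proof -
  let ?F = "\<lambda>j. vderivs j {-\<delta>..\<delta>} f"
  have "continuous_on {-\<delta>..\<delta>} (?F (Suc N))"
    using f by (simp add: Ck_on_def)
  moreover have "(0::real) \<in> {-\<delta>..\<delta>}"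
    using \<delta> by simp
  ultimately obtain d where d: "d > 0" "\<And>u. u \<in> {-\<delta>..\<delta>} \<Longrightarrow> dist u 0 < d \<Longrightarrow> dist (?F (Suc N) u) (?F (Suc N) 0) < \<epsilon>"
    unfolding continuous_on_iff using \<epsilon> by metis
  show ?thesis
  proof (intro exI[of _ "min d \<delta>"] conjI allI impI)
    show "min d \<delta> > 0"
      using d \<delta> by simp
    fix s assume s: "abs s < min d \<delta>"
    have seg: "\<bar>u\<bar> \<le> \<bar>s\<bar>" "\<bar>s - u\<bar> \<le> \<bar>s\<bar>" if "u \<in> closed_segment 0 s" for u
      using that by (auto simp: closed_segment_eq_real_ivl split: if_splits)
    have "norm (?F 0 s - (\<Sum>j<Suc N. ?F j 0 * of_real (s ^ j / fact j)) - ?F (Suc N) 0 * of_real (s ^ Suc N / fact (Suc N)))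
        \<le> (\<epsilon> * abs s ^ N) * \<bar>s\<bar>"
    proof (rule taylor_mean_value)
      fix j u assume "j < Suc N" "u \<in> closed_segment 0 s"
      then show "(?F j has_vector_derivative ?F (Suc j) u) (at u)"
        using seg(1)[of u] s by (intro Ck_on_derivative_at[OF f]) auto
    next
      fix u assume u: "u \<in> closed_segment 0 s"
      have "u \<in> {-\<delta>..\<delta>}" "dist u 0 < d"
        using seg(1)[OF u] s by (auto simp: dist_norm)
      then have "norm (?F (Suc N) u - ?F (Suc N) 0) \<le> \<epsilon>"
        using d(2)[of u] by (simp only: dist_norm less_imp_le)
      moreover have "\<bar>s - u\<bar> ^ N / fact N \<le> abs s ^ N / 1"
        using seg(2)[OF u] by (intro frac_le power_mono) (auto simp: fact_ge_1)
      ultimately show "norm (?F (Suc N) u - ?F (Suc N) 0) * (\<bar>s - u\<bar> ^ N / fact N) \<le> \<epsilon> * abs s ^ N"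
        using \<epsilon> by (intro mult_mono) auto
    qed
    moreover have "poly (taylor_poly F (Suc (Suc N))) (of_real s)
        = (\<Sum>j<Suc N. ?F j 0 * of_real (s ^ j / fact j)) + ?F (Suc N) 0 * of_real (s ^ Suc N / fact (Suc N))"
      by (subst poly_taylor_poly, subst sum.lessThan_Suc)
         (simp add: F_def sum_divide_distrib del: fact_Suc)
    ultimately show "norm (f s - poly (taylor_poly F (Suc (Suc N))) (of_real s)) \<le> \<epsilon> * abs s ^ Suc N"
      by (simp add: diff_diff_eq mult_ac)
  qed
qed

text \<open>The terms \<open>1 + \<kappa> s^2\<close> are isolated so that multiplying by an
  expansion starting with \<open>1 - \<kappa> s^2\<close> visibly leaves nothing between 1 and
  \<open>s ^ 3\<close>.\<close>

lemma exp_square_poly_approx: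
  fixes \<kappa> :: real
  assumes \<kappa>: "\<kappa> \<ge> 0"
  shows "\<exists>E::complex poly. \<exists>C>0. \<forall>s. \<bar>s\<bar> \<le> 1 \<longrightarrow>
    norm (of_real (exp (\<kappa> * s^2)) - poly (1 + monom (of_real \<kappa>) 2 + monom 1 4 * E) (of_real s)) \<le> C * abs s ^ (2 * M)"
proof (intro exI conjI allI impI)
  define E :: "complex poly" where "E = (\<Sum>i<M. monom (of_real (\<kappa> ^ (i + 2) / fact (i + 2))) (2 * i))"
  \<comment> \<open>The summand 1 keeps \<open>C\<close> positive when
    \<open>\<kappa> = 0\<close>.\<close>
  define C where "C = exp \<kappa> * \<kappa> ^ (M + 2) + 1"
  show "C > 0"
    using \<kappa> by (simp add: C_def add_nonneg_pos)
  fix s :: real assume s: "\<bar>s\<bar> \<le> 1"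
  define x where "x = \<kappa> * s^2"
  have s2: "s^2 \<le> 1"
    using s by (simp add: abs_square_le_1)
  have x: "0 \<le> x" "x \<le> \<kappa>"
    using \<kappa> s2 mult_left_mono[OF s2 \<kappa>] by (auto simp: x_def)
  obtain t where t: "\<bar>t\<bar> \<le> \<bar>x\<bar>" "exp x = (\<Sum>m<M + 2. x ^ m / fact m) + exp t / fact (M + 2) * x ^ (M + 2)"
    using Maclaurin_exp_le[of x "M + 2"] by blast
  have "(\<Sum>m<M + 2. x ^ m / fact m) = 1 + x + (\<Sum>i<M. x ^ (i + 2) / fact (i + 2))"
    by (simp add: sum.lessThan_Suc_shift del: sum.lessThan_Suc)
  moreover have "poly (1 + monom (of_real \<kappa>) 2 + monom 1 4 * E) (of_real s) = of_real (1 + x + (\<Sum>i<M. x ^ (i + 2) / fact (i + 2)))"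
  proof -
    have pow: "x ^ (i + 2) / fact (i + 2) = s ^ 4 * (\<kappa> ^ (i + 2) / fact (i + 2) * s ^ (2 * i))" for i
      by (simp add: x_def power_mult_distrib power_mult power_add eval_nat_numeral del: fact_Suc)
    have "poly (1 + monom (of_real \<kappa>) 2 + monom 1 4 * E) (of_real s)
        = of_real (1 + \<kappa> * s^2 + s ^ 4 * (\<Sum>i<M. \<kappa> ^ (i + 2) / fact (i + 2) * s ^ (2 * i)))"
      by (simp add: E_def poly_sum poly_monom del: fact_Suc)
    then show ?thesis
      by (simp only: pow sum_distrib_left x_def[symmetric])
  qed
  ultimately have "of_real (exp x) - poly (1 + monom (of_real \<kappa>) 2 + monom 1 4 * E) (of_real s) = complex_of_real (exp t / fact (M + 2) * x ^ (M + 2))"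
    unfolding t(2) by (simp only: of_real_add add_diff_cancel_left')
  then have "norm (of_real (exp x) - poly (1 + monom (of_real \<kappa>) 2 + monom 1 4 * E) (of_real s)) = exp t / fact (M + 2) * x ^ (M + 2)"
    using x by (simp del: of_real_mult of_real_divide of_real_power fact_Suc add: norm_of_real)
  also have "\<dots> \<le> exp \<kappa> / 1 * (\<kappa> ^ (M + 2) * (s^2) ^ M)"
  proof (intro mult_mono frac_le)
    have "x ^ (M + 2) = \<kappa> ^ (M + 2) * (s^2) ^ M * (s^2) ^ 2"
      by (simp add: x_def power_mult_distrib power_add)
    also have "\<dots> \<le> \<kappa> ^ (M + 2) * (s^2) ^ M * 1"
      using \<kappa> power_le_one[OF _ s2, of 2] by (intro mult_left_mono) simp_all
    finally show "x ^ (M + 2) \<le> \<kappa> ^ (M + 2) * (s^2) ^ M"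
      by simp
  qed (use x t \<kappa> in \<open>auto simp: fact_ge_1 simp del: fact_Suc\<close>)
  also have "\<dots> \<le> C * abs s ^ (2 * M)"
  proof -
    have "abs s ^ (2 * M) = (s^2) ^ M"
      by (simp add: power_mult)
    then show ?thesis
      by (simp only: C_def distrib_right) simp
  qed
  finally show "norm (of_real (exp (\<kappa> * s^2)) - poly (1 + monom (of_real \<kappa>) 2 + monom 1 4 * E) (of_real s)) \<le> C * abs s ^ (2 * M)"
    by (simp add: x_def)
qed

lemma norm_power2_has_real_derivative:
  fixes f :: "real \<Rightarrow> complex"
  assumes "(f has_vector_derivative f') (at u)"
  shows "((\<lambda>u. (norm (f u))^2) has_real_derivative 2 * (f u \<bullet> f')) (at u)"
proof -
  have "((\<lambda>u. f u \<bullet> f u) has_derivative (\<lambda>h. f u \<bullet> (h *\<^sub>R f') + (h *\<^sub>R f') \<bullet> f u)) (at u)"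
    using assms unfolding has_vector_derivative_def by (intro has_derivative_inner)
  moreover have "(\<lambda>h. f u \<bullet> (h *\<^sub>R f') + (h *\<^sub>R f') \<bullet> f u) = (*) (2 * (f u \<bullet> f'))"
    by (simp add: fun_eq_iff inner_commute)
  ultimately show ?thesis
    by (simp add: has_field_derivative_def power2_norm_eq_inner)
qed

text \<open>\<open>|\<lambda>(s)|^2 exp (c s^2 / 2)\<close> decreases away from the origin, since the derivative of \<open>\<lambda>\<close> is \<open>- c s + o(s)\<close>.\<close>
lemma eigenvalue_decay:
  fixes lam lam' :: "real \<Rightarrow> complex" and c :: real
  assumes c: "c > 0" and \<delta>: "\<delta> > 0"
    and der: "\<And>u. abs u < \<delta> \<Longrightarrow> (lam has_vector_derivative lam' u) (at u)"
    and lam0: "lam 0 = 1" "lam' 0 = 0"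
    and der2: "(lam' has_vector_derivative - of_real c) (at 0)"
  shows "\<exists>\<rho>>0. \<rho> \<le> \<delta> \<and> (\<forall>s u. abs s < \<rho> \<longrightarrow> u \<in> closed_segment 0 s \<longrightarrow>
           norm (lam s) \<le> norm (lam u) * exp (- (c / 4 * (abs s * \<bar>s - u\<bar>))))"
proof -
  \<comment> \<open>The derivative of \<open>\<Phi>\<close> below is \<open>2 * u * g u\<close>
    times a positive weight. At the origin \<open>g\<close> tends to \<open>- c + c / 2\<close>: the
    weight \<open>exp (c / 2 * u^2)\<close> takes back only half of the decay of the squared
    modulus, so a strict sign remains.\<close>
  define g where "g u = lam u \<bullet> (lam' u / of_real u + of_real (c / 2) * lam u)" for u
  have "isCont lam 0"
    using der[of 0] \<delta> by (auto intro: has_vector_derivative_continuous)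
  then have lim1: "(lam \<longlongrightarrow> 1) (at 0)"
    using lam0 by (simp add: isCont_def)
  have lim2: "((\<lambda>u. lam' u / of_real u) \<longlongrightarrow> - of_real c) (at 0)"
  proof -
    have "((\<lambda>y. (1 / \<bar>y\<bar>) *\<^sub>R (lam' y + y *\<^sub>R of_real c)) \<longlongrightarrow> 0) (at 0)"
      using der2 lam0 by (simp add: has_vector_derivative_def has_derivative_at2)
    then have h1: "((\<lambda>y. norm ((1 / \<bar>y\<bar>) *\<^sub>R (lam' y + y *\<^sub>R of_real c))) \<longlongrightarrow> 0) (at 0)"
      by (rule tendsto_norm_zero)
    have h2: "norm ((1 / \<bar>y\<bar>) *\<^sub>R (lam' y + y *\<^sub>R of_real c)) = norm (lam' y / of_real y - (- of_real c))" if "y \<noteq> 0" for y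
    proof -
      have "lam' y / of_real y - (- of_real c) = (lam' y + y *\<^sub>R of_real c) / of_real y"
        using that by (simp add: scaleR_conv_of_real field_simps)
      then show ?thesis
        by (simp add: norm_divide)
    qed
    have "((\<lambda>y. norm (lam' y / of_real y - (- of_real c))) \<longlongrightarrow> 0) (at 0)"
      by (rule Lim_transform_eventually[OF h1], unfold eventually_at_filter)
         (intro always_eventually allI impI h2)
    then show ?thesis
      by (rule LIM_zero_cancel[OF tendsto_norm_zero_cancel])
  qed
  have "(g \<longlongrightarrow> 1 \<bullet> (- of_real c + of_real (c / 2) * (1::complex))) (at 0)"
    unfolding g_def by (intro tendsto_intros lim1 lim2)
  moreover have "1 \<bullet> (- of_real c + of_real (c / 2) * (1::complex)) < 0"
    using c by (simp add: inner_complex_def)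
  ultimately have "\<forall>\<^sub>F u in at 0. g u < 0"
    by (rule order_tendstoD)
  then obtain d where d: "d > 0" "\<And>u. u \<noteq> 0 \<Longrightarrow> abs u < d \<Longrightarrow> g u < 0"
    unfolding eventually_at by (auto simp: dist_norm)
  define \<Phi> where "\<Phi> u = (norm (lam u))^2 * exp (c / 2 * u^2)" for u
  have \<Phi>': "(\<Phi> has_real_derivative 2 * u * g u * exp (c / 2 * u^2)) (at u)" if "abs u < \<delta>" for u
  proof -
    have eq: "2 * u * g u = 2 * (lam u \<bullet> lam' u) + c * u * (norm (lam u))^2"
    proof (cases "u = 0")
      case True
      then show ?thesis using lam0 by simp
    next
      case False
      have "u *\<^sub>R (lam' u / of_real u + of_real (c / 2) * lam u) = lam' u + (c * u / 2) *\<^sub>R lam u"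
        using False by (simp add: scaleR_conv_of_real algebra_simps)
      then have "u * g u = lam u \<bullet> (lam' u + (c * u / 2) *\<^sub>R lam u)"
        unfolding g_def by (metis inner_scaleR_right)
      then show ?thesis
        by (simp add: inner_add_right power2_norm_eq_inner algebra_simps)
    qed
    show ?thesis
      unfolding \<Phi>_def[abs_def] eq
      by (rule derivative_eq_intros norm_power2_has_real_derivative[OF der[OF that]] refl)+
         (simp add: algebra_simps)
  qed
  define \<rho> where "\<rho> = min d \<delta>"
  have mono: "\<Phi> s \<le> \<Phi> u" if s: "abs s < \<rho>" and u: "u \<in> closed_segment 0 s" for s u
  proof (cases "s \<ge> 0")
    case True
    then have us: "0 \<le> u" "u \<le> s"
      using u by (auto simp: closed_segment_eq_real_ivl)
    show ?thesis
    proof (rule DERIV_nonpos_imp_nonincreasing[OF us(2)])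
      fix x assume x: "u \<le> x" "x \<le> s"
      have "2 * x * g x * exp (c / 2 * x^2) \<le> 0"
        using d(2)[of x] x us s by (cases "x = 0") (auto simp: \<rho>_def mult_le_0_iff)
      then show "\<exists>y. (\<Phi> has_real_derivative y) (at x) \<and> y \<le> 0"
        using \<Phi>'[of x] x us s by (auto simp: \<rho>_def)
    qed
  next
    case False
    then have us: "s \<le> u" "u \<le> 0"
      using u by (auto simp: closed_segment_eq_real_ivl)
    show ?thesis
    proof (rule DERIV_nonneg_imp_nondecreasing[OF us(1)])
      fix x assume x: "s \<le> x" "x \<le> u"
      have "0 \<le> 2 * x * g x * exp (c / 2 * x^2)"
        using d(2)[of x] x us s by (cases "x = 0") (auto simp: \<rho>_def zero_le_mult_iff)
      then show "\<exists>y. (\<Phi> has_real_derivative y) (at x) \<and> 0 \<le> y"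
        using \<Phi>'[of x] x us s by (auto simp: \<rho>_def)
    qed
  qed
  show ?thesis
  proof (intro exI[of _ \<rho>] conjI allI impI)
    show "\<rho> > 0" "\<rho> \<le> \<delta>"
      using d \<delta> by (auto simp: \<rho>_def)
    fix s u assume s: "abs s < \<rho>" and u: "u \<in> closed_segment 0 s"
    let ?e = "exp (- (c / 4 * (abs s * \<bar>s - u\<bar>)))"
    \<comment> \<open>On the segment \<open>s\<close> and \<open>u\<close> have the same sign, so
      \<open>s^2 - u^2\<close> is \<open>\<bar>s\<bar> + \<bar>u\<bar>\<close> times
      \<open>\<bar>s - u\<bar>\<close>. The rate \<open>c / 2\<close> for the squared modulus
      becomes \<open>c / 4\<close> after taking roots.\<close>
    have "\<bar>u\<bar> \<le> \<bar>s\<bar>" and su: "\<bar>s - u\<bar> = \<bar>s\<bar> - \<bar>u\<bar>"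
      using u by (auto simp: closed_segment_eq_real_ivl split: if_splits)
    then have "abs s * \<bar>s - u\<bar> \<le> (\<bar>s\<bar> + \<bar>u\<bar>) * (\<bar>s\<bar> - \<bar>u\<bar>)"
      unfolding su by (intro mult_right_mono) auto
    also have "\<dots> = s^2 - u^2"
      by (simp add: square_diff_square_factored[symmetric] power2_eq_square)
    finally have le: "abs s * \<bar>s - u\<bar> \<le> s^2 - u^2" .
    have "(norm (lam s))^2 = \<Phi> s * exp (- (c / 2 * s^2))"
      by (simp add: \<Phi>_def exp_minus)
    also have "\<dots> \<le> \<Phi> u * exp (- (c / 2 * s^2))"
      by (intro mult_right_mono mono s u) simp
    also have "\<dots> = (norm (lam u))^2 * exp (c / 2 * u^2 - c / 2 * s^2)"
      by (simp only: \<Phi>_def diff_conv_add_uminus exp_add mult.assoc)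
    also have "\<dots> \<le> (norm (lam u))^2 * exp (2 * (- (c / 4 * (abs s * \<bar>s - u\<bar>))))"
      using mult_left_mono[OF le, of "c / 2"] c by (intro mult_left_mono) (auto simp: algebra_simps)
    also have "\<dots> = (norm (lam u) * ?e)^2"
      by (simp add: power_mult_distrib exp_double[symmetric])
    finally show "norm (lam s) \<le> norm (lam u) * ?e"
      by (rule power2_le_imp_le) simp
  qed
qed

text \<open>The radius must be fixed before \<epsilon>, although Peano's remainder is below
  \<open>\<epsilon> * abs s ^ (m + 2)\<close> only on a smaller interval
  \<open>\<bar>s\<bar> < \<theta>\<close>. Outside it,
  \<open>1 \<le> \<bar>s\<bar> / \<theta>\<close> turns the crude bound into one of order
  \<open>m + 3\<close> with a constant depending on \<epsilon>, harmless since it gains a power of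
  \<open>1 / sqrt n\<close>.\<close>

lemma eigenvalue_structure:
  fixes lam :: "real \<Rightarrow> complex" and c :: real
  assumes c: "c > 0" and \<delta>: "\<delta> > 0" and m: "m \<ge> 1"
    and Ck: "Ck_on (m + 2) {-\<delta>..\<delta>} lam"
    and lim: "((\<lambda>s. (lam s - (1 - complex_of_real (c * s^2 / 2))) / complex_of_real (s^2)) \<longlongrightarrow> 0) (at 0)"
  obtains \<rho> and Q :: "complex poly" where "0 < \<rho>" "\<rho> \<le> \<delta>" "\<rho> \<le> 1" "lam 0 = 1"
    "\<And>s u. abs s < \<rho> \<Longrightarrow> u \<in> closed_segment 0 s \<Longrightarrow>
       norm (lam s) \<le> norm (lam u) * exp (- (c / 4 * (abs s * \<bar>s - u\<bar>)))"
    "\<And>s. abs s < \<rho> \<Longrightarrow> norm (of_real s ^ 3 * poly Q (of_real s)) \<le> c / 4 * s^2"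
    "\<And>\<epsilon>. \<epsilon> > 0 \<Longrightarrow> \<exists>C>0. \<forall>s. abs s < \<rho> \<longrightarrow>
       norm (of_real (exp (c / 2 * s^2)) * lam s - (1 + of_real s ^ 3 * poly Q (of_real s)))
         \<le> \<epsilon> * abs s ^ (m + 2) + C * abs s ^ (m + 3)"
proof -
  define F where "F j = vderivs j {-\<delta>..\<delta>} lam 0" for j
  define L where "L = taylor_poly F (m + 3)"
  define \<kappa> where "\<kappa> = c / 2"
  have peano: "\<exists>\<eta>>0. \<forall>s. abs s < \<eta> \<longrightarrow> norm (lam s - poly L (of_real s)) \<le> \<epsilon> * abs s ^ (m + 2)" if "\<epsilon> > 0" for \<epsilon>
    using taylor_peano[of "m + 1" \<delta> lam \<epsilon>] Ck \<delta> that
    by (simp add: L_def F_def[abs_def] numeral_3_eq_3 numeral_2_eq_2)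
  obtain \<eta> where \<eta>: "\<eta> > 0" "\<And>s. abs s < \<eta> \<Longrightarrow> norm (lam s - poly L (of_real s)) \<le> abs s ^ (m + 2)"
    using peano[of 1] by auto
  \<comment> \<open>The Taylor polynomial and the assumed second-order expansion both approximate
    \<open>lam\<close> to \<open>o(s^2)\<close>. Their difference is a polynomial, hence divisible
    by \<open>s ^ 3\<close>, and this fixes the derivatives of \<open>lam\<close> at 0 up to order
    2.\<close>
  have "((\<lambda>s. (lam s - poly L (of_real s)) / complex_of_real (s^2)) \<longlongrightarrow> 0) (at 0)"
  proof (rule Lim_null_comparison)
    show "((\<lambda>s::real. \<bar>s\<bar>) \<longlongrightarrow> 0) (at 0)"
      by (intro tendsto_rabs_zero tendsto_ident_at)
    have "\<forall>\<^sub>F s in at (0::real). abs s < min \<eta> 1 \<and> s \<noteq> 0"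
      unfolding eventually_at using \<eta> by (intro exI[of _ "min \<eta> 1"]) (auto simp: dist_norm)
    then show "\<forall>\<^sub>F s in at 0. norm ((lam s - poly L (of_real s)) / complex_of_real (s^2)) \<le> \<bar>s\<bar>"
    proof eventually_elim
      case (elim s)
      have "norm ((lam s - poly L (of_real s)) / complex_of_real (s^2)) \<le> abs s ^ (m + 2) / s^2"
        using \<eta>(2)[of s] elim by (auto simp: norm_divide norm_power intro!: divide_right_mono)
      also have "\<dots> = abs s ^ m"
        using elim by (simp only: power_add power2_abs) simp
      also have "\<dots> \<le> abs s ^ 1"
        using elim m by (intro power_decreasing) auto
      finally show ?case by simp
    qed
  qed
  from tendsto_diff[OF lim this]
  have "((\<lambda>s. (poly L (of_real s) - (1 - complex_of_real (c * s^2 / 2))) / complex_of_real (s^2)) \<longlongrightarrow> 0) (at 0)"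
    by (simp add: diff_divide_distrib[symmetric] algebra_simps)
  then have "((\<lambda>s::real. poly (L - 1 + monom (of_real \<kappa>) 2) (of_real s) / of_real s ^ 2) \<longlongrightarrow> 0) (at 0)"
    by (simp add: poly_monom \<kappa>_def algebra_simps)
  then obtain Lt where "L - 1 + monom (of_real \<kappa>) 2 = monom 1 (Suc 2) * Lt"
    using poly_little_o_imp_factor by blast
  then have Lt: "L = 1 - monom (of_real \<kappa>) 2 + monom 1 3 * Lt"
    by (simp add: algebra_simps numeral_3_eq_3)
  have coeff: "coeff L 0 = 1" "coeff L 1 = 0" "coeff L 2 = - of_real \<kappa>"
    unfolding Lt by (auto simp: coeff_monom_mult)
  have F: "F 0 = 1" "F 1 = 0" "F 2 = - of_real c"
    using coeff by (auto simp: L_def coeff_taylor_poly \<kappa>_def)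
  have lam0: "lam 0 = 1"
    using F(1) by (simp add: F_def)
  obtain \<rho>1 where \<rho>1: "\<rho>1 > 0" "\<rho>1 \<le> \<delta>"
    "\<And>s u. abs s < \<rho>1 \<Longrightarrow> u \<in> closed_segment 0 s \<Longrightarrow>
       norm (lam s) \<le> norm (lam u) * exp (- (c / 4 * (abs s * \<bar>s - u\<bar>)))"
  proof -
    have "(lam has_vector_derivative vderivs 1 {-\<delta>..\<delta>} lam u) (at u)" if "abs u < \<delta>" for u
      using Ck_on_derivative_at[OF Ck, of 0 u] that by simp
    moreover have "(vderivs 1 {-\<delta>..\<delta>} lam has_vector_derivative - of_real c) (at 0)"
      using Ck_on_derivative_at[OF Ck, of 1 0] \<delta> F(3) by (simp add: F_def numeral_2_eq_2)
    ultimately show thesis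
      using eigenvalue_decay[OF c \<delta>, of lam "vderivs 1 {-\<delta>..\<delta>} lam"] lam0 F(2) that
      unfolding F_def by blast
  qed
  have "\<kappa> \<ge> 0"
    using c by (simp add: \<kappa>_def)
  from exp_square_poly_approx[OF this, of "m + 3"]
  obtain E :: "complex poly" and C1 where C1: "C1 > 0" "\<And>s. \<bar>s\<bar> \<le> 1 \<Longrightarrow>
    norm (of_real (exp (\<kappa> * s^2)) - poly (1 + monom (of_real \<kappa>) 2 + monom 1 4 * E) (of_real s)) \<le> C1 * abs s ^ (2 * (m + 3))"
    by blast
  define EE where "EE = 1 + monom (of_real \<kappa>) 2 + monom 1 4 * E"
  \<comment> \<open>Read off from the product of \<open>1 + \<kappa> s^2 + s^4 E\<close> and
    \<open>1 - \<kappa> s^2 + s^3 Lt\<close>: the quadratic terms cancel and leave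
    \<open>- \<kappa>^2 s^4\<close>, and \<open>s ^ 3\<close> is divided out.\<close>
  define Q where "Q = Lt * EE + monom 1 1 * E * (1 - monom (of_real \<kappa>) 2) - monom (of_real (\<kappa>^2)) 1"
  have Q: "1 + of_real s ^ 3 * poly Q (of_real s) = poly EE (of_real s) * poly L (of_real s)" for s :: real
    unfolding Lt Q_def EE_def by (simp add: poly_monom algebra_simps eval_nat_numeral)
  obtain D where D: "D > 0" "\<And>s::real. \<bar>s\<bar> \<le> 1 \<Longrightarrow> norm (poly Q (of_real s)) \<le> D"
    using poly_bounded_unit_interval[of Q] by auto
  obtain D' where D': "D' > 0" "\<And>s::real. \<bar>s\<bar> \<le> 1 \<Longrightarrow> norm (poly L (of_real s)) \<le> D'"
    using poly_bounded_unit_interval[of L] by auto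
  \<comment> \<open>The bound \<open>c / (4 * D)\<close> makes the cubic term at most
    \<open>c / 4 * s^2\<close>, so that it cannot outweigh the Gaussian decay after taking
    \<open>n\<close>-th powers.\<close>
  define \<rho> where "\<rho> = min (min \<rho>1 \<eta>) (min 1 (c / (4 * D)))"
  show thesis
  proof (rule that[of \<rho> Q])
    show "0 < \<rho>" "\<rho> \<le> \<delta>" "\<rho> \<le> 1" "lam 0 = 1"
      using \<rho>1 \<eta> c D lam0 by (auto simp: \<rho>_def)
    show "norm (lam s) \<le> norm (lam u) * exp (- (c / 4 * (abs s * \<bar>s - u\<bar>)))"
      if "abs s < \<rho>" "u \<in> closed_segment 0 s" for s u
      using that by (intro \<rho>1) (auto simp: \<rho>_def)
    show "norm (of_real s ^ 3 * poly Q (of_real s)) \<le> c / 4 * s^2" if s: "abs s < \<rho>" for s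
    proof -
      have "norm (of_real s ^ 3 * poly Q (of_real s)) = s^2 * (abs s * norm (poly Q (of_real s)))"
        by (simp add: norm_mult norm_power eval_nat_numeral abs_mult[symmetric])
      also have "\<dots> \<le> s^2 * (c / (4 * D) * D)"
        using s D by (intro mult_left_mono mult_mono) (auto simp: \<rho>_def)
      finally show ?thesis
        using D by (simp add: mult.commute)
    qed
    let ?err = "\<lambda>s::real. norm (of_real (exp (c / 2 * s^2)) * lam s - (1 + of_real s ^ 3 * poly Q (of_real s)))"
    fix \<epsilon> :: real assume \<epsilon>: "\<epsilon> > 0"
    define \<epsilon>' where "\<epsilon>' = \<epsilon> / exp \<kappa>"
    have \<epsilon>': "\<epsilon>' > 0"
      using \<epsilon> by (simp add: \<epsilon>'_def)
    obtain \<theta> where \<theta>: "\<theta> > 0" "\<And>s. abs s < \<theta> \<Longrightarrow> norm (lam s - poly L (of_real s)) \<le> \<epsilon>' * abs s ^ (m + 2)"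
      using peano[OF \<epsilon>'] by auto
    define C where "C = exp \<kappa> / \<theta> + C1 * D'"
    have C: "C > 0"
      using \<theta> C1 D' by (simp add: C_def add_pos_pos)
    show "\<exists>C>0. \<forall>s. abs s < \<rho> \<longrightarrow>
       ?err s
         \<le> \<epsilon> * abs s ^ (m + 2) + C * abs s ^ (m + 3)"
    proof (intro exI[of _ C] conjI allI impI C)
      fix s :: real assume s: "abs s < \<rho>"
      have s1: "\<bar>s\<bar> \<le> 1"
        using s by (auto simp: \<rho>_def)
      have "s^2 \<le> 1"
        using s1 by (simp add: abs_square_le_1)
      then have "\<kappa> * s^2 \<le> \<kappa> * 1"
        using c by (intro mult_left_mono) (auto simp: \<kappa>_def)
      then have e: "exp (\<kappa> * s^2) \<le> exp \<kappa>"
        by simp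
      have main: "norm (lam s - poly L (of_real s)) \<le> \<epsilon>' * abs s ^ (m + 2) + 1 / \<theta> * abs s ^ (m + 3)"
      proof (cases "abs s < \<theta>")
        case True
        have "0 \<le> 1 / \<theta> * abs s ^ (m + 3)"
          using \<theta> by simp
        then show ?thesis
          using \<theta>(2)[OF True] by linarith
      next
        case False
        have "norm (lam s - poly L (of_real s)) \<le> abs s ^ (m + 2) * 1"
          using \<eta>(2)[of s] s by (simp add: \<rho>_def)
        also have "\<dots> \<le> abs s ^ (m + 2) * (\<bar>s\<bar> / \<theta>)"
          using False \<theta> by (intro mult_left_mono) (auto simp: field_simps)
        also have "\<dots> = 1 / \<theta> * abs s ^ (m + 3)"
          by (simp add: eval_nat_numeral)
        also have "\<dots> \<le> \<epsilon>' * abs s ^ (m + 2) + 1 / \<theta> * abs s ^ (m + 3)"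
          using \<epsilon>' by simp
        finally show ?thesis .
      qed
      have "of_real (exp (c / 2 * s^2)) * lam s - (1 + of_real s ^ 3 * poly Q (of_real s))
          = of_real (exp (\<kappa> * s^2)) * (lam s - poly L (of_real s))
            + (of_real (exp (\<kappa> * s^2)) - poly EE (of_real s)) * poly L (of_real s)"
        unfolding Q by (simp add: \<kappa>_def algebra_simps)
      also have "norm \<dots> \<le> exp (\<kappa> * s^2) * norm (lam s - poly L (of_real s))
            + norm (of_real (exp (\<kappa> * s^2)) - poly EE (of_real s)) * norm (poly L (of_real s))"
        by (rule order_trans[OF norm_triangle_ineq]) (simp add: norm_mult)
      also have "\<dots> \<le> exp \<kappa> * (\<epsilon>' * abs s ^ (m + 2) + 1 / \<theta> * abs s ^ (m + 3)) + (C1 * abs s ^ (m + 3)) * D'"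
      proof (intro add_mono mult_mono e main D' s1)
        have "norm (of_real (exp (\<kappa> * s^2)) - poly EE (of_real s)) \<le> C1 * abs s ^ (2 * (m + 3))"
          using C1(2)[OF s1] by (simp add: EE_def)
        also have "\<dots> \<le> C1 * abs s ^ (m + 3)"
          using C1 s1 by (intro mult_left_mono power_decreasing) auto
        finally show "norm (of_real (exp (\<kappa> * s^2)) - poly EE (of_real s)) \<le> C1 * abs s ^ (m + 3)" .
      qed (use C1 in auto)
      also have "\<dots> = \<epsilon> * abs s ^ (m + 2) + C * abs s ^ (m + 3)"
        by (simp add: C_def \<epsilon>'_def algebra_simps)
      finally show "?err s
         \<le> \<epsilon> * abs s ^ (m + 2) + C * abs s ^ (m + 3)" .
    qed
  qed
qed

section \<open>Expansion of the characteristic function near the origin\<close>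

text \<open>Telescoping of the powers; \<open>1 \<le> M\<close> allows the exponent \<open>n\<close>
  where \<open>n - 1\<close> would appear, which avoids subtraction on naturals.\<close>

lemma norm_power_difference_le:
  fixes p q :: complex
  assumes "norm p \<le> M" "norm q \<le> M" "1 \<le> M"
  shows "norm (q ^ n - p ^ n) \<le> real n * norm (q - p) * M ^ n"
proof (induction n)
  case (Suc n)
  have "q ^ Suc n - p ^ Suc n = q * (q ^ n - p ^ n) + (q - p) * p ^ n"
    by (simp add: algebra_simps)
  also have "norm \<dots> \<le> norm q * norm (q ^ n - p ^ n) + norm (q - p) * norm p ^ n"
    by (rule order_trans[OF norm_triangle_ineq]) (simp add: norm_mult norm_power)
  also have "\<dots> \<le> M * (real n * norm (q - p) * M ^ n) + norm (q - p) * (1 * M ^ n)"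
    using assms Suc by (intro add_mono mult_mono mult_left_mono order_trans[OF power_mono[OF assms(1)]]) auto
  also have "\<dots> \<le> M * (real n * norm (q - p) * M ^ n) + norm (q - p) * (M * M ^ n)"
    using assms by (intro add_mono mult_left_mono mult_right_mono) auto
  also have "\<dots> = real (Suc n) * norm (q - p) * M ^ Suc n"
    by (simp add: algebra_simps)
  finally show ?case .
qed simp

text \<open>By Pascal's rule the remainder for \<open>n + 1\<close> and \<open>K + 1\<close> is the
  one for \<open>n\<close> and \<open>K + 1\<close> plus \<open>z\<close> times the one for
  \<open>n\<close> and \<open>K\<close>; hence the induction on \<open>n\<close> with
  \<open>K\<close> general.\<close>

lemma binomial_remainder_le:
  fixes z :: complex
  shows "norm ((1 + z) ^ n - (\<Sum>k<K. of_nat (n choose k) * z ^ k)) \<le> (real n * norm z) ^ K * (1 + norm z) ^ n"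
proof (induction n arbitrary: K)
  case 0
  show ?case
  proof (cases K)
    case (Suc K')
    then show ?thesis
      by (simp add: sum.lessThan_Suc_shift del: sum.lessThan_Suc)
  qed simp
next
  case (Suc n)
  show ?case
  proof (cases K)
    case 0
    have "norm (1 + z) ^ Suc n \<le> (1 + norm z) ^ Suc n"
      by (intro power_mono order_trans[OF norm_triangle_ineq]) auto
    then show ?thesis
      using 0 by (simp add: norm_power norm_mult)
  next
    case (Suc K')
    let ?R = "\<lambda>K. (1 + z) ^ n - (\<Sum>k<K. of_nat (n choose k) * z ^ k)"
    have "(\<Sum>k<Suc K'. of_nat (Suc n choose k) * z ^ k)
        = (\<Sum>k<Suc K'. of_nat (n choose k) * z ^ k) + z * (\<Sum>k<K'. of_nat (n choose k) * z ^ k)"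
      by (simp add: sum.lessThan_Suc_shift sum.distrib sum_distrib_left algebra_simps del: sum.lessThan_Suc)
    then have "(1 + z) ^ Suc n - (\<Sum>k<Suc K'. of_nat (Suc n choose k) * z ^ k) = ?R (Suc K') + z * ?R K'"
      by (simp add: algebra_simps del: sum.lessThan_Suc)
    also have "norm \<dots> \<le> norm (?R (Suc K')) + norm z * norm (?R K')"
      by (rule order_trans[OF norm_triangle_ineq]) (simp add: norm_mult)
    also have "\<dots> \<le> (real n * norm z) ^ Suc K' * (1 + norm z) ^ n + norm z * ((real n * norm z) ^ K' * (1 + norm z) ^ n)"
      by (intro add_mono mult_left_mono Suc.IH) auto
    also have "\<dots> = real n ^ K' * real (Suc n) * norm z ^ Suc K' * (1 + norm z) ^ n"
      by (simp add: algebra_simps power_mult_distrib)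
    also have "\<dots> \<le> real (Suc n) ^ K' * real (Suc n) * norm z ^ Suc K' * (1 + norm z) ^ Suc n"
      by (intro mult_mono power_mono power_increasing) auto
    also have "\<dots> = (real (Suc n) * norm z) ^ Suc K' * (1 + norm z) ^ Suc n"
      by (simp only: power_mult_distrib power_Suc mult_ac)
    finally show ?thesis
      unfolding Suc .
  qed
qed

text \<open>Polynomials in \<open>v\<close> whose coefficients are polynomials in \<open>t\<close>;
  the outer variable is evaluated at the constant polynomial \<open>[:v:]\<close>. Closure
  properties then show that the expansion is polynomial without computing its coefficients.\<close>

definition bipoly :: "(complex \<Rightarrow> complex \<Rightarrow> complex) \<Rightarrow> bool" where
  "bipoly f \<longleftrightarrow> (\<exists>p :: complex poly poly. \<forall>v t. f v t = poly (poly p [:v:]) t)"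

lemma bipoly_const: "bipoly (\<lambda>v t. a)"
  unfolding bipoly_def by (intro exI[of _ "[:[:a:]:]"]) simp

lemma bipoly_fst: "bipoly (\<lambda>v t. v)"
  unfolding bipoly_def by (intro exI[of _ "[:0, 1:]"]) simp

lemma bipoly_snd: "bipoly (\<lambda>v t. t)"
  unfolding bipoly_def by (intro exI[of _ "[:[:0, 1:]:]"]) simp

lemma bipoly_add: "bipoly f \<Longrightarrow> bipoly g \<Longrightarrow> bipoly (\<lambda>v t. f v t + g v t)"
  unfolding bipoly_def by (metis poly_add)

lemma bipoly_mult: "bipoly f \<Longrightarrow> bipoly g \<Longrightarrow> bipoly (\<lambda>v t. f v t * g v t)"
  unfolding bipoly_def by (metis poly_mult)

lemma bipoly_sum: "(\<And>i. i \<in> I \<Longrightarrow> bipoly (f i)) \<Longrightarrow> bipoly (\<lambda>v t. \<Sum>i\<in>I. f i v t)"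
  by (induction I rule: infinite_finite_induct) (auto intro: bipoly_const bipoly_add)

lemma bipoly_prod: "(\<And>i. i \<in> I \<Longrightarrow> bipoly (f i)) \<Longrightarrow> bipoly (\<lambda>v t. \<Prod>i\<in>I. f i v t)"
  by (induction I rule: infinite_finite_induct) (auto intro: bipoly_const bipoly_mult)

lemma bipoly_power: "bipoly f \<Longrightarrow> bipoly (\<lambda>v t. f v t ^ k)"
  using bipoly_prod[of "{..<k}" "\<lambda>_. f"] by simp

lemma bipoly_poly: "bipoly f \<Longrightarrow> bipoly (\<lambda>v t. poly q (f v t))"
  unfolding poly_altdef by (intro bipoly_sum bipoly_mult bipoly_const bipoly_power)

text \<open>Ordering by powers of \<open>v\<close>, the value at \<open>v = 0\<close> is the leading
  coefficient \<open>A 0\<close>. At \<open>t = 0\<close> the polynomial in \<open>v\<close> with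
  coefficients \<open>poly (A k) 0\<close> is constantly 1, so its higher coefficients
  vanish.\<close>

lemma bipoly_expansion:
  assumes "bipoly f" and f0: "\<And>t. f 0 t = 1" and f1: "\<And>v. f v 0 = 1"
  obtains A :: "nat \<Rightarrow> complex poly" and d where "A 0 = 1" "\<And>k. k \<ge> 1 \<Longrightarrow> poly (A k) 0 = 0"
    "\<And>v t. f v t = (\<Sum>k\<le>d. poly (A k) t * v ^ k)"
proof -
  obtain p :: "complex poly poly" where p: "\<And>v t. f v t = poly (poly p [:v:]) t"
    using assms(1) by (auto simp: bipoly_def)
  have const_power: "[:v:] ^ k = [:v ^ k:]" for v :: complex and k
    by (induction k) (auto simp: one_pCons)
  have f: "f v t = (\<Sum>k\<le>degree p. poly (coeff p k) t * v ^ k)" for v t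
    unfolding p by (subst poly_altdef) (simp add: poly_sum const_power mult.commute)
  show thesis
  proof (rule that[OF _ _ f])
    have "poly (coeff p 0) = poly 1"
      using f0 by (auto simp: p fun_eq_iff poly_0_coeff_0)
    then show "coeff p 0 = 1"
      by (simp only: poly_eq_poly_eq_iff)
    fix k :: nat assume k: "k \<ge> 1"
    define q where "q = (\<Sum>k\<le>degree p. monom (poly (coeff p k) 0) k)"
    have "poly q = poly 1"
      using f1 by (auto simp: f q_def fun_eq_iff poly_sum poly_monom)
    then have "q = 1"
      by (simp only: poly_eq_poly_eq_iff)
    moreover have "coeff q k = poly (coeff p k) 0"
      by (cases "k \<le> degree p") (auto simp: q_def coeff_sum coeff_eq_0)
    ultimately show "poly (coeff p k) 0 = 0"
      using k by (simp add: coeff_1)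
  qed
qed

lemma power_mult_gauss_le_uniform:
  fixes c :: real
  assumes c: "c > 0"
  shows "\<exists>C>0. \<forall>j\<le>M. \<forall>t. abs t ^ j * exp (- (c * t^2)) \<le> C * cauchy t"
proof -
  obtain C where C: "\<And>j. C j > 0" "\<And>j t. abs t ^ j * exp (- (c * t^2)) \<le> C j * cauchy t"
    using power_mult_gauss_le[OF c] by metis
  show ?thesis
  proof (intro exI[of _ "\<Sum>j\<le>M. C j"] conjI allI impI)
    show "(\<Sum>j\<le>M. C j) > 0"
      using C by (intro sum_pos) auto
    fix j t assume "j \<le> M"
    then have "C j \<le> (\<Sum>j\<le>M. C j)"
      using C(1)[THEN less_imp_le] by (intro member_le_sum) auto
    then have "C j * cauchy t \<le> (\<Sum>j\<le>M. C j) * cauchy t"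
      by (intro mult_right_mono) (auto simp: add_nonneg_nonneg)
    then show "abs t ^ j * exp (- (c * t^2)) \<le> (\<Sum>j\<le>M. C j) * cauchy t"
      using C(2)[of t j] by linarith
  qed
qed

text \<open>The first bound serves for \<open>\<bar>t\<bar> \<le> 1\<close>, the second beyond.
  Integrability at infinity needs \<open>m + 1 \<ge> 2\<close>, and this is where the order being at
  least 1 enters.\<close>

lemma min_power_le_inverse:
  fixes x t C :: real
  assumes m: "m \<ge> 1" and C: "C \<ge> 0"
    and x: "x \<le> abs t ^ (m + 1)" "x * abs t ^ (m + 1) \<le> C"
  shows "x \<le> 2 * (1 + C) * cauchy t"
proof (cases "\<bar>t\<bar> \<le> 1")
  case True
  have "x \<le> 1"
    using x(1) power_le_one[of "\<bar>t\<bar>" "m + 1"] True by linarith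
  moreover have "t^2 \<le> 1"
    using True by (simp add: abs_square_le_1)
  then have "1 + t^2 \<le> 2 * (1 + C)"
    using C by simp
  then have "1 \<le> 2 * (1 + C) * cauchy t"
    by (simp add: field_simps add_pos_nonneg)
  ultimately show ?thesis
    by linarith
next
  case False
  show ?thesis
  proof (cases "x \<le> 0")
    case True
    then show ?thesis
      using C by (intro order_trans[OF True]) (simp add: add_nonneg_nonneg)
  next
    case x0: False
    have t2: "abs t ^ 2 \<le> abs t ^ (m + 1)" "1 \<le> abs t ^ 2"
      using False m by (intro power_increasing one_le_power; simp)+
    have "x * (1 + t^2) \<le> x * (2 * abs t ^ (m + 1))"
      using t2 x0 by (intro mult_left_mono) auto
    also have "\<dots> \<le> 2 * (1 + C)"
      using x(2) C by simp
    finally show ?thesis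
      by (simp add: field_simps add_pos_nonneg)
  qed
qed

text \<open>Here \<open>v\<close> is \<open>1 / sqrt n\<close>, so
  \<open>n * \<bar>s\<bar> = \<bar>t\<bar> / v\<close>. The bound \<open>\<beta>\<close> is
  available at an intermediate point \<open>u\<close>, while the power of \<open>lam\<close> stands
  at \<open>s\<close>; \<open>decay\<close> bridges the two and leaves the gain
  \<open>exp (- y)\<close>, which compensates the missing Gaussian factor in
  \<open>\<beta>\<close>.\<close>

lemma characteristic_taylor:
  fixes F :: "nat \<Rightarrow> real \<Rightarrow> complex" and lam :: "real \<Rightarrow> complex" and c t v :: real
  defines "s \<equiv> t * v"
  assumes c: "c > 0" and m: "m \<ge> 1" and v: "v > 0" "real n * v^2 = 1"
    and der: "\<And>j u. j < m + 2 \<Longrightarrow> u \<in> closed_segment 0 s \<Longrightarrow> (F j has_vector_derivative F (Suc j) u) (at u)"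
    and decay: "\<And>u. u \<in> closed_segment 0 s \<Longrightarrow> norm (lam s) \<le> norm (lam u) * exp (- (c / 4 * (abs s * \<bar>s - u\<bar>)))"
    and bnd: "\<And>u. u \<in> closed_segment 0 s \<Longrightarrow> norm (lam u ^ n * F (m + 2) u) \<le> \<beta>"
  shows "norm (lam s ^ n * F 0 s - lam s ^ n * (\<Sum>j<m + 2. F j 0 * of_real (s ^ j / fact j)))
    \<le> \<beta> * v ^ (m + 2) * (2 * (1 + (4 / c) ^ (m + 1))) * (abs t * cauchy t)"
proof -
  have \<beta>: "\<beta> \<ge> 0"
    by (rule order_trans[OF norm_ge_zero bnd[of 0]]) simp
  define Y where "Y = 2 * (1 + (4 / c) ^ (m + 1)) * cauchy t"
  have bound: "norm (lam s ^ n * F (Suc (m + 1)) u - 0) * (\<bar>s - u\<bar> ^ (m + 1) / fact (m + 1)) \<le> \<beta> * (v ^ (m + 1) * Y)"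
    if u: "u \<in> closed_segment 0 s" for u
  proof -
    define w where "w = \<bar>s - u\<bar>"
    define y where "y = real n * (c / 4 * (abs s * w))"
    have w: "0 \<le> w" "w \<le> \<bar>s\<bar>"
      using u by (auto simp: w_def closed_segment_eq_real_ivl split: if_splits)
    have y: "0 \<le> y"
      using c w by (simp add: y_def)
    have "norm (lam s ^ n * F (Suc (m + 1)) u) \<le> (norm (lam u) * exp (- (c / 4 * (abs s * w)))) ^ n * norm (F (m + 2) u)"
      using decay[OF u] by (auto simp: norm_mult norm_power w_def intro!: mult_right_mono power_mono)
    also have "\<dots> = norm (lam u ^ n * F (m + 2) u) * exp (- y)"
      by (simp add: norm_mult norm_power power_mult_distrib exp_of_nat_mult[symmetric] y_def)
    also have "\<dots> \<le> \<beta> * exp (- y)"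
      by (intro mult_right_mono bnd u) simp
    finally have 1: "norm (lam s ^ n * F (Suc (m + 1)) u) \<le> \<beta> * exp (- y)" .
    \<comment> \<open>The weight measured in units of \<open>v ^ (m + 1)\<close>. One bound is
      \<open>\<bar>s - u\<bar> \<le> \<bar>s\<bar>\<close>; the other is the exponential series at
      \<open>y\<close>, whose factorial cancels that of the Taylor weight.\<close>
    define x where "x = exp (- y) * (w ^ (m + 1) / fact (m + 1)) / v ^ (m + 1)"
    have "x \<le> Y"
      unfolding Y_def
    proof (rule min_power_le_inverse[OF m])
      have "exp (- y) * (w ^ (m + 1) / fact (m + 1)) \<le> 1 * (abs s ^ (m + 1) / 1)"
        using y w by (intro mult_mono frac_le power_mono) (auto simp: fact_ge_1 simp del: fact_Suc)
      also have "\<dots> = abs t ^ (m + 1) * v ^ (m + 1)"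
        using v by (simp add: s_def abs_mult power_mult_distrib)
      finally show "x \<le> abs t ^ (m + 1)"
        using v by (simp add: x_def divide_le_eq mult_ac del: power_Suc fact_Suc)
      have h1: "y ^ (m + 1) / fact (m + 1) \<le> exp y"
        using y by (rule power_div_fact_le_exp)
      have h2: "y = c / 4 * (w * \<bar>t\<bar> / v)"
      proof -
        have "real n * \<bar>s\<bar> = (real n * v^2) * \<bar>t\<bar> / v"
          using v(1) by (simp add: s_def abs_mult power2_eq_square)
        then show ?thesis
          unfolding v(2) by (simp add: y_def field_simps)
      qed
      have h3: "c / 4 * (w * \<bar>t\<bar>) / v = y"
        unfolding h2 by simp
      define G where "G = (w * \<bar>t\<bar> / v) ^ (m + 1) / fact (m + 1)"
      have "(c / 4) ^ (m + 1) * G \<le> exp y"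
        unfolding G_def times_divide_eq_right power_mult_distrib[symmetric] h3 by (rule h1)
      then have "(4 / c) ^ (m + 1) * ((c / 4) ^ (m + 1) * G) \<le> (4 / c) ^ (m + 1) * exp y"
        using c by (intro mult_left_mono) auto
      moreover have "(4 / c) ^ (m + 1) * (c / 4) ^ (m + 1) = 1"
        using c by (simp only: power_mult_distrib[symmetric]) simp
      ultimately have "(w * \<bar>t\<bar> / v) ^ (m + 1) / fact (m + 1) \<le> (4 / c) ^ (m + 1) * exp y"
        by (simp only: mult.assoc[symmetric] mult_1 G_def)
      then have "exp (- y) * ((w * \<bar>t\<bar> / v) ^ (m + 1) / fact (m + 1)) \<le> exp (- y) * ((4 / c) ^ (m + 1) * exp y)"
        by (rule mult_left_mono) simp
      also have "\<dots> = (4 / c) ^ (m + 1)"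
        by (simp add: exp_minus)
      finally show "x * abs t ^ (m + 1) \<le> (4 / c) ^ (m + 1)"
        by (simp add: x_def power_divide power_mult_distrib mult_ac del: fact_Suc power_Suc)
    qed (use c in simp)
    then have 2: "exp (- y) * (w ^ (m + 1) / fact (m + 1)) \<le> v ^ (m + 1) * Y"
      using v by (simp add: x_def divide_le_eq mult_ac del: power_Suc fact_Suc)
    have "norm (lam s ^ n * F (Suc (m + 1)) u - 0) * (\<bar>s - u\<bar> ^ (m + 1) / fact (m + 1))
        \<le> \<beta> * exp (- y) * (w ^ (m + 1) / fact (m + 1))"
      using mult_right_mono[OF 1, of "w ^ (m + 1) / fact (m + 1)"] w by (simp add: w_def del: power_Suc fact_Suc)
    also have "\<dots> \<le> \<beta> * (v ^ (m + 1) * Y)"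
      using mult_left_mono[OF 2 \<beta>] by (simp add: mult.assoc del: power_Suc fact_Suc)
    finally show ?thesis .
  qed
  have "norm (lam s ^ n * F 0 s - (\<Sum>j<Suc (m + 1). lam s ^ n * F j 0 * of_real (s ^ j / fact j)) -
      0 * of_real (s ^ Suc (m + 1) / fact (Suc (m + 1)))) \<le> \<beta> * (v ^ (m + 1) * Y) * \<bar>s\<bar>"
  proof (rule taylor_mean_value[where F = "\<lambda>j u. lam s ^ n * F j u"])
    fix j u assume "j < Suc (m + 1)" "u \<in> closed_segment 0 s"
    then show "((\<lambda>u. lam s ^ n * F j u) has_vector_derivative lam s ^ n * F (Suc j) u) (at u)"
      by (intro has_vector_derivative_mult_right der) auto
  qed (rule bound)
  also have "\<beta> * (v ^ (m + 1) * Y) * \<bar>s\<bar> = \<beta> * v ^ (m + 2) * (2 * (1 + (4 / c) ^ (m + 1))) * (abs t * cauchy t)"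
    using v by (simp add: Y_def s_def abs_mult)
  finally show ?thesis
    by (simp add: sum_distrib_left mult.assoc del: sum.lessThan_Suc)
qed

text \<open>Exact agreement of the coefficients at \<open>j = 0\<close> removes the one term without
  a power of \<open>s\<close>; every other term yields the factor \<bar>t\<bar>.\<close>

lemma coefficient_error_le:
  fixes F B :: "nat \<Rightarrow> complex" and z :: complex and t s :: real
  assumes F: "F 0 = B 0" "\<And>j. j < m + 2 \<Longrightarrow> norm (F j - B j) \<le> \<alpha>"
    and s: "\<bar>s\<bar> \<le> \<bar>t\<bar>" and z: "norm z \<le> e"
    and dom: "\<And>j. j \<le> m \<Longrightarrow> abs t ^ j * e \<le> Y"
  shows "norm (z * (\<Sum>j<m + 2. F j * of_real (s ^ j / fact j)) - z * (\<Sum>j<m + 2. B j * of_real (s ^ j / fact j)))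
    \<le> \<alpha> * (real m + 1) * (abs t * Y)"
proof -
  have \<alpha>: "\<alpha> \<ge> 0"
    by (rule order_trans[OF norm_ge_zero F(2)[of 0]]) simp
  have e: "e \<ge> 0"
    using z norm_ge_zero[of z] by linarith
  have "z * (\<Sum>j<m + 2. F j * of_real (s ^ j / fact j)) - z * (\<Sum>j<m + 2. B j * of_real (s ^ j / fact j))
      = (\<Sum>j<Suc (m + 1). z * ((F j - B j) * of_real (s ^ j / fact j)))"
    by (simp add: sum_distrib_left left_diff_distrib right_diff_distrib sum_subtractf diff_divide_distrib del: sum.lessThan_Suc)
  also have "\<dots> = (\<Sum>j<m + 1. z * ((F (Suc j) - B (Suc j)) * of_real (s ^ Suc j / fact (Suc j))))"
    by (subst sum.lessThan_Suc_shift) (simp add: F(1) del: fact_Suc)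
  also have "norm \<dots> \<le> (\<Sum>j<m + 1. \<alpha> * (abs t * Y))"
  proof (rule sum_norm_le)
    fix j assume "j \<in> {..<m + 1}"
    then have j: "j \<le> m"
      by simp
    have "norm (z * ((F (Suc j) - B (Suc j)) * of_real (s ^ Suc j / fact (Suc j))))
        = norm z * (norm (F (Suc j) - B (Suc j)) * (abs s ^ Suc j / fact (Suc j)))"
      by (simp add: norm_mult norm_divide norm_power del: fact_Suc)
    also have "\<dots> \<le> e * (\<alpha> * (abs t ^ Suc j / 1))"
      using j z e \<alpha> s by (intro mult_mono frac_le power_mono F(2)) (auto simp: fact_ge_1 simp del: fact_Suc)
    also have "\<dots> = \<alpha> * (abs t * (abs t ^ j * e))"
      by simp
    also have "\<dots> \<le> \<alpha> * (abs t * Y)"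
      using \<alpha> by (intro mult_left_mono dom j) auto
    finally show "norm (z * ((F (Suc j) - B (Suc j)) * of_real (s ^ Suc j / fact (Suc j)))) \<le> \<alpha> * (abs t * Y)" .
  qed
  finally show ?thesis
    by (simp add: algebra_simps)
qed

text \<open>With \<open>q = exp (c / 2 * s^2) * lam\<close>, both \<open>q\<close> and
  \<open>1 + z\<close> are bounded by \<open>M = exp (c / 4 * s^2)\<close>. Replacing one by the
  other costs at most \<open>M ^ n\<close>, which uses up only half of the Gaussian exponent, so
  \<open>exp (- (c / 4 * t^2))\<close> remains to absorb powers of \<open>t\<close>.\<close>

lemma eigenvalue_power_expansion:
  fixes lam Q :: complex and c t v :: real
  defines "s \<equiv> t * v"
  defines "z \<equiv> of_real s ^ 3 * Q"
  assumes c: "c > 0" and v: "v > 0" "real n * v^2 = 1"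
    and dom: "\<And>j. j \<le> 3 * m + 3 \<Longrightarrow> abs t ^ j * exp (- (c / 4 * t^2)) \<le> Y"
    and lam: "norm lam \<le> exp (- (c / 4 * s^2))"
    and Q: "norm z \<le> c / 4 * s^2" "norm Q \<le> D"
    and R: "norm (of_real (exp (c / 2 * s^2)) * lam - (1 + z)) \<le> \<epsilon> * abs s ^ (m + 2) + C * abs s ^ (m + 3)"
    and nonneg: "\<epsilon> \<ge> 0" "C \<ge> 0"
  shows "norm (lam ^ n - of_real (exp (- (c / 2 * t^2))) * (\<Sum>k<Suc m. of_nat (n choose k) * z ^ k))
    \<le> (\<epsilon> * v ^ m + (C + D ^ (m + 1)) * v ^ (m + 1)) * (abs t * Y)"
proof -
  have ns: "real n * s^2 = t^2"
    using v by (simp add: s_def power_mult_distrib mult.left_commute)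
  have abs_s: "\<bar>s\<bar> = abs t * v"
    using v by (simp add: s_def abs_mult)
  have D: "D \<ge> 0"
    using Q(2) norm_ge_zero[of Q] by linarith
  define M where "M = exp (c / 4 * s^2)"
  have Mn: "M ^ n = exp (c / 4 * t^2)"
    unfolding M_def exp_of_nat_mult[symmetric] ns[symmetric] by (simp add: mult_ac)
  have M1: "M \<ge> 1"
    using c by (simp add: M_def)
  define q where "q = of_real (exp (c / 2 * s^2)) * lam"
  define w where "w = exp (- (c / 2 * t^2))"
  have wM: "w * M ^ n = exp (- (c / 4 * t^2))"
    unfolding w_def Mn exp_add[symmetric] by simp
  have w: "w > 0"
    by (simp add: w_def)
  have lamq: "lam ^ n = of_real w * q ^ n"
  proof -
    have "exp (c / 2 * s^2) ^ n = exp (c / 2 * t^2)"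
      unfolding exp_of_nat_mult[symmetric] ns[symmetric] by (simp add: mult_ac)
    then have "w * exp (c / 2 * s^2) ^ n = 1"
      by (simp add: w_def exp_minus)
    then have "of_real w * of_real (exp (c / 2 * s^2)) ^ n = (1::complex)"
      by (metis of_real_1 of_real_mult of_real_power)
    then show ?thesis
      by (simp add: q_def power_mult_distrib mult.assoc[symmetric])
  qed
  have qM: "norm q \<le> M"
  proof -
    have "norm q \<le> exp (c / 2 * s^2) * exp (- (c / 4 * s^2))"
      unfolding q_def using lam by (simp add: norm_mult)
    also have "\<dots> = M"
      unfolding M_def exp_add[symmetric] by simp
    finally show ?thesis .
  qed
  have zM: "1 + norm z \<le> M"
    unfolding M_def using Q(1) exp_ge_add_one_self[of "c / 4 * s^2"] by linarith
  have pM: "norm (1 + z) \<le> M"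
    using zM norm_triangle_ineq[of 1 z] by simp
  have "norm (q ^ n - (1 + z) ^ n) \<le> real n * norm (q - (1 + z)) * M ^ n"
    by (rule norm_power_difference_le[OF pM qM M1])
  also have "\<dots> \<le> real n * (\<epsilon> * abs s ^ (m + 2) + C * abs s ^ (m + 3)) * M ^ n"
    using R M1 by (intro mult_right_mono mult_left_mono) (auto simp: q_def)
  also have "real n * (\<epsilon> * abs s ^ (m + 2) + C * abs s ^ (m + 3))
      = (real n * v^2) * (\<epsilon> * v ^ m * abs t ^ (m + 2) + C * v ^ (m + 1) * abs t ^ (m + 3))"
    by (simp add: abs_s power_mult_distrib power_add power2_eq_square algebra_simps eval_nat_numeral)
  finally have 1: "norm (q ^ n - (1 + z) ^ n) \<le> (\<epsilon> * v ^ m * abs t ^ (m + 2) + C * v ^ (m + 1) * abs t ^ (m + 3)) * M ^ n"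
    using v(2) by simp
  let ?b = "\<Sum>k<Suc m. of_nat (n choose k) * z ^ k"
  \<comment> \<open>Of the three factors \<open>v\<close> in \<open>s ^ 3\<close>, two cancel
    against \<open>n\<close>; each further binomial term thus gains one \<open>v\<close>.\<close>
  have nz: "real n * norm z \<le> D * v * abs t ^ 3"
  proof -
    have "real n * norm z = real n * abs s ^ 3 * norm Q"
      by (simp add: z_def norm_mult norm_power)
    also have "\<dots> = (real n * v^2) * v * abs t ^ 3 * norm Q"
      by (simp add: abs_s power_mult_distrib eval_nat_numeral)
    also have "\<dots> \<le> 1 * v * abs t ^ 3 * D"
      unfolding v(2) using Q(2) v(1) by (intro mult_left_mono) auto
    finally show ?thesis
      by (simp add: mult_ac)
  qed
  have "norm ((1 + z) ^ n - ?b) \<le> (real n * norm z) ^ Suc m * (1 + norm z) ^ n"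
    by (rule binomial_remainder_le)
  also have "\<dots> \<le> (D * v * abs t ^ 3) ^ Suc m * M ^ n"
    using D v M1 by (intro mult_mono[OF power_mono[OF nz] power_mono[OF zM]]) auto
  \<comment> \<open>This is the highest power of \<open>t\<close> that occurs and fixes the range of
    \<open>j\<close> in \<open>dom\<close>.\<close>
  also have "(D * v * abs t ^ 3) ^ Suc m = D ^ (m + 1) * v ^ (m + 1) * abs t ^ (3 * m + 3)"
  proof -
    have "(abs t ^ 3) ^ Suc m = abs t ^ (3 * m + 3)"
      by (simp only: power_mult[symmetric]) (simp add: algebra_simps)
    then show ?thesis
      by (simp only: power_mult_distrib Suc_eq_plus1)
  qed
  finally have 2: "norm ((1 + z) ^ n - ?b) \<le> D ^ (m + 1) * v ^ (m + 1) * abs t ^ (3 * m + 3) * M ^ n" .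
  have pw: "abs t ^ Suc j * (w * M ^ n) \<le> abs t * Y" if "j \<le> 3 * m + 3" for j
    using mult_left_mono[OF dom[OF that], of "\<bar>t\<bar>"] by (simp add: wM)
  have "lam ^ n - of_real w * ?b = of_real w * ((q ^ n - (1 + z) ^ n) + ((1 + z) ^ n - ?b))"
    by (simp add: lamq algebra_simps del: sum.lessThan_Suc)
  also have "norm \<dots> \<le> w * (norm (q ^ n - (1 + z) ^ n) + norm ((1 + z) ^ n - ?b))"
    unfolding norm_mult norm_of_real using w by (intro mult_mono norm_triangle_ineq) auto
  also have "\<dots> \<le> w * ((\<epsilon> * v ^ m * abs t ^ (m + 2) + C * v ^ (m + 1) * abs t ^ (m + 3)) * M ^ n +
      D ^ (m + 1) * v ^ (m + 1) * abs t ^ (3 * m + 3) * M ^ n)"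
    using w by (intro mult_left_mono add_mono 1 2) simp
  also have "\<dots> = \<epsilon> * v ^ m * (abs t ^ Suc (m + 1) * (w * M ^ n)) + C * v ^ (m + 1) * (abs t ^ Suc (m + 2) * (w * M ^ n))
      + D ^ (m + 1) * v ^ (m + 1) * (abs t ^ Suc (3 * m + 2) * (w * M ^ n))"
    by (simp add: algebra_simps eval_nat_numeral)
  also have "\<dots> \<le> \<epsilon> * v ^ m * (abs t * Y) + C * v ^ (m + 1) * (abs t * Y) + D ^ (m + 1) * v ^ (m + 1) * (abs t * Y)"
    using nonneg v D by (intro add_mono mult_left_mono pw) auto
  also have "\<dots> = (\<epsilon> * v ^ m + (C + D ^ (m + 1)) * v ^ (m + 1)) * (abs t * Y)"
    by (simp add: algebra_simps)
  finally show ?thesis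
    unfolding w_def .
qed

text \<open>The variable \<open>n\<close> is eliminated by \<open>n * v^2 = 1\<close>: since
  \<open>(n - i) * v^2 = 1 - i * v^2\<close>, the binomial coefficient times
  \<open>v ^ (2 * k)\<close> is polynomial in \<open>v\<close>. The factor
  \<open>s ^ (3 * k)\<close> provides these powers and \<open>v ^ k\<close> besides.\<close>

lemma edgeworth_bipoly:
  fixes Q :: "complex poly" and B :: "nat \<Rightarrow> complex"
  assumes B0: "B 0 = 1"
  obtains A :: "nat \<Rightarrow> complex poly" and d where "A 0 = 1" "\<And>k. k \<ge> 1 \<Longrightarrow> poly (A k) 0 = 0"
    "\<And>n v t. real n * v^2 = 1 \<Longrightarrow>
      (\<Sum>k<Suc m. of_nat (n choose k) * (of_real (t * v) ^ 3 * poly Q (of_real (t * v))) ^ k) *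
      (\<Sum>j<m + 2. B j * of_real ((t * v) ^ j / fact j)) = (\<Sum>k\<le>d. poly (A k) (of_real t) * of_real v ^ k)"
proof -
  define f where "f v t = (\<Sum>k<Suc m. inverse (fact k) * (\<Prod>i<k. 1 + (- of_nat i) * v ^ 2) * (v ^ k * (t ^ 3 * poly Q (t * v)) ^ k)) *
      (\<Sum>j<m + 2. B j * inverse (fact j) * (t * v) ^ j)" for v t :: complex
  have "bipoly f"
    unfolding f_def
    by (intro bipoly_mult bipoly_sum bipoly_prod bipoly_add bipoly_const bipoly_power bipoly_poly bipoly_fst bipoly_snd)
  moreover have "f 0 t = 1" for t
    unfolding f_def by (simp add: B0 sum.lessThan_Suc_shift del: sum.lessThan_Suc)
  moreover have "f v 0 = 1" for v
    unfolding f_def by (simp add: B0 sum.lessThan_Suc_shift del: sum.lessThan_Suc)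
  ultimately obtain A d where A: "A 0 = 1" "\<And>k. k \<ge> 1 \<Longrightarrow> poly (A k) 0 = 0"
    "\<And>v t. f v t = (\<Sum>k\<le>d. poly (A k) t * v ^ k)"
    by (rule bipoly_expansion) blast
  show thesis
  proof (rule that[of A d])
    fix n :: nat and v t :: real
    assume nv: "real n * v^2 = 1"
    let ?v = "complex_of_real v" and ?t = "complex_of_real t"
    let ?l = "\<Sum>k<Suc m. of_nat (n choose k) * (of_real (t * v) ^ 3 * poly Q (of_real (t * v))) ^ k" and ?r = "\<Sum>j<m + 2. B j * of_real ((t * v) ^ j / fact j)"
    have nv': "of_nat n * ?v ^ 2 = 1"
      using arg_cong[OF nv, of complex_of_real] by simp
    have summand: "of_nat (n choose k) * ((?t * ?v) ^ 3 * poly Q (?t * ?v)) ^ k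
        = inverse (fact k) * (\<Prod>i<k. 1 + (- of_nat i) * ?v ^ 2) * (?v ^ k * (?t ^ 3 * poly Q (?t * ?v)) ^ k)" for k
    proof -
      have "(of_nat (n choose k) :: complex) = (\<Prod>i<k. of_nat n - of_nat i) / fact k"
        by (simp add: binomial_gbinomial gbinomial_prod_rev atLeast0LessThan)
      moreover have "(\<Prod>i<k. of_nat n - of_nat i) * (?v ^ 2) ^ k = (\<Prod>i<k. 1 + (- of_nat i) * ?v ^ 2)"
      proof -
        have "(\<Prod>i<k. of_nat n - of_nat i) * (?v ^ 2) ^ k = (\<Prod>i<k. (of_nat n - of_nat i) * ?v ^ 2)"
          by (simp add: prod.distrib)
        also have "\<dots> = (\<Prod>i<k. 1 + (- of_nat i) * ?v ^ 2)"
          by (intro prod.cong refl) (simp add: left_diff_distrib nv')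
        finally show ?thesis .
      qed
      moreover have "((?t * ?v) ^ 3 * poly Q (?t * ?v)) ^ k = (?v ^ 2) ^ k * (?v ^ k * (?t ^ 3 * poly Q (?t * ?v)) ^ k)"
        unfolding power_mult_distrib[symmetric] by (simp add: power_mult_distrib eval_nat_numeral mult_ac)
      ultimately show ?thesis
        by (simp add: divide_inverse mult_ac)
    qed
    have sum1: "?l =
        (\<Sum>k<Suc m. inverse (fact k) * (\<Prod>i<k. 1 + (- of_nat i) * ?v ^ 2) * (?v ^ k * (?t ^ 3 * poly Q (?t * ?v)) ^ k))"
      by (simp only: of_real_mult summand)
    have sum2: "?r = (\<Sum>j<m + 2. B j * inverse (fact j) * (?t * ?v) ^ j)"
      by (intro sum.cong refl) (simp add: divide_inverse mult_ac)
    have "?l * ?r = f ?v ?t"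
      unfolding f_def sum1 sum2 ..
    then show "?l * ?r = (\<Sum>k\<le>d. poly (A k) ?t * ?v ^ k)"
      by (simp only: A(3))
  qed (use A in auto)
qed

section \<open>The uniform estimate at small frequencies\<close>

lemma SP_D: "a \<in> SP \<Longrightarrow> p > 0 \<Longrightarrow> e > 0 \<Longrightarrow> \<forall>\<^sub>F n in sequentially. \<bar>a n\<bar> \<le> e * real n powr (- p)"
  using landau_o.smallD[of a sequentially "\<lambda>n. real n powr (- p)" e] by (simp add: SP_def)

lemma LP_D: "b \<in> LP \<Longrightarrow> p > 0 \<Longrightarrow> e > 0 \<Longrightarrow> \<forall>\<^sub>F n in sequentially. \<bar>b n\<bar> \<le> e * real n powr p"
  using landau_o.smallD[of b sequentially "\<lambda>n. real n powr p" e] by (simp add: LP_def)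

lemma inverse_sqrt_power_eq:
  assumes "n \<ge> 1"
  shows "(1 / sqrt (real n)) ^ k = real n powr (- real k / 2)"
proof -
  have "1 / sqrt (real n) = real n powr (- 1 / 2)"
    using assms by (simp add: powr_half_sqrt[symmetric] powr_minus_divide)
  then show ?thesis
    using assms by (simp add: powr_power)
qed

text \<open>A sequence in \<open>SP\<close> tends to 0, so nothing nonzero and eventually constant
  is of its order; the use is to force \<open>B 0 = 1\<close>.\<close>

lemma SP_const_bigo_imp_zero:
  assumes a: "a \<in> SP" and x: "(\<lambda>n. x n) \<in> O(a)" "\<forall>\<^sub>F n in sequentially. x n = (y::real)"
  shows "y = 0"
proof (rule ccontr)
  assume y: "y \<noteq> 0"
  obtain K where K: "K > 0" "\<forall>\<^sub>F n in sequentially. norm (x n) \<le> K * norm (a n)"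
    using x(1) by (rule landau_o.bigE)
  define e where "e = \<bar>y\<bar> / (2 * K)"
  have e: "e > 0"
    using K y by (simp add: e_def)
  have "\<forall>\<^sub>F n in sequentially. False"
    using K(2) x(2) SP_D[OF a zero_less_one e] eventually_ge_at_top[of 1]
  proof eventually_elim
    case (elim n)
    have "real n powr (-1) \<le> real n powr 0"
      using elim by (intro powr_mono) auto
    then have "\<bar>a n\<bar> \<le> e * 1"
      using elim e mult_left_mono[of "real n powr (-1)" 1 e] by simp
    then have "K * \<bar>a n\<bar> \<le> K * e"
      using K by simp
    also have "\<dots> = \<bar>y\<bar> / 2"
      using K by (simp add: e_def)
    finally show False
      using elim y by simp
  qed
  then show False
    by simp
qed

text \<open>The degree \<open>d\<close> comes from the two-variable polynomial and has no relation
  to \<open>m\<close>; terms beyond the order of the error are harmless here and are cut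
  later.\<close>

lemma alpha_near_expansion:
  assumes alpha: "assm_alpha M S \<psi> m c" and m: "m \<ge> 1"
    and X0: "\<And>n. n \<ge> 1 \<Longrightarrow> charf M S \<psi> n 0 = 1"
  obtains \<rho> and A :: "nat \<Rightarrow> complex poly" and d where "\<rho> > 0" "A 0 = 1" "\<And>k. k \<ge> 1 \<Longrightarrow> poly (A k) 0 = 0"
    "\<And>\<epsilon>. \<epsilon> > 0 \<Longrightarrow> \<forall>\<^sub>F n in sequentially. \<forall>t. abs t < \<rho> * sqrt (real n) \<longrightarrow>
       norm (charf M S \<psi> n (t / sqrt (real n)) - of_real (exp (- (c / 2 * t^2))) *
             (\<Sum>k\<le>d. poly (A k) (of_real t) * of_real (1 / sqrt (real n)) ^ k))
         \<le> \<epsilon> * (1 / sqrt (real n)) ^ m * (abs t * cauchy t)"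
proof -
  let ?X = "charf M S \<psi>"
  have c: "c > 0"
    using alpha by (simp add: assm_alpha_def)
  from alpha obtain \<delta> n0 a b lam B where \<delta>: "\<delta> > 0" and n0: "n0 \<ge> 1"
    and CkX: "\<And>n. n \<ge> n0 \<Longrightarrow> Ck_on (m + 2) {-\<delta>..\<delta>} (?X n)"
    and ab: "a \<in> SP" "b \<in> LP" and Cklam: "Ck_on (m + 2) {-\<delta>..\<delta>} lam"
    and lam_nz: "\<And>s. abs s < \<delta> \<Longrightarrow> lam s \<noteq> 0"
    and lim: "((\<lambda>s. (lam s - (1 - complex_of_real (c * s^2 / 2))) / complex_of_real (s^2)) \<longlongrightarrow> 0) (at 0)"
    and HB: "\<And>j. j \<le> m + 2 \<Longrightarrow> (\<lambda>n. norm (vderivs j {-\<delta><..<\<delta>} (\<lambda>s. inverse (lam s) ^ n * ?X n s) 0 - B j)) \<in> O(a)"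
    and Hb: "\<And>n s j. n \<ge> n0 \<Longrightarrow> abs s < \<delta> \<Longrightarrow> j \<le> m + 2 \<Longrightarrow>
       norm (lam s ^ n * vderivs j {-\<delta><..<\<delta>} (\<lambda>s. inverse (lam s) ^ n * ?X n s) s) \<le> b n * exp (- c * s^2 / 8) + a n"
    unfolding assm_alpha_def Let_def by blast
  define T where "T = {-\<delta><..<\<delta>}"
  define F where "F n j = vderivs j T (\<lambda>s. inverse (lam s) ^ n * ?X n s)" for n j
  have T: "open T" "T \<subseteq> interior {-\<delta>..\<delta>}"
    by (auto simp: T_def interior_atLeastAtMost_real)
  have F_der: "(F n j has_vector_derivative F n (Suc j) u) (at u)" if "n \<ge> n0" "j < m + 2" "abs u < \<delta>" for n j u
  proof -
    have "smooth_on T (m + 2) (\<lambda>s. inverse (lam s) ^ n * ?X n s)"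
      by (intro smooth_on_mult[OF T(1)] smooth_on_power[OF T(1)] smooth_on_inverse[OF T(1)]
            Ck_on_imp_smooth_on[OF Cklam T(2)] Ck_on_imp_smooth_on[OF CkX T(2)] that)
         (auto simp: T_def intro!: lam_nz)
    then show ?thesis
      unfolding F_def using that by (intro vderivs_has_vector_derivative[OF T(1)]) (auto simp: T_def)
  qed
  obtain \<rho> and Q where \<rho>: "0 < \<rho>" "\<rho> \<le> \<delta>" "\<rho> \<le> 1" and lam0: "lam 0 = 1"
    and decay: "\<And>s u. abs s < \<rho> \<Longrightarrow> u \<in> closed_segment 0 s \<Longrightarrow>
       norm (lam s) \<le> norm (lam u) * exp (- (c / 4 * (abs s * \<bar>s - u\<bar>)))"
    and Q1: "\<And>s. abs s < \<rho> \<Longrightarrow> norm (of_real s ^ 3 * poly Q (of_real s)) \<le> c / 4 * s^2"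
    and Q2: "\<And>\<epsilon>. \<epsilon> > 0 \<Longrightarrow> \<exists>C>0. \<forall>s. abs s < \<rho> \<longrightarrow>
       norm (of_real (exp (c / 2 * s^2)) * lam s - (1 + of_real s ^ 3 * poly Q (of_real s)))
         \<le> \<epsilon> * abs s ^ (m + 2) + C * abs s ^ (m + 3)"
    using eigenvalue_structure[OF c \<delta> m Cklam lim] by blast
  have F0: "F n 0 s = inverse (lam s) ^ n * ?X n s" for n s
    by (simp add: F_def)
  have F00: "F n 0 0 = 1" if "n \<ge> 1" for n
    using X0[OF that] by (simp add: F0 lam0)
  \<comment> \<open>At the origin \<open>H\<close> equals 1 for every \<open>n \<ge> 1\<close>, so
    its distance to \<open>B 0\<close> is eventually constant and yet \<open>O(a)\<close>.\<close>
  have B0: "B 0 = 1"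
  proof -
    have "norm (1 - B 0) = 0"
    proof (rule SP_const_bigo_imp_zero[OF ab(1) HB[of 0, folded T_def, folded F_def]])
      show "\<forall>\<^sub>F n in sequentially. norm (F n 0 0 - B 0) = norm (1 - B 0)"
        using eventually_ge_at_top[of 1] by eventually_elim (simp add: F00)
    qed simp
    then show ?thesis
      by simp
  qed
  obtain A :: "nat \<Rightarrow> complex poly" and d where A: "A 0 = 1" "\<And>k. k \<ge> 1 \<Longrightarrow> poly (A k) 0 = 0"
    and A_eq: "\<And>n v t. real n * v^2 = 1 \<Longrightarrow>
      (\<Sum>k<Suc m. of_nat (n choose k) * (of_real (t * v) ^ 3 * poly Q (of_real (t * v))) ^ k) *
      (\<Sum>j<m + 2. B j * of_real ((t * v) ^ j / fact j)) = (\<Sum>k\<le>d. poly (A k) (of_real t) * of_real v ^ k)"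
    using edgeworth_bipoly[where B = B and m = m and Q = Q, OF B0] by blast
  have "c / 4 > 0"
    using c by simp
  from power_mult_gauss_le_uniform[OF this, of "3 * m + 3"]
  obtain C0 where C0: "C0 > 0" "\<And>j t. j \<le> 3 * m + 3 \<Longrightarrow> abs t ^ j * exp (- (c / 4 * t^2)) \<le> C0 * cauchy t"
    by blast
  obtain D where D: "D > 0" "\<And>s::real. \<bar>s\<bar> \<le> 1 \<Longrightarrow> norm (poly Q (of_real s)) \<le> D"
    using poly_bounded_unit_interval[of Q] by auto
  define SB where "SB = (\<Sum>j<m + 2. norm (B j))"
  have SB: "SB \<ge> 0"
    by (simp add: SB_def sum_nonneg)
  define K1 where "K1 = 2 * (1 + (4 / c) ^ (m + 1))"
  have K1: "K1 > 0"
    using c by (simp add: K1_def add_pos_nonneg)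
  have "\<exists>K>0. \<forall>\<^sub>F n in sequentially. norm (F n j 0 - B j) \<le> K * \<bar>a n\<bar>" if "j < m + 2" for j
  proof -
    have "(\<lambda>n. norm (F n j 0 - B j)) \<in> O(a)"
      using HB[of j] that unfolding F_def T_def by simp
    then show ?thesis
      by (elim landau_o.bigE) auto
  qed
  then obtain K where K: "\<And>j. j < m + 2 \<Longrightarrow> K j > 0"
    "\<And>j. j < m + 2 \<Longrightarrow> \<forall>\<^sub>F n in sequentially. norm (F n j 0 - B j) \<le> K j * \<bar>a n\<bar>"
    by metis
  define Ka where "Ka = (\<Sum>j<m + 2. K j)"
  have Ka: "Ka > 0"
    unfolding Ka_def by (intro sum_pos) (auto simp: K(1) simp del: sum.lessThan_Suc)
  have ev_coeff: "\<forall>\<^sub>F n in sequentially. \<forall>j\<in>{..<m + 2}. norm (F n j 0 - B j) \<le> Ka * \<bar>a n\<bar>"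
  proof (intro eventually_ball_finite ballI)
    fix j assume j: "j \<in> {..<m + 2}"
    then have "K j \<le> Ka"
      unfolding Ka_def using K(1)[THEN less_imp_le] by (intro member_le_sum) auto
    then show "\<forall>\<^sub>F n in sequentially. norm (F n j 0 - B j) \<le> Ka * \<bar>a n\<bar>"
      using K(2)[of j] j by (auto elim!: eventually_mono intro!: order_trans[OF _ mult_right_mono[of "K j" Ka]])
  qed simp
  show thesis
  proof (rule that[of \<rho> A d, OF \<rho>(1) A])
    fix \<epsilon> :: real assume \<epsilon>: "\<epsilon> > 0"
    let ?goal = "\<lambda>n t. norm (?X n (t / sqrt (real n)) - of_real (exp (- (c / 2 * t^2))) * (\<Sum>k\<le>d. poly (A k) (of_real t) * of_real (1 / sqrt (real n)) ^ k)) \<le> \<epsilon> * (1 / sqrt (real n)) ^ m * (abs t * cauchy t)"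
    define \<epsilon>' where "\<epsilon>' = \<epsilon> / (4 * (SB + 1) * C0)"
    have \<epsilon>': "\<epsilon>' > 0"
      using \<epsilon> SB C0 by (simp add: \<epsilon>'_def)
    have \<epsilon>'_le: "SB * \<epsilon>' * C0 \<le> \<epsilon> / 4"
    proof -
      have "SB * \<epsilon>' * C0 \<le> (SB + 1) * \<epsilon>' * C0"
        using SB \<epsilon>' C0 by (intro mult_right_mono) auto
      also have "\<dots> = \<epsilon> / 4"
      proof -
        have x: "x * (\<epsilon> / (4 * x * C0)) * C0 = \<epsilon> / 4" if "x > 0" for x
          using that C0(1) by simp
        show ?thesis
          unfolding \<epsilon>'_def using SB by (intro x) simp
      qed
      finally show ?thesis .
    qed
    from Q2[OF \<epsilon>'] obtain C where C: "C > 0" "\<And>s. abs s < \<rho> \<Longrightarrow>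
       norm (of_real (exp (c / 2 * s^2)) * lam s - (1 + of_real s ^ 3 * poly Q (of_real s)))
         \<le> \<epsilon>' * abs s ^ (m + 2) + C * abs s ^ (m + 3)"
      by blast
    \<comment> \<open>The error is divided into quarters of \<epsilon>; the extra 2 is for the two
      summands of \<open>\<beta>\<close>.\<close>
    define e1 where "e1 = \<epsilon> / (8 * K1)"
    have e1: "e1 > 0"
      using \<epsilon> K1 by (simp add: e1_def)
    define K2 where "K2 = Ka * (real m + 1) * C0"
    have K2: "K2 > 0"
      unfolding K2_def using Ka C0 by (intro mult_pos_pos) auto
    define e2 where "e2 = \<epsilon> / (4 * K2)"
    have e2: "e2 > 0"
      using \<epsilon> K2 by (simp add: e2_def)
    define K3 where "K3 = SB * (C + D ^ (m + 1)) * C0"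
    have K3: "K3 \<ge> 0"
      unfolding K3_def using SB C D C0 by (intro mult_nonneg_nonneg add_nonneg_nonneg) auto
    have "((\<lambda>n. K3 * (1 / sqrt (real n))) \<longlongrightarrow> 0) sequentially"
      by real_asymp
    then have ev3: "\<forall>\<^sub>F n in sequentially. K3 * (1 / sqrt (real n)) < \<epsilon> / 4"
      using \<epsilon> by (intro order_tendstoD) auto
    have m2: "real m / 2 > 0"
      using m by simp
    show "\<forall>\<^sub>F n in sequentially. \<forall>t. abs t < \<rho> * sqrt (real n) \<longrightarrow>
       ?goal n t"
      using eventually_ge_at_top[of n0] LP_D[OF ab(2) zero_less_one e1] SP_D[OF ab(1) zero_less_one e1]
        ev_coeff SP_D[OF ab(1) m2 e2] ev3
    proof eventually_elim
      case (elim n)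
      have n: "n \<ge> 1"
        using elim(1) n0 by simp
      define v where "v = 1 / sqrt (real n)"
      have v: "v > 0" "real n * v^2 = 1" "v \<le> 1"
        using n by (auto simp: v_def power_divide)
      define \<beta> where "\<beta> = \<bar>b n\<bar> + \<bar>a n\<bar>"
      \<comment> \<open>Both summands of \<open>\<beta>\<close> are at most \<open>e1 * n\<close>,
        and \<open>n * v^2 = 1\<close>: two of the \<open>m + 2\<close> powers of \<open>v\<close>
        pay for the growth of \<open>b\<close>.\<close>
      have \<beta>: "\<beta> * v ^ (m + 2) * K1 \<le> \<epsilon> / 4 * v ^ m"
      proof -
        have "real n powr (-1) \<le> real n powr 1"
          using n by (intro powr_mono) auto
        then have "\<bar>a n\<bar> \<le> e1 * real n"
          using elim(3) mult_left_mono[of "real n powr (-1)" "real n powr 1" e1] e1 n by simp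
        moreover have "\<bar>b n\<bar> \<le> e1 * real n"
          using elim(2) n by simp
        ultimately have "\<beta> \<le> 2 * e1 * real n"
          by (simp add: \<beta>_def)
        then have "\<beta> * v^2 \<le> 2 * e1 * real n * v^2"
          by (intro mult_right_mono) auto
        also have "\<dots> = 2 * e1"
          using v(2) by (simp add: mult.assoc)
        finally have "(\<beta> * v^2) * (v ^ m * K1) \<le> 2 * e1 * (v ^ m * K1)"
          using v K1 by (intro mult_right_mono) auto
        also have "\<dots> = \<epsilon> / 4 * v ^ m"
          using K1 by (simp add: e1_def)
        finally show ?thesis
          by (simp only: power_add mult_ac)
      qed
      define \<alpha> where "\<alpha> = Ka * \<bar>a n\<bar>"
      have \<alpha>: "\<alpha> * (real m + 1) * C0 \<le> \<epsilon> / 4 * v ^ m"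
      proof -
        have "\<bar>a n\<bar> \<le> e2 * v ^ m"
          using elim(5) inverse_sqrt_power_eq[OF n, of m] by (simp add: v_def)
        then have "K2 * \<bar>a n\<bar> \<le> K2 * (e2 * v ^ m)"
          using K2 by (intro mult_left_mono) auto
        also have "\<dots> = \<epsilon> / 4 * v ^ m"
          using K2 by (simp add: e2_def)
        finally show ?thesis
          by (simp only: \<alpha>_def K2_def mult_ac)
      qed
      show ?case
      proof (intro allI impI)
        fix t assume t: "abs t < \<rho> * sqrt (real n)"
        define s where "s = t * v"
        have s_eq: "t / sqrt (real n) = s"
          by (simp add: s_def v_def)
        have s: "abs s < \<rho>"
          using t n by (simp add: s_eq[symmetric] abs_divide divide_less_eq)
        have seg: "abs u < \<delta>" if "u \<in> closed_segment 0 s" for u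
          using that s \<rho> by (auto simp: closed_segment_eq_real_ivl split: if_splits)
        define Y where "Y = C0 * cauchy t"
        define z where "z = of_real s ^ 3 * poly Q (of_real s)"
        define Bs where "Bs = (\<Sum>j<m + 2. B j * of_real (s ^ j / fact j))"
        define Fs where "Fs = (\<Sum>j<m + 2. F n j 0 * of_real (s ^ j / fact j))"
        define bin where "bin = (\<Sum>k<Suc m. of_nat (n choose k) * z ^ k)"
        define w where "w = complex_of_real (exp (- (c / 2 * t^2)))"
        have lam_le: "norm (lam s) \<le> exp (- (c / 4 * s^2))"
          using decay[OF s, of 0] by (simp add: lam0 power2_eq_square abs_mult[symmetric])
        have ns: "real n * s^2 = t^2"
          using v by (simp add: s_def power_mult_distrib mult.left_commute)
        have lamn_le: "norm (lam s ^ n) \<le> exp (- (c / 4 * t^2))"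
        proof -
          have "norm (lam s ^ n) \<le> exp (- (c / 4 * s^2)) ^ n"
            unfolding norm_power by (intro power_mono lam_le) simp
          also have "\<dots> = exp (- (c / 4 * t^2))"
            unfolding exp_of_nat_mult[symmetric] ns[symmetric] by (simp add: mult_ac)
          finally show ?thesis .
        qed
        have "lam s \<noteq> 0"
          using s \<rho> by (intro lam_nz) simp
        then have X: "?X n s = lam s ^ n * F n 0 s"
          by (simp add: F0 power_inverse)
        have 1: "norm (lam s ^ n * F n 0 s - lam s ^ n * Fs) \<le> \<beta> * v ^ (m + 2) * K1 * (abs t * cauchy t)"
          unfolding Fs_def K1_def s_def
        proof (rule characteristic_taylor[OF c m v(1,2)])
          fix j u assume j: "j < m + 2" and "u \<in> closed_segment 0 (t * v)"
          then show "(F n j has_vector_derivative F n (Suc j) u) (at u)"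
            using seg by (intro F_der elim j) (simp add: s_def)
        next
          fix u assume "u \<in> closed_segment 0 (t * v)"
          then have u: "u \<in> closed_segment 0 s"
            by (simp add: s_def)
          show "norm (lam (t * v)) \<le> norm (lam u) * exp (- (c / 4 * (\<bar>t * v\<bar> * \<bar>t * v - u\<bar>)))"
            using decay[OF s u] by (simp add: s_def)
          have "norm (lam u ^ n * F n (m + 2) u) \<le> b n * exp (- c * u^2 / 8) + a n"
            unfolding F_def T_def by (intro Hb elim seg u order_refl)
          also have "\<dots> \<le> \<bar>b n\<bar> * 1 + \<bar>a n\<bar>"
            using c by (intro add_mono mult_mono) auto
          finally show "norm (lam u ^ n * F n (m + 2) u) \<le> \<beta>"
            by (simp add: \<beta>_def)
        qed
        have 2: "norm (lam s ^ n * Fs - lam s ^ n * Bs) \<le> \<alpha> * (real m + 1) * (abs t * Y)"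
          unfolding Fs_def Bs_def
        proof (rule coefficient_error_le[OF _ _ _ lamn_le])
          show "F n 0 0 = B 0"
            using F00[OF n] B0 by simp
          show "norm (F n j 0 - B j) \<le> \<alpha>" if "j < m + 2" for j
            using elim(4) that by (simp add: \<alpha>_def)
          show "\<bar>s\<bar> \<le> \<bar>t\<bar>"
            using v mult_left_mono[OF v(3), of "\<bar>t\<bar>"] by (simp add: s_def abs_mult)
          show "abs t ^ j * exp (- (c / 4 * t^2)) \<le> Y" if "j \<le> m" for j
            using that unfolding Y_def by (intro C0) simp
        qed
        have 3: "norm (lam s ^ n - w * bin) \<le> (\<epsilon>' * v ^ m + (C + D ^ (m + 1)) * v ^ (m + 1)) * (abs t * Y)"
          unfolding w_def bin_def z_def s_def
        proof (rule eigenvalue_power_expansion[OF c v(1,2)])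
          show "abs t ^ j * exp (- (c / 4 * t^2)) \<le> Y" if "j \<le> 3 * m + 3" for j
            unfolding Y_def using that by (rule C0)
          show "norm (poly Q (of_real (t * v))) \<le> D"
            using D(2)[of s] s \<rho> by (simp add: s_def)
        qed (use \<epsilon>' C(1) in \<open>simp_all only: s_def[symmetric] lam_le Q1[OF s] C(2)[OF s] less_imp_le\<close>)
        have Bs: "norm Bs \<le> SB"
          unfolding Bs_def SB_def
        proof (rule sum_norm_le)
          fix j
          have "abs s ^ j / fact j \<le> 1 / 1"
            using s \<rho> by (intro frac_le power_le_one) (auto simp: fact_ge_1)
          then have "norm (B j) * (abs s ^ j / fact j) \<le> norm (B j) * 1"
            by (intro mult_left_mono) auto
          then show "norm (B j * of_real (s ^ j / fact j)) \<le> norm (B j)"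
            by (simp add: norm_mult norm_divide norm_power)
        qed
        have W: "(\<Sum>k\<le>d. poly (A k) (of_real t) * of_real v ^ k) = bin * Bs"
          using A_eq[OF v(2), of t] by (simp only: bin_def Bs_def z_def s_def)
        \<comment> \<open>In turn, \<open>H\<close> is replaced by its Taylor polynomial, the
          derivatives at 0 by \<open>B\<close>, and \<open>lam ^ n\<close> by the Gaussian times the
          truncated binomial sum. The last error has two parts, of orders
          \<open>\<epsilon>' * v ^ m\<close> and \<open>v ^ (m + 1)\<close>, so four quarters of
          \<epsilon> are needed.\<close>
        have "?X n s - w * (bin * Bs) = (lam s ^ n * F n 0 s - lam s ^ n * Fs) + (lam s ^ n * Fs - lam s ^ n * Bs) + (lam s ^ n - w * bin) * Bs"
          by (simp add: X algebra_simps)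
        also have "norm \<dots> \<le> norm (lam s ^ n * F n 0 s - lam s ^ n * Fs) + norm (lam s ^ n * Fs - lam s ^ n * Bs) + norm (lam s ^ n - w * bin) * norm Bs"
          by (intro order_trans[OF norm_triangle_ineq] add_mono norm_triangle_ineq) (simp add: norm_mult)
        also have "\<dots> \<le> \<beta> * v ^ (m + 2) * K1 * (abs t * cauchy t) + \<alpha> * (real m + 1) * (abs t * Y)
            + (\<epsilon>' * v ^ m + (C + D ^ (m + 1)) * v ^ (m + 1)) * (abs t * Y) * SB"
          by (intro add_mono 1 2 mult_mono 3 Bs order_trans[OF norm_ge_zero 3]) auto
        also have "\<dots> = (\<beta> * v ^ (m + 2) * K1 + \<alpha> * (real m + 1) * C0 + SB * \<epsilon>' * C0 * v ^ m + K3 * v * v ^ m) * (abs t * cauchy t)"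
          by (simp add: Y_def K3_def algebra_simps)
        also have "\<dots> \<le> (\<epsilon> / 4 * v ^ m + \<epsilon> / 4 * v ^ m + \<epsilon> / 4 * v ^ m + \<epsilon> / 4 * v ^ m) * (abs t * cauchy t)"
        proof (rule mult_right_mono)
          have "SB * \<epsilon>' * C0 * v ^ m \<le> \<epsilon> / 4 * v ^ m" "K3 * v * v ^ m \<le> \<epsilon> / 4 * v ^ m"
            using \<epsilon>'_le elim(6) v by (auto simp: v_def[symmetric] intro!: mult_right_mono less_imp_le)
          then show "\<beta> * v ^ (m + 2) * K1 + \<alpha> * (real m + 1) * C0 + SB * \<epsilon>' * C0 * v ^ m + K3 * v * v ^ m
              \<le> \<epsilon> / 4 * v ^ m + \<epsilon> / 4 * v ^ m + \<epsilon> / 4 * v ^ m + \<epsilon> / 4 * v ^ m"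
            by (intro add_mono \<beta> \<alpha>)
        qed (simp add: add_nonneg_nonneg)
        also have "\<dots> = \<epsilon> * v ^ m * (abs t * cauchy t)"
          by simp
        finally show "?goal n t"
          unfolding s_eq v_def[symmetric] W w_def .
      qed
    qed
  qed
qed

section \<open>The expansion of the distribution function\<close>

lemma eventually_powr_le:
  fixes p q \<eta> K :: real
  assumes "q < p" "\<eta> > 0"
  shows "\<forall>\<^sub>F n in sequentially. K * real n powr (- p) \<le> \<eta> * real n powr (- q)"
proof -
  have "((\<lambda>n. K * real n powr (- (p - q))) \<longlongrightarrow> K * 0) sequentially"
    using assms by (intro tendsto_mult tendsto_const tendsto_neg_powr filterlim_real_sequentially) auto
  then have "\<forall>\<^sub>F n in sequentially. K * real n powr (- (p - q)) < \<eta>"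
    using assms by (intro order_tendstoD(2)) auto
  then show ?thesis
    using eventually_ge_at_top[of 1]
  proof eventually_elim
    case (elim n)
    have "real n powr (- p) = real n powr (- (p - q)) * real n powr (- q)"
      by (simp add: powr_add[symmetric])
    then have "K * real n powr (- p) = (K * real n powr (- (p - q))) * real n powr (- q)"
      by simp
    also have "\<dots> \<le> \<eta> * real n powr (- q)"
      using elim by (intro mult_right_mono) auto
    finally show ?case .
  qed
qed

definition expansion_ft :: "real \<Rightarrow> (nat \<Rightarrow> complex poly) \<Rightarrow> nat \<Rightarrow> real \<Rightarrow> real \<Rightarrow> complex" where
  "expansion_ft c A N v t = of_real (exp (- (c / 2 * t^2))) * (\<Sum>k\<le>N. poly (A k) (of_real t) * of_real v ^ k)"

text \<open>In this range \<open>\<rho> \<le> abs t * v\<close>, so multiplying by a power of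
  \<open>abs t * v / \<rho>\<close> only enlarges. This produces any desired power of
  \<open>v\<close>, while the Gaussian absorbs the powers of \<open>t\<close>.\<close>

lemma expansion_ft_tail:
  assumes c: "c > 0" and \<rho>: "\<rho> > 0"
  obtains C where "C > 0"
    "\<And>n t. n \<ge> 1 \<Longrightarrow> \<rho> * sqrt (real n) \<le> \<bar>t\<bar> \<Longrightarrow>
       norm (expansion_ft c A N (1 / sqrt (real n)) t) \<le> C * (1 / sqrt (real n)) ^ (m + 1) * (abs t * cauchy t)"
proof -
  have "c / 2 > 0"
    using c by simp
  from poly_mult_gauss_le[OF this, of m]
  have "\<exists>C>0. \<forall>t. abs t ^ m * norm (poly (A k) (of_real t)) * exp (- (c / 2 * t^2)) \<le> C * cauchy t" for k
    by blast
  then obtain C where C: "\<And>k. C k > 0"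
    "\<And>k t. abs t ^ m * norm (poly (A k) (of_real t)) * exp (- (c / 2 * t^2)) \<le> C k * cauchy t"
    by metis
  show thesis
  proof (rule that[of "(\<Sum>k\<le>N. C k) / \<rho> ^ (m + 1)"])
    show "(\<Sum>k\<le>N. C k) / \<rho> ^ (m + 1) > 0"
      using \<rho> C by (intro divide_pos_pos sum_pos) auto
    fix n :: nat and t :: real
    assume n: "n \<ge> 1" and t: "\<rho> * sqrt (real n) \<le> \<bar>t\<bar>"
    define v where "v = 1 / sqrt (real n)"
    have v: "v > 0" "v \<le> 1"
      using n by (auto simp: v_def)
    have t0: "\<bar>t\<bar> > 0"
      using t \<rho> n by (intro less_le_trans[OF _ t]) auto
    have "\<rho> \<le> abs t * v"
      using t n by (simp add: v_def field_simps)
    then have pw: "\<rho> ^ (m + 1) \<le> (abs t * v) ^ (m + 1)"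
      using \<rho> by (intro power_mono) auto
    have "norm (expansion_ft c A N v t) \<le> exp (- (c / 2 * t^2)) * (\<Sum>k\<le>N. norm (poly (A k) (of_real t)))"
      unfolding expansion_ft_def norm_mult
    proof (intro mult_mono sum_norm_le)
      fix k
      have "norm (poly (A k) (of_real t) * of_real v ^ k) \<le> norm (poly (A k) (of_real t)) * 1"
        unfolding norm_mult using v by (intro mult_left_mono) (auto simp: norm_power power_le_one)
      then show "norm (poly (A k) (of_real t) * of_real v ^ k) \<le> norm (poly (A k) (of_real t))"
        by simp
    qed auto
    then have "norm (expansion_ft c A N v t) * abs t ^ m \<le> exp (- (c / 2 * t^2)) * (\<Sum>k\<le>N. norm (poly (A k) (of_real t))) * abs t ^ m"
      by (rule mult_right_mono) simp
    also have "\<dots> = (\<Sum>k\<le>N. abs t ^ m * norm (poly (A k) (of_real t)) * exp (- (c / 2 * t^2)))"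
      by (simp add: sum_distrib_left sum_distrib_right mult_ac)
    also have "\<dots> \<le> (\<Sum>k\<le>N. C k * cauchy t)"
      by (intro sum_mono C)
    also have "\<dots> = (\<Sum>k\<le>N. C k) * cauchy t"
      by (simp add: sum_distrib_right)
    finally have le: "norm (expansion_ft c A N v t) * abs t ^ m \<le> (\<Sum>k\<le>N. C k) * cauchy t" .
    have "norm (expansion_ft c A N v t) * \<rho> ^ (m + 1) \<le> norm (expansion_ft c A N v t) * (abs t * v) ^ (m + 1)"
      by (intro mult_left_mono pw) simp
    also have "\<dots> = (norm (expansion_ft c A N v t) * abs t ^ m) * (abs t * v ^ (m + 1))"
      by (simp add: power_mult_distrib mult_ac)
    also have "\<dots> \<le> ((\<Sum>k\<le>N. C k) * cauchy t) * (abs t * v ^ (m + 1))"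
      using v by (intro mult_right_mono le) auto
    finally show "norm (expansion_ft c A N (1 / sqrt (real n)) t) \<le>
        (\<Sum>k\<le>N. C k) / \<rho> ^ (m + 1) * (1 / sqrt (real n)) ^ (m + 1) * (abs t * cauchy t)"
      unfolding v_def[symmetric] using \<rho> by (simp add: pos_le_divide_eq mult_ac del: power_Suc)
  qed
qed

text \<open>Every dropped term has at least \<open>N + 1\<close> factors \<open>v\<close>, and
  \<open>A k\<close> vanishing at 0 supplies the factor \<bar>t\<bar>.\<close>

lemma expansion_ft_truncate:
  assumes c: "c > 0" and A: "\<And>k. k \<ge> 1 \<Longrightarrow> poly (A k) 0 = 0" and N: "N \<le> d"
  obtains C where "C > 0"
    "\<And>n t. n \<ge> 1 \<Longrightarrow>
       norm (expansion_ft c A d (1 / sqrt (real n)) t - expansion_ft c A N (1 / sqrt (real n)) t)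
         \<le> C * (1 / sqrt (real n)) ^ (N + 1) * (abs t * cauchy t)"
proof -
  have "\<exists>C>0. \<forall>t. norm (poly (A k) (of_real t)) * exp (- (c / 2 * t^2)) \<le> C * (abs t * cauchy t)" if k: "k \<ge> 1" for k
  proof -
    obtain q where q: "A k = pCons 0 q"
      using A[OF k] by (cases "A k") auto
    have "c / 2 > 0"
      using c by simp
    from poly_mult_gauss_le[OF this, of 0 q] obtain C where C: "C > 0"
      "\<And>t. norm (poly q (of_real t)) * exp (- (c / 2 * t^2)) \<le> C * cauchy t"
      by auto
    show ?thesis
    proof (intro exI[of _ C] conjI allI C)
      fix t :: real
      have "norm (poly (A k) (of_real t)) * exp (- (c / 2 * t^2)) = abs t * (norm (poly q (of_real t)) * exp (- (c / 2 * t^2)))"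
        by (simp add: q norm_mult)
      also have "\<dots> \<le> abs t * (C * cauchy t)"
        by (intro mult_left_mono C) simp
      finally show "norm (poly (A k) (of_real t)) * exp (- (c / 2 * t^2)) \<le> C * (abs t * cauchy t)"
        by (simp add: mult_ac)
    qed
  qed
  then obtain C where C: "\<And>k. k \<ge> 1 \<Longrightarrow> C k > 0"
    "\<And>k t. k \<ge> 1 \<Longrightarrow> norm (poly (A k) (of_real t)) * exp (- (c / 2 * t^2)) \<le> C k * (abs t * cauchy t)"
    by metis
  define I where "I = {N<..d}"
  define CC where "CC = (\<Sum>k\<in>I. C k) + 1"
  have sC: "(\<Sum>k\<in>I. C k) \<ge> 0"
    using C(1) by (intro sum_nonneg less_imp_le) (auto simp: I_def)
  show thesis
  proof (rule that[of CC])
    show "CC > 0"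
      using sC by (simp add: CC_def)
    fix n :: nat and t :: real
    assume n: "n \<ge> 1"
    define v where "v = 1 / sqrt (real n)"
    have v: "v > 0" "v \<le> 1"
      using n by (auto simp: v_def)
    let ?f = "\<lambda>k. poly (A k) (of_real t) * complex_of_real v ^ k"
    have "(\<Sum>k\<le>d. ?f k) = (\<Sum>k\<le>N. ?f k) + (\<Sum>k\<in>I. ?f k)"
      unfolding I_def using N by (subst sum.union_disjoint[symmetric]) (auto intro!: sum.cong)
    then have "norm (expansion_ft c A d v t - expansion_ft c A N v t) = exp (- (c / 2 * t^2)) * norm (\<Sum>k\<in>I. ?f k)"
      unfolding expansion_ft_def right_diff_distrib[symmetric] norm_mult by simp
    also have "\<dots> \<le> exp (- (c / 2 * t^2)) * (\<Sum>k\<in>I. norm (poly (A k) (of_real t)) * v ^ (N + 1))"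
    proof (intro mult_left_mono sum_norm_le)
      fix k assume "k \<in> I"
      then have "v ^ k \<le> v ^ (N + 1)"
        using v by (intro power_decreasing) (auto simp: I_def)
      then show "norm (?f k) \<le> norm (poly (A k) (of_real t)) * v ^ (N + 1)"
        using v by (simp add: norm_mult norm_power mult_left_mono del: power_Suc)
    qed simp
    also have "\<dots> = (\<Sum>k\<in>I. norm (poly (A k) (of_real t)) * exp (- (c / 2 * t^2))) * v ^ (N + 1)"
      by (simp add: sum_distrib_left sum_distrib_right mult_ac)
    also have "\<dots> \<le> (\<Sum>k\<in>I. C k * (abs t * cauchy t)) * v ^ (N + 1)"
      using v by (intro mult_right_mono sum_mono C) (auto simp: I_def)
    also have "\<dots> = (\<Sum>k\<in>I. C k) * (v ^ (N + 1) * (abs t * cauchy t))"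
      unfolding sum_distrib_right[symmetric] by (simp only: mult_ac)
    also have "\<dots> \<le> CC * (v ^ (N + 1) * (abs t * cauchy t))"
      using v by (intro mult_right_mono) (auto simp: CC_def add_nonneg_nonneg)
    finally show "norm (expansion_ft c A d (1 / sqrt (real n)) t - expansion_ft c A N (1 / sqrt (real n)) t)
         \<le> CC * (1 / sqrt (real n)) ^ (N + 1) * (abs t * cauchy t)"
      unfolding v_def[symmetric] by (simp only: mult.assoc)
  qed
qed

section \<open>The density having the truncated expansion as its Fourier transform\<close>

lemma poly_map_poly_Re: "poly (map_poly Re p) x = Re (poly p (of_real x))"
  by (induction p) (auto simp: map_poly_pCons)

text \<open>The corrections enter as derivatives, so \<open>P k\<close> is the polynomial of the
  distribution function rather than of the density.\<close>

definition edgeworth_density :: "real \<Rightarrow> (nat \<Rightarrow> complex poly) \<Rightarrow> nat \<Rightarrow> real \<Rightarrow> real \<Rightarrow> complex" where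
  "edgeworth_density \<sigma> P N v x =
     of_real (normal_density 0 \<sigma> x) + (\<Sum>k=1..N. of_real v ^ k * gauss_poly \<sigma> (gauss_deriv \<sigma> (P k)) x)"

context
  fixes \<sigma> :: real
  assumes \<sigma>: "\<sigma> > 0"
begin

lemma normal_density_eq_gauss_poly: "complex_of_real (normal_density 0 \<sigma> x) = gauss_poly \<sigma> 1 x"
  by (simp add: gauss_poly_def)

lemma edgeworth_density_integrable: "complex_integrable lborel (edgeworth_density \<sigma> P N v)"
  unfolding edgeworth_density_def[abs_def] normal_density_eq_gauss_poly
  by (intro Bochner_Integration.integrable_add Bochner_Integration.integrable_sum integrable_mult_right gauss_poly_integrable[OF \<sigma>])

lemma edgeworth_density_ft:
  assumes A: "A 0 = 1"
    and P: "\<And>k t. k \<ge> 1 \<Longrightarrow> ft lborel (gauss_poly \<sigma> (gauss_deriv \<sigma> (P k))) t = poly (A k) (of_real t) * exp (- (\<sigma>^2 * t^2 / 2))"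
  shows "ft lborel (edgeworth_density \<sigma> P N v) t = expansion_ft (\<sigma>^2) A N v t"
proof -
  have int: "complex_integrable lborel (\<lambda>x. gauss_poly \<sigma> R x * iexp (t * x))" for R
    using complex_density.integrable_ft[OF gauss_poly_complex_density[OF \<sigma>]] .
  have "ft lborel (edgeworth_density \<sigma> P N v) t
      = (CLBINT x. gauss_poly \<sigma> 1 x * iexp (t * x) + (\<Sum>k=1..N. of_real v ^ k * (gauss_poly \<sigma> (gauss_deriv \<sigma> (P k)) x * iexp (t * x))))"
    unfolding ft_def edgeworth_density_def normal_density_eq_gauss_poly
    by (simp only: distrib_right sum_distrib_right mult.assoc)
  also have "\<dots> = ft lborel (gauss_poly \<sigma> 1) t + (\<Sum>k=1..N. of_real v ^ k * ft lborel (gauss_poly \<sigma> (gauss_deriv \<sigma> (P k))) t)"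
    unfolding ft_def
    by (subst Bochner_Integration.integral_add)
       (use int in \<open>auto intro!: Bochner_Integration.integrable_sum integrable_mult_right simp: Bochner_Integration.integral_sum\<close>)
  also have "ft lborel (gauss_poly \<sigma> 1) t = exp (- (\<sigma>^2 * t^2 / 2))"
    using ft_normal_density[OF \<sigma>, of t] by (simp add: normal_density_eq_gauss_poly)
  also have "(\<Sum>k=1..N. of_real v ^ k * ft lborel (gauss_poly \<sigma> (gauss_deriv \<sigma> (P k))) t)
      = of_real (exp (- (\<sigma>^2 * t^2 / 2))) * (\<Sum>k=1..N. poly (A k) (of_real t) * of_real v ^ k)"
    unfolding sum_distrib_left by (intro sum.cong refl) (simp add: P)
  also have "of_real (exp (- (\<sigma>^2 * t^2 / 2))) + of_real (exp (- (\<sigma>^2 * t^2 / 2))) * (\<Sum>k=1..N. poly (A k) (of_real t) * of_real v ^ k)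
      = of_real (exp (- (\<sigma>^2 * t^2 / 2))) * (\<Sum>k\<le>N. poly (A k) (of_real t) * of_real v ^ k)"
  proof -
    have "{..N} = insert 0 {1..N}"
      by auto
    then show ?thesis
      by (simp add: A distrib_left)
  qed
  finally show ?thesis
    by (simp add: expansion_ft_def)
qed

lemma edgeworth_density_lower_mass:
  "Re (lower_mass lborel (edgeworth_density \<sigma> P N v) x) =
     (LBINT y:{..x}. normal_density 0 \<sigma> y) + normal_density 0 \<sigma> x * (\<Sum>k=1..N. poly (map_poly Re (P k)) x * v ^ k)"
proof -
  have int: "complex_integrable lborel (\<lambda>y. indicator {..x} y *\<^sub>R gauss_poly \<sigma> R y)" for R
    using complex_density.integrable_indicator_density[OF gauss_poly_complex_density[OF \<sigma>]] .
  have "lower_mass lborel (edgeworth_density \<sigma> P N v) x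
      = (CLBINT y. indicator {..x} y *\<^sub>R gauss_poly \<sigma> 1 y + (\<Sum>k=1..N. of_real v ^ k * (indicator {..x} y *\<^sub>R gauss_poly \<sigma> (gauss_deriv \<sigma> (P k)) y)))"
    unfolding lower_mass_def edgeworth_density_def normal_density_eq_gauss_poly
    by (simp only: scaleR_add_right scaleR_sum_right mult_scaleR_right)
  also have "\<dots> = lower_mass lborel (gauss_poly \<sigma> 1) x + (\<Sum>k=1..N. of_real v ^ k * lower_mass lborel (gauss_poly \<sigma> (gauss_deriv \<sigma> (P k))) x)"
    unfolding lower_mass_def
    by (subst Bochner_Integration.integral_add)
       (use int in \<open>auto intro!: Bochner_Integration.integrable_sum integrable_mult_right simp del: mult_scaleR_right simp: Bochner_Integration.integral_sum\<close>)
  also have "lower_mass lborel (gauss_poly \<sigma> 1) x = of_real (LBINT y:{..x}. normal_density 0 \<sigma> y)"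
  proof -
    have "lower_mass lborel (gauss_poly \<sigma> 1) x = (CLBINT y. complex_of_real (indicator {..x} y *\<^sub>R normal_density 0 \<sigma> y))"
      unfolding lower_mass_def by (intro Bochner_Integration.integral_cong refl) (simp add: gauss_poly_def scaleR_conv_of_real)
    then show ?thesis
      unfolding set_lebesgue_integral_def by (simp only: integral_complex_of_real)
  qed
  also have "(\<Sum>k=1..N. of_real v ^ k * lower_mass lborel (gauss_poly \<sigma> (gauss_deriv \<sigma> (P k))) x)
      = of_real (normal_density 0 \<sigma> x) * (\<Sum>k=1..N. poly (P k) (of_real x) * of_real (v ^ k))"
    unfolding sum_distrib_left
    by (intro sum.cong refl) (simp add: lower_mass_gauss_deriv[OF \<sigma>] gauss_poly_def)
  finally show ?thesis
    by (simp add: poly_map_poly_Re del: of_real_power)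
qed

text \<open>Uniformity over \<open>v\<close> in [0, 1] gives one slope constant in Esseen's
  inequality for all \<open>n\<close>.\<close>

lemma edgeworth_density_bounded:
  obtains K where "K > 0" "\<And>v x. 0 \<le> v \<Longrightarrow> v \<le> 1 \<Longrightarrow> norm (edgeworth_density \<sigma> P N v x) \<le> K"
proof -
  have "\<exists>C>0. \<forall>x. norm (gauss_poly \<sigma> R x) \<le> C" for R
  proof -
    obtain C where C: "C > 0" "\<And>x. norm (gauss_poly \<sigma> R x) \<le> C * cauchy x"
      using gauss_poly_le[OF \<sigma>] by blast
    have "C * cauchy x \<le> C * 1" for x :: real
      using C(1) by (intro mult_left_mono) (auto simp: field_simps add_pos_nonneg)
    then have "norm (gauss_poly \<sigma> R x) \<le> C" for x
      using C(2)[of x] by (metis mult_1_right order_trans)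
    then show ?thesis
      using C(1) by blast
  qed
  then obtain C where C: "\<And>R. C R > 0" "\<And>R x. norm (gauss_poly \<sigma> R x) \<le> C R"
    by metis
  show thesis
  proof (rule that[of "C 1 + (\<Sum>k=1..N. C (gauss_deriv \<sigma> (P k)))"])
    show "C 1 + (\<Sum>k=1..N. C (gauss_deriv \<sigma> (P k))) > 0"
      using C(1) by (intro add_pos_nonneg sum_nonneg less_imp_le)
    fix v x :: real assume v: "0 \<le> v" "v \<le> 1"
    show "norm (edgeworth_density \<sigma> P N v x) \<le> C 1 + (\<Sum>k=1..N. C (gauss_deriv \<sigma> (P k)))"
      unfolding edgeworth_density_def normal_density_eq_gauss_poly
    proof (intro order_trans[OF norm_triangle_ineq] add_mono C sum_norm_le)
      fix k
      have "v ^ k * norm (gauss_poly \<sigma> (gauss_deriv \<sigma> (P k)) x) \<le> 1 * C (gauss_deriv \<sigma> (P k))"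
        using v C(1)[THEN less_imp_le] by (intro mult_mono C power_le_one) auto
      then show "norm (of_real v ^ k * gauss_poly \<sigma> (gauss_deriv \<sigma> (P k)) x) \<le> C (gauss_deriv \<sigma> (P k))"
        using v by (simp add: norm_mult norm_power)
    qed
  qed
qed

end

section \<open>The law of the normalised sum and the large frequencies\<close>

lemma law_properties:
  fixes Z \<psi> :: "'a \<Rightarrow> real"
  assumes [measurable]: "Z \<in> borel_measurable M" "\<psi> \<in> borel_measurable M"
    and nn: "AE \<omega> in M. \<psi> \<omega> \<ge> 0" and int: "integrable M \<psi>" "integral\<^sup>L M \<psi> = 1"
  defines "\<nu> \<equiv> distr (density M (\<lambda>\<omega>. ennreal (\<psi> \<omega>))) borel Z"
  shows "real_distribution \<nu>"
    and "char \<nu> t = (CLINT \<omega>|M. complex_of_real (\<psi> \<omega>) * cis (t * Z \<omega>))"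
    and "cdf \<nu> x = measure (density M (\<lambda>\<omega>. ennreal (\<psi> \<omega>))) {\<omega> \<in> space M. Z \<omega> \<le> x}"
proof -
  let ?P = "density M (\<lambda>\<omega>. ennreal (\<psi> \<omega>))"
  have "emeasure ?P (space ?P) = (\<integral>\<^sup>+\<omega>. ennreal (\<psi> \<omega>) \<partial>M)"
    by (subst emeasure_density) (auto intro!: nn_integral_cong)
  also have "\<dots> = 1"
    using nn_integral_eq_integral[OF int(1) nn] int(2) by simp
  finally interpret P: prob_space ?P
    by (rule prob_spaceI)
  show "real_distribution \<nu>"
    unfolding \<nu>_def by (rule P.real_distribution_distr) simp
  have "char \<nu> t = (CLINT \<omega>|?P. iexp (t * Z \<omega>))"
    unfolding char_def \<nu>_def by (subst integral_distr) auto
  also have "\<dots> = (CLINT \<omega>|M. \<psi> \<omega> *\<^sub>R iexp (t * Z \<omega>))"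
    using nn by (subst integral_density) auto
  finally show "char \<nu> t = (CLINT \<omega>|M. complex_of_real (\<psi> \<omega>) * cis (t * Z \<omega>))"
    by (simp add: cis_conv_exp scaleR_conv_of_real)
  show "cdf \<nu> x = measure ?P {\<omega> \<in> space M. Z \<omega> \<le> x}"
    unfolding cdf_def \<nu>_def by (subst measure_distr) (auto intro!: arg_cong2[where f = measure])
qed

text \<open>The measure \<open>dt / \<bar>t\<bar>\<close> is invariant under
  \<open>t = q * s\<close>. For \<open>\<rho> \<le> \<bar>s\<bar> \<le> K\<close> the integrand is
  at most \<open>\<alpha> / \<rho>\<close>, on an interval of length \<open>2 * K\<close>; what
  remains is the integral of assumption (delta).\<close>

lemma far_integral_le:
  fixes X :: "real \<Rightarrow> complex"
  assumes [measurable]: "X \<in> borel_measurable borel" and X1: "\<And>s. norm (X s) \<le> 1"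
    and q: "q > 0" and \<rho>: "\<rho> > 0" and K: "K > 0" and \<alpha>: "\<alpha> \<ge> 0"
    and X\<alpha>: "\<And>s. \<rho> \<le> \<bar>s\<bar> \<Longrightarrow> \<bar>s\<bar> \<le> K \<Longrightarrow> norm (X s) \<le> \<alpha>"
  shows "(\<integral>\<^sup>+t. indicator {t. \<rho> * q \<le> \<bar>t\<bar> \<and> abs t < L * q} t * ennreal (norm (X (t / q)) / \<bar>t\<bar>) \<partial>lborel)
    \<le> ennreal (2 * K * \<alpha> / \<rho> + (LBINT s:{s. K < \<bar>s\<bar> \<and> abs s < L}. norm (X s) / \<bar>s\<bar>))"
proof -
  let ?A = "{s. K < \<bar>s\<bar> \<and> abs s < L}"
  let ?f = "\<lambda>s. indicator ?A s *\<^sub>R (norm (X s) / \<bar>s\<bar>)" and ?g = "\<lambda>s. indicator {t. \<rho> * q \<le> \<bar>t\<bar> \<and> abs t < L * q} (0 + q * s) * ennreal (norm (X ((0 + q * s) / q)) / \<bar>0 + q * s\<bar>)"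
  \<comment> \<open>A non-integrable function has Bochner integral 0, which would bound nothing.
    Here the integrand is at most \<open>1 / K\<close> on a set of finite measure, so the passage to
    the nonnegative integral is legitimate.\<close>
  have int: "integrable lborel (\<lambda>s. ?f s)"
  proof (rule integrableI_bounded_set_indicator[where B = "1 / K"])
    have "?A \<subseteq> {-\<bar>L\<bar>..\<bar>L\<bar>}"
      by auto
    then have "emeasure lborel ?A \<le> emeasure lborel {-\<bar>L\<bar>..\<bar>L\<bar>}"
      by (intro emeasure_mono) auto
    then show "emeasure lborel ?A < \<infinity>"
      by (auto intro: le_less_trans simp: emeasure_lborel_Icc_eq)
    show "AE s in lborel. s \<in> ?A \<longrightarrow> norm (norm (X s) / \<bar>s\<bar>) \<le> 1 / K"
      using K X1 by (auto intro!: AE_I2 frac_le simp: abs_divide)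
  qed measurable
  have "(\<integral>\<^sup>+t. indicator {t. \<rho> * q \<le> \<bar>t\<bar> \<and> abs t < L * q} t * ennreal (norm (X (t / q)) / \<bar>t\<bar>) \<partial>lborel)
      = abs q * (\<integral>\<^sup>+s. ?g s \<partial>lborel)"
    using q by (intro nn_integral_real_affine) auto
  also have "\<dots> = (\<integral>\<^sup>+s. abs q * ?g s \<partial>lborel)"
    by (rule nn_integral_cmult[symmetric]) measurable
  also have "\<dots> \<le> (\<integral>\<^sup>+s. ennreal (\<alpha> / \<rho>) * indicator {-K..K} s + ennreal (?f s) \<partial>lborel)"
  proof (rule nn_integral_mono)
    fix s :: real
    have scale: "\<rho> * q \<le> \<bar>q * s\<bar> \<longleftrightarrow> \<rho> \<le> \<bar>s\<bar>" "\<bar>q * s\<bar> < L * q \<longleftrightarrow> abs s < L"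
      using q by (auto simp: abs_mult mult.commute)
    have eq: "abs q * ?g s
        = indicator {s. \<rho> \<le> \<bar>s\<bar> \<and> abs s < L} s * ennreal (norm (X s) / \<bar>s\<bar>)"
    proof -
      have "ennreal \<bar>q\<bar> * ennreal (norm (X s) / \<bar>q * s\<bar>) = ennreal (norm (X s) / \<bar>s\<bar>)"
        using q by (subst ennreal_mult'[symmetric]) (auto simp: abs_mult)
      then show ?thesis
        using q scale by (auto simp: indicator_def)
    qed
    show "abs q * ?g s
        \<le> ennreal (\<alpha> / \<rho>) * indicator {-K..K} s + ennreal (?f s)"
    proof (cases "\<rho> \<le> \<bar>s\<bar> \<and> abs s < L")
      case True
      show ?thesis
      proof (cases "\<bar>s\<bar> \<le> K")
        case sK: True
        have "norm (X s) / \<bar>s\<bar> \<le> \<alpha> / \<rho>"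
          using True sK \<rho> \<alpha> X\<alpha> by (intro frac_le) auto
        then show ?thesis
          unfolding eq using True sK by (auto simp: ennreal_leI abs_le_iff)
      next
        case False
        then show ?thesis
          unfolding eq using True by auto
      qed
    qed (simp add: eq del: add_0)
  qed
  also have "\<dots> = ennreal (\<alpha> / \<rho>) * emeasure lborel {-K..K} + (\<integral>\<^sup>+s. ennreal (?f s) \<partial>lborel)"
    by (subst nn_integral_add) (auto simp: nn_integral_cmult_indicator)
  also have "ennreal (\<alpha> / \<rho>) * emeasure lborel {-K..K} = ennreal (2 * K * \<alpha> / \<rho>)"
    using K \<alpha> \<rho> by (simp add: ennreal_mult[symmetric] algebra_simps)
  also have "(\<integral>\<^sup>+s. ennreal (?f s) \<partial>lborel) = ennreal (LBINT s:?A. norm (X s) / \<bar>s\<bar>)"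
    unfolding set_lebesgue_integral_def by (intro nn_integral_eq_integral int) (auto simp: indicator_def)
  also have "ennreal (2 * K * \<alpha> / \<rho>) + ennreal (LBINT s:?A. norm (X s) / \<bar>s\<bar>) = ennreal (2 * K * \<alpha> / \<rho> + (LBINT s:?A. norm (X s) / \<bar>s\<bar>))"
    using K \<alpha> \<rho> by (subst ennreal_plus)
      (auto simp: set_lebesgue_integral_def intro!: integral_nonneg_AE)
  finally show ?thesis .
qed

theorem theorem1p6:
  fixes M :: "'a measure" and S \<psi> :: "nat \<Rightarrow> 'a \<Rightarrow> real"
    and r' :: nat and r \<sigma>2 :: real
  assumes "prob_space M"
    and "\<And>n. n \<ge> 1 \<Longrightarrow> S n \<in> borel_measurable M"
    and "\<And>n. n \<ge> 1 \<Longrightarrow> \<psi> n \<in> borel_measurable M"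
    and "\<And>n. n \<ge> 1 \<Longrightarrow> AE \<omega> in M. \<psi> n \<omega> \<ge> 0"
    and "\<And>n. n \<ge> 1 \<Longrightarrow> integrable M (\<psi> n)"
    and "\<And>n. n \<ge> 1 \<Longrightarrow> integral\<^sup>L M (\<psi> n) = 1"
    and "r' \<ge> 1" and "r \<ge> 1"
    and "assm_alpha M S \<psi> r' \<sigma>2"
    and "assm_beta M S \<psi>"
    and "assm_delta M S \<psi> r"
  shows "\<exists>P :: nat \<Rightarrow> real poly. \<forall>\<epsilon>>0. \<forall>\<^sub>F n in sequentially. \<forall>x::real.
           \<bar>measure (density M (\<lambda>\<omega>. ennreal (\<psi> n \<omega>))) {\<omega>\<in>space M. S n \<omega> / sqrt (real n) \<le> x}
             - gauss_cdf \<sigma>2 x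
             - normal_density 0 (sqrt \<sigma>2) x *
                 (\<Sum>k=1..min r' (nat \<lfloor>r\<rfloor>). poly (P k) x / real n powr (real k / 2))\<bar>
           \<le> \<epsilon> * real n powr (- min r (real r') / 2)"
proof -
  let ?X = "charf M S \<psi>"
  define N where "N = min r' (nat \<lfloor>r\<rfloor>)"
  define \<mu> where "\<mu> = min r (real r')"
  define v where "v n = 1 / sqrt (real n)" for n :: nat
  have c: "\<sigma>2 > 0"
    using assms(9) by (simp add: assm_alpha_def)
  define \<sigma> where "\<sigma> = sqrt \<sigma>2"
  have \<sigma>: "\<sigma> > 0" "\<sigma>^2 = \<sigma>2"
    using c by (auto simp: \<sigma>_def)
  \<comment> \<open>The strict inequality makes the truncation error
    \<open>n powr (- (N + 1) / 2)\<close> negligible, also for non-integer \<open>r\<close>.\<close>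
  have N\<mu>: "\<mu> < real N + 1"
  proof (cases "r' \<le> nat \<lfloor>r\<rfloor>")
    case True
    then show ?thesis
      by (simp add: N_def \<mu>_def min_def)
  next
    case False
    then have "real N = of_int \<lfloor>r\<rfloor>"
      using \<open>r \<ge> 1\<close> by (simp add: N_def)
    moreover have "r < of_int \<lfloor>r\<rfloor> + 1"
      by linarith
    ultimately show ?thesis
      unfolding \<mu>_def min_less_iff_disj by linarith
  qed
  have vpow: "v n ^ k = real n powr (- (real k / 2))" if "n \<ge> 1" for n k
    unfolding v_def using inverse_sqrt_power_eq[OF that, of k] by simp

  define \<nu> where "\<nu> n = distr (density M (\<lambda>\<omega>. ennreal (\<psi> n \<omega>))) borel (\<lambda>\<omega>. S n \<omega> / sqrt (real n))" for n
  have law: "real_distribution (\<nu> n)" "char (\<nu> n) t = ?X n (t * v n)"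
    "cdf (\<nu> n) x = measure (density M (\<lambda>\<omega>. ennreal (\<psi> n \<omega>))) {\<omega>\<in>space M. S n \<omega> / sqrt (real n) \<le> x}"
    if n: "n \<ge> 1" for n t x
  proof -
    have "(\<lambda>\<omega>. S n \<omega> / sqrt (real n)) \<in> borel_measurable M"
      using assms(2)[OF n] by measurable
    note law = law_properties[OF this assms(3-6)[OF n]]
    show "real_distribution (\<nu> n)" "char (\<nu> n) t = ?X n (t * v n)"
      "cdf (\<nu> n) x = measure (density M (\<lambda>\<omega>. ennreal (\<psi> n \<omega>))) {\<omega>\<in>space M. S n \<omega> / sqrt (real n) \<le> x}"
      unfolding \<nu>_def using law by (auto simp: charf_def v_def)
  qed
  have X_char: "?X n s = char (\<nu> n) (s * sqrt (real n))" if "n \<ge> 1" for n s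
    using law(2)[OF that, of "s * sqrt (real n)"] that by (simp add: v_def)
  have X_meas: "?X n \<in> borel_measurable borel" and X_le: "norm (?X n s) \<le> 1" and X_0: "?X n 0 = 1"
    if n: "n \<ge> 1" for n s
  proof -
    interpret real_distribution "\<nu> n"
      by (rule law(1)[OF n])
    have "?X n = (\<lambda>s. char (\<nu> n) (s * sqrt (real n)))"
      using X_char[OF n] by blast
    then show "?X n \<in> borel_measurable borel"
      by simp
    show "norm (?X n s) \<le> 1" "?X n 0 = 1"
      using cmod_char_le_1 char_zero by (auto simp: X_char[OF n])
  qed

  obtain \<rho> and A0 :: "nat \<Rightarrow> complex poly" and d where \<rho>: "\<rho> > 0"
    and A0: "A0 0 = 1" "\<And>k. k \<ge> 1 \<Longrightarrow> poly (A0 k) 0 = 0"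
    and near0: "\<And>\<epsilon>. \<epsilon> > 0 \<Longrightarrow> \<forall>\<^sub>F n in sequentially. \<forall>t. abs t < \<rho> * sqrt (real n) \<longrightarrow>
       norm (?X n (t / sqrt (real n)) - of_real (exp (- (\<sigma>2 / 2 * t^2))) *
             (\<Sum>k\<le>d. poly (A0 k) (of_real t) * of_real (1 / sqrt (real n)) ^ k))
         \<le> \<epsilon> * (1 / sqrt (real n)) ^ r' * (abs t * cauchy t)"
    using alpha_near_expansion[OF assms(9,7) X_0] by blast
  \<comment> \<open>The degree \<open>d\<close> may be smaller than \<open>N\<close>; padding with
    zeros and passing to \<open>d'\<close> secures \<open>N \<le> d'\<close> without changing the
    sum.\<close>
  define A where "A k = (if k \<le> d then A0 k else 0)" for k
  have A: "A 0 = 1" "\<And>k. k \<ge> 1 \<Longrightarrow> poly (A k) 0 = 0"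
    using A0 by (auto simp: A_def)
  define d' where "d' = max d N"
  have near: "\<forall>\<^sub>F n in sequentially. \<forall>t. abs t < \<rho> * sqrt (real n) \<longrightarrow>
       norm (?X n (t * v n) - expansion_ft \<sigma>2 A d' (v n) t) \<le> \<epsilon> * v n ^ r' * (abs t * cauchy t)" if "\<epsilon> > 0" for \<epsilon>
  proof -
    have "(\<Sum>k\<le>d'. poly (A k) z * w ^ k) = (\<Sum>k\<le>d. poly (A0 k) z * w ^ k)" for z w :: complex
      by (rule sum.mono_neutral_cong_right) (auto simp: A_def d'_def)
    then show ?thesis
      using near0[OF that] by (simp add: expansion_ft_def v_def)
  qed
  obtain C1 where C1: "C1 > 0" "\<And>n t. n \<ge> 1 \<Longrightarrow>
       norm (expansion_ft \<sigma>2 A d' (v n) t - expansion_ft \<sigma>2 A N (v n) t) \<le> C1 * v n ^ (N + 1) * (abs t * cauchy t)"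
    using expansion_ft_truncate[where A = A and N = N and d = d', OF c A(2)] unfolding v_def d'_def by auto
  obtain C2 where C2: "C2 > 0" "\<And>n t. n \<ge> 1 \<Longrightarrow> \<rho> * sqrt (real n) \<le> \<bar>t\<bar> \<Longrightarrow>
       norm (expansion_ft \<sigma>2 A N (v n) t) \<le> C2 * v n ^ (r' + 1) * (abs t * cauchy t)"
    using expansion_ft_tail[where A = A and N = N and m = r', OF c \<rho>] unfolding v_def by blast

  have "\<exists>P. \<forall>t. ft lborel (gauss_poly \<sigma> (gauss_deriv \<sigma> P)) t = poly (A k) (of_real t) * exp (- (\<sigma>^2 * t^2 / 2))" if "k \<ge> 1" for k
    using exists_gauss_primitive_ft[OF \<sigma>(1) A(2)[OF that]] .
  then obtain P where P: "\<And>k t. k \<ge> 1 \<Longrightarrow> ft lborel (gauss_poly \<sigma> (gauss_deriv \<sigma> (P k))) t = poly (A k) (of_real t) * exp (- (\<sigma>^2 * t^2 / 2))"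
    by metis
  define g where "g n = edgeworth_density \<sigma> P N (v n)" for n
  have g_ft: "ft lborel (g n) t = expansion_ft \<sigma>2 A N (v n) t" for n t
    unfolding g_def using edgeworth_density_ft[where A = A and P = P, OF \<sigma>(1) A(1) P] by (simp add: \<sigma>)
  obtain Kg where Kg: "Kg > 0" "\<And>v x. 0 \<le> v \<Longrightarrow> v \<le> 1 \<Longrightarrow> norm (edgeworth_density \<sigma> P N v x) \<le> Kg"
    using edgeworth_density_bounded[OF \<sigma>(1)] by blast
  define CE where "CE = esseen_const"
  have CE: "CE > 0"
    by (simp add: CE_def esseen_const_pos)

  show ?thesis
  \<comment> \<open>The polynomials \<open>P k\<close> are complex, but only the real part of the
    candidate is compared with the distribution function.\<close>
  proof (intro exI[of _ "\<lambda>k. map_poly Re (P k)"] allI impI)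
    fix \<epsilon> :: real assume \<epsilon>: "\<epsilon> > 0"
    \<comment> \<open>Chosen so that the cut-off error \<open>CE * Kg / T\<close> equals
      \<open>\<epsilon> / 4 * n powr (- r / 2)\<close>; assumption (delta) is available for every
      such \<open>B\<close>.\<close>
    define B where "B = 4 * CE * Kg / \<epsilon>"
    have B: "B > 0"
      using CE Kg \<epsilon> by (simp add: B_def)
    \<comment> \<open>The \<open>pi\<close> is the integral of \<open>cauchy\<close>.\<close>
    define \<eta> where "\<eta> = \<epsilon> / (4 * CE * pi)"
    have \<eta>: "\<eta> > 0"
      using CE \<epsilon> by (simp add: \<eta>_def)
    define L where "L n = B * real n powr ((r - 1) / 2)" for n
    from assms(11) B obtain K where K: "K > 0"
      and delta: "(\<lambda>n. LBINT s:{s. K < \<bar>s\<bar> \<and> abs s < L n}. norm (?X n s) / \<bar>s\<bar>) \<in> o(\<lambda>n. real n powr (- r / 2))"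
      unfolding assm_delta_def L_def by blast
    \<comment> \<open>If \<open>K < \<rho>\<close> this set is empty and the bound from assumption
      (beta) is vacuous, as is the range where it is used.\<close>
    have "compact ({-K..K} - {-\<rho><..<\<rho>})" "{-K..K} - {-\<rho><..<\<rho>} \<subseteq> - {0}"
      using \<rho> by (auto intro: compact_diff)
    with assms(10) obtain a where a: "a \<in> SP" "\<And>n s. n \<ge> 1 \<Longrightarrow> s \<in> {-K..K} - {-\<rho><..<\<rho>} \<Longrightarrow> norm (?X n s) \<le> a n"
      unfolding assm_beta_def by meson
    define J where "J n = (LBINT s:{s. K < \<bar>s\<bar> \<and> abs s < L n}. norm (?X n s) / \<bar>s\<bar>)" for n
    have J0: "J n \<ge> 0" for n
      unfolding J_def set_lebesgue_integral_def by (intro integral_nonneg_AE) (auto simp: indicator_def)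
    have \<mu>: "\<mu> / 2 > 0" "\<mu> \<le> r" "\<mu> \<le> real r'"
      using assms(7,8) by (auto simp: \<mu>_def)
    define e1 where "e1 = \<epsilon> / (4 * CE) * (\<rho> / (2 * K))"
    have e1: "e1 > 0"
      using \<epsilon> CE \<rho> K by (simp add: e1_def)
    have e2: "\<epsilon> / (4 * CE) > 0"
      using \<epsilon> CE by simp
    have ev1: "\<forall>\<^sub>F n in sequentially. C1 * real n powr (- ((real N + 1) / 2)) \<le> \<eta> / 2 * real n powr (- (\<mu> / 2))"
      using N\<mu> \<eta> by (intro eventually_powr_le) auto
    have ev2: "\<forall>\<^sub>F n in sequentially. C2 * real n powr (- ((real r' + 1) / 2)) \<le> \<eta> * real n powr (- (\<mu> / 2))"
      using \<mu> \<eta> by (intro eventually_powr_le) auto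
    have ev3: "\<forall>\<^sub>F n in sequentially. J n \<le> \<epsilon> / (4 * CE) * real n powr (- r / 2)"
      using landau_o.smallD[OF delta e2] J0 unfolding J_def[symmetric] by simp
    show "\<forall>\<^sub>F n in sequentially. \<forall>x::real.
           \<bar>measure (density M (\<lambda>\<omega>. ennreal (\<psi> n \<omega>))) {\<omega>\<in>space M. S n \<omega> / sqrt (real n) \<le> x}
             - gauss_cdf \<sigma>2 x
             - normal_density 0 (sqrt \<sigma>2) x *
                 (\<Sum>k=1..min r' (nat \<lfloor>r\<rfloor>). poly (map_poly Re (P k)) x / real n powr (real k / 2))\<bar>
           \<le> \<epsilon> * real n powr (- min r (real r') / 2)"
      using eventually_ge_at_top[of 1] near[OF half_gt_zero[OF \<eta>]] ev1 ev2 ev3 SP_D[OF a(1) \<mu>(1) e1]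
    proof eventually_elim
      case (elim n)
      note n = elim(1)
      define q where "q = sqrt (real n)"
      have q: "q > 0" "t * v n = t / q" for t
        using n by (auto simp: q_def v_def)
      define m where "m = real n powr (- (\<mu> / 2))"
      have m: "m > 0"
        using n by (simp add: m_def)
      have v: "0 \<le> v n" "v n \<le> 1"
        using n by (auto simp: v_def)
      have rm: "real n powr (- r / 2) \<le> m" "v n ^ r' \<le> m"
        unfolding m_def vpow[OF n] using n \<mu> by (auto intro!: powr_mono)
      define T where "T = B * real n powr (r / 2)"
      have T: "T > 0"
        using B n by (simp add: T_def)
      \<comment> \<open>The Esseen cut-off in \<open>t\<close> corresponds exactly to the upper
        limit of the integral in assumption (delta) in \<open>s\<close>, because
        \<open>n powr ((r - 1) / 2)\<close> times \<open>sqrt n\<close> is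
        \<open>n powr (r / 2)\<close>.\<close>
      have TL: "T = L n * q"
        using n by (simp add: T_def L_def q_def powr_half_sqrt[symmetric] powr_add[symmetric] field_simps)
      define \<alpha> where "\<alpha> = \<bar>a n\<bar>"
      have near_le: "norm (?X n (t * v n) - ft lborel (g n) t) \<le> \<eta> * m * (abs t * cauchy t)" if t: "abs t < \<rho> * q" for t
      proof -
        have "norm (?X n (t * v n) - ft lborel (g n) t)
            \<le> norm (?X n (t * v n) - expansion_ft \<sigma>2 A d' (v n) t) + norm (expansion_ft \<sigma>2 A d' (v n) t - expansion_ft \<sigma>2 A N (v n) t)"
          unfolding g_ft by (rule order_trans[OF _ norm_triangle_ineq]) simp
        also have "\<dots> \<le> \<eta> / 2 * v n ^ r' * (abs t * cauchy t) + C1 * v n ^ (N + 1) * (abs t * cauchy t)"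
          using elim(2) t C1(2)[OF n] by (intro add_mono) (auto simp: q_def)
        also have "\<dots> \<le> \<eta> / 2 * m * (abs t * cauchy t) + \<eta> / 2 * m * (abs t * cauchy t)"
        proof (intro add_mono mult_right_mono mult_left_mono rm)
          show "C1 * v n ^ (N + 1) \<le> \<eta> / 2 * m"
            using elim(3) by (simp only: vpow[OF n] m_def of_nat_add of_nat_1)
        qed (use \<eta> in \<open>auto simp: add_nonneg_nonneg\<close>)
        finally show ?thesis
          by simp
      qed
      have tail_le: "norm (ft lborel (g n) t) \<le> \<eta> * m * (abs t * cauchy t)" if t: "\<rho> * q \<le> \<bar>t\<bar>" for t
      proof -
        have "norm (ft lborel (g n) t) \<le> C2 * v n ^ (r' + 1) * (abs t * cauchy t)"
          unfolding g_ft using t C2(2)[OF n] by (simp add: q_def)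
        also have "\<dots> \<le> \<eta> * m * (abs t * cauchy t)"
        proof (rule mult_right_mono)
          show "C2 * v n ^ (r' + 1) \<le> \<eta> * m"
            using elim(4) by (simp only: vpow[OF n] m_def of_nat_add of_nat_1)
        qed (simp add: add_nonneg_nonneg)
        finally show ?thesis .
      qed
      \<comment> \<open>The first term covers both the difference at small frequencies and the
        candidate alone at large ones: the ranges are disjoint and share the majorant
        \<open>\<eta> * m * cauchy t\<close>.\<close>
      define I where "I = \<eta> * m * pi + (2 * K * \<alpha> / \<rho> + J n)"
      have I0: "I \<ge> 0"
        using \<eta> m K \<rho> J0[of n] by (simp add: I_def \<alpha>_def)
      have "(\<integral>\<^sup>+t. indicator {-T<..<T} t * ennreal (norm (char (\<nu> n) t - ft lborel (g n) t) / \<bar>t\<bar>) \<partial>lborel)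
          \<le> (\<integral>\<^sup>+t. ennreal (\<eta> * m * cauchy t) +
                indicator {t. \<rho> * q \<le> \<bar>t\<bar> \<and> abs t < L n * q} t * ennreal (norm (?X n (t / q)) / \<bar>t\<bar>) \<partial>lborel)"
      proof (rule nn_integral_mono)
        fix t :: real
        \<comment> \<open>At \<open>t = 0\<close> the quotient is 0 by convention, so nonnegativity
          of the right-hand side is enough.\<close>
        have divide: "x / \<bar>t\<bar> \<le> \<eta> * m * cauchy t" if "x \<le> \<eta> * m * (abs t * cauchy t)" for x
        proof (cases "t = 0")
          case False
          then show ?thesis
            using that by (simp add: pos_divide_le_eq mult_ac)
        qed (use \<eta> m in \<open>simp add: add_nonneg_nonneg\<close>)
        show "indicator {-T<..<T} t * ennreal (norm (char (\<nu> n) t - ft lborel (g n) t) / \<bar>t\<bar>)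
            \<le> ennreal (\<eta> * m * cauchy t) +
              indicator {t. \<rho> * q \<le> \<bar>t\<bar> \<and> abs t < L n * q} t * ennreal (norm (?X n (t / q)) / \<bar>t\<bar>)"
        proof (cases "t \<in> {-T<..<T}")
          case True
          then have tT: "abs t < L n * q"
            by (auto simp: TL)
          show ?thesis
          proof (cases "abs t < \<rho> * q")
            case near: True
            have "norm (char (\<nu> n) t - ft lborel (g n) t) / \<bar>t\<bar> \<le> \<eta> * m * cauchy t"
              unfolding law(2)[OF n] by (rule divide[OF near_le[OF near]])
            then show ?thesis
              using True near by (simp add: ennreal_leI)
          next
            case False
            then have far: "\<rho> * q \<le> \<bar>t\<bar>"
              by simp
            have "norm (char (\<nu> n) t - ft lborel (g n) t) / \<bar>t\<bar> \<le> norm (ft lborel (g n) t) / \<bar>t\<bar> + norm (?X n (t / q)) / \<bar>t\<bar>"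
              unfolding law(2)[OF n] q(2) add_divide_distrib[symmetric]
              by (intro divide_right_mono) (auto simp: norm_triangle_ineq4 add.commute intro: order_trans[OF norm_triangle_ineq4])
            also have "\<dots> \<le> \<eta> * m * cauchy t + norm (?X n (t / q)) / \<bar>t\<bar>"
              by (intro add_mono divide tail_le far order_refl)
            finally show ?thesis
              using True far tT \<eta> m by (simp add: ennreal_leI ennreal_plus[symmetric] add_nonneg_nonneg del: ennreal_plus)
          qed
        qed simp
      qed
      also have "\<dots> = (\<integral>\<^sup>+t. ennreal (\<eta> * m * cauchy t) \<partial>lborel) +
          (\<integral>\<^sup>+t. indicator {t. \<rho> * q \<le> \<bar>t\<bar> \<and> abs t < L n * q} t * ennreal (norm (?X n (t / q)) / \<bar>t\<bar>) \<partial>lborel)"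
      proof -
        note X_meas[OF n, measurable]
        show ?thesis
          by (rule nn_integral_add) measurable
      qed
      also have "(\<integral>\<^sup>+t. ennreal (\<eta> * m * cauchy t) \<partial>lborel) = ennreal (\<eta> * m * pi)"
      proof (subst nn_integral_eq_integral)
        show "integrable lborel (\<lambda>t. \<eta> * m * cauchy t)"
          using integrable_inverse_square_plus_1 by (rule integrable_mult_right)
        show "ennreal (LBINT t. \<eta> * m * cauchy t) = ennreal (\<eta> * m * pi)"
          by (simp only: integral_mult_right_zero integral_inverse_square_plus_1)
      qed (use \<eta> m in \<open>simp add: add_nonneg_nonneg\<close>)
      also have "ennreal (\<eta> * m * pi) + (\<integral>\<^sup>+t. indicator {t. \<rho> * q \<le> \<bar>t\<bar> \<and> abs t < L n * q} t * ennreal (norm (?X n (t / q)) / \<bar>t\<bar>) \<partial>lborel)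
          \<le> ennreal (\<eta> * m * pi) + ennreal (2 * K * \<alpha> / \<rho> + J n)"
        unfolding J_def
      proof (intro add_left_mono far_integral_le X_meas[OF n] X_le[OF n] q(1) \<rho> K)
        show "norm (?X n s) \<le> \<alpha>" if "\<rho> \<le> \<bar>s\<bar>" "\<bar>s\<bar> \<le> K" for s
        proof -
          have "s \<in> {-K..K} - {-\<rho><..<\<rho>}"
            using that by auto
          from a(2)[OF n this] show ?thesis
            by (simp add: \<alpha>_def)
        qed
      qed (simp add: \<alpha>_def)
      also have "\<dots> = ennreal I"
        unfolding I_def using \<eta> m K \<rho> J0[of n] by (intro ennreal_plus[symmetric]) (auto simp: \<alpha>_def)
      finally have "(\<integral>\<^sup>+t. indicator {-T<..<T} t * ennreal (norm (char (\<nu> n) t - ft lborel (g n) t) / \<bar>t\<bar>) \<partial>lborel) \<le> ennreal I" .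
      moreover have "\<bar>Re (g n y)\<bar> \<le> Kg" for y
        using order_trans[OF abs_Re_le_cmod Kg(2)[OF v]] by (simp add: g_def)
      moreover have "complex_integrable lborel (g n)"
        unfolding g_def by (rule edgeworth_density_integrable[OF \<sigma>(1)])
      ultimately have "\<bar>cdf (\<nu> n) x - Re (lower_mass lborel (g n) x)\<bar> \<le> CE * (I + Kg / T)" for x
        unfolding CE_def by (intro esseen_smoothing_inequality law(1)[OF n] Kg T I0)
      \<comment> \<open>Four quarters of \<open>\<epsilon> * m\<close>: the common majorant, the
        middle frequencies, the integral of assumption (delta), and the cut-off error.\<close>
      also have "CE * (I + Kg / T) \<le> CE * (\<epsilon> / (4 * CE) * m + (\<epsilon> / (4 * CE) * m + \<epsilon> / (4 * CE) * m) + \<epsilon> / (4 * CE) * m)"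
        unfolding I_def
      proof (intro mult_left_mono add_mono)
        show "\<eta> * m * pi \<le> \<epsilon> / (4 * CE) * m"
          by (simp add: \<eta>_def)
        have "2 * K * \<alpha> / \<rho> \<le> 2 * K * (e1 * m) / \<rho>"
          using elim(6) K \<rho> by (intro divide_right_mono mult_left_mono) (auto simp: \<alpha>_def m_def)
        also have "\<dots> = \<epsilon> / (4 * CE) * m"
          using K \<rho> by (simp add: e1_def)
        finally show "2 * K * \<alpha> / \<rho> \<le> \<epsilon> / (4 * CE) * m" .
        show "J n \<le> \<epsilon> / (4 * CE) * m"
          using elim(5) mult_left_mono[OF rm(1), of "\<epsilon> / (4 * CE)"] e2 by linarith
        have "Kg / T = \<epsilon> / (4 * CE) * real n powr (- r / 2)"
          using Kg CE \<epsilon> by (simp add: T_def B_def powr_minus_divide)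
        also have "\<dots> \<le> \<epsilon> / (4 * CE) * m"
          using e2 by (intro mult_left_mono rm) simp
        finally show "Kg / T \<le> \<epsilon> / (4 * CE) * m" .
      qed (use CE in simp)
      also have "\<dots> = \<epsilon> * m"
        using CE by (simp add: field_simps)
      finally have le: "\<bar>cdf (\<nu> n) x - Re (lower_mass lborel (g n) x)\<bar> \<le> \<epsilon> * m" for x .
      have low: "Re (lower_mass lborel (g n) x) = gauss_cdf \<sigma>2 x + normal_density 0 (sqrt \<sigma>2) x *
                 (\<Sum>k=1..min r' (nat \<lfloor>r\<rfloor>). poly (map_poly Re (P k)) x / real n powr (real k / 2))" for x
      proof -
        have v_div: "y * v n ^ k = y / real n powr (real k / 2)" for y k
          using n by (simp add: vpow powr_minus_divide)
        show ?thesis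
          using edgeworth_density_lower_mass[OF \<sigma>(1), of P N "v n" x]
          by (simp only: g_def gauss_cdf_def \<sigma>_def N_def v_div)
      qed
      show ?case
        using le by (simp add: low law(3)[OF n] m_def \<mu>_def diff_diff_eq)
    qed
  qed
qed

end
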